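(* Let $(M,g,J,\psi_{\mathbb C})$ be a closed, connected nearly Kähler six-manifold with an effective action of the two-torus $T^2$ preserving $g$, $J$ and $\psi_\pm$, let $U,V$ be the generating vector fields of the action, and let $\nu_M\colon M\to\mathbb R$, $\nu_M(p)=\sigma_p(U_p,V_p)$. Then $\nu_M$ has non-zero regular values. For any regular value $s$ of $\nu_M$, the $T^2$-action on $\nu_M^{-1}(s)$ is free; thus $\nu_M^{-1}(s)/T^2$ is a smooth three-dimensional manifold.
   Context: Let $M$ be a closed (compact, without boundary), connected smooth six-manifold. An $\mathrm{SU}(3)$-structure on $M$ consists of a Riemannian metric $g$, an almost complex structure $J$ which is an isometry of each tangent space, and a complex volume form $\psi_{\mathbb C}=\psi_++i\psi_-$ of type $(3,0)$, with fundamental two-form $\sigma:=g(J\cdot,\cdot)$, such that at each point $p$ there is an orthonormal basis $\{F_k,JF_k\}_{k=1,2,3}$ of $T_pM$, with dual basis $\{f_k,Jf_k\}_{k=1,2,3}$ ($Jf_k$ denoting the element dual to $JF_k$), for which $\sigma=\sum_{k=1}^3 f_k\wedge Jf_k$ and $\psi_{\mathbb C}=(f_1+iJf_1)\wedge(f_2+iJf_2)\wedge(f_3+iJf_3)$. The structure is called nearly Kähler if $$d\sigma=3\psi_+,\qquad d\psi_-=-2\,\sigma\wedge\sigma .$$ The generating vector fields $U,V$ are those of the action induced by a basis of the Lie algebra $\mathfrak t^2$ of $T^2$; in particular $[U,V]=0$. The function $\nu_M=\sigma(U,V)$ is called the multi-moment map; it is $T^2$-invariant and satisfies $d\nu_M=3\psi_+(U,V,\cdot)$.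 A regular value means a value $s\in\nu_M(M)$ such that $(d\nu_M)_p\neq 0$ for all $p\in\nu_M^{-1}(s)$. *)

theory Defs
  imports "HOL-Analysis.Analysis" "HOL-Algebra.Group_Action"
begin

section \<open>Smooth manifolds\<close>

text \<open>Only meant for an open set \<open>S\<close> in a finite-dimensional domain, where having all iterated
  directional derivatives differentiable is the usual notion of smoothness.\<close>

primrec Ck_on :: "nat \<Rightarrow> 'a::euclidean_space set \<Rightarrow> ('a \<Rightarrow> 'b::real_normed_vector) \<Rightarrow> bool" where
  "Ck_on 0 S f \<longleftrightarrow> continuous_on S f"
| "Ck_on (Suc n) S f \<longleftrightarrow>
     (\<forall>x\<in>S. f differentiable (at x)) \<and> (\<forall>v. Ck_on n S (\<lambda>x. frechet_derivative f (at x) v))"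

definition smooth_on :: "'a::euclidean_space set \<Rightarrow> ('a \<Rightarrow> 'b::real_normed_vector) \<Rightarrow> bool" where
  "smooth_on S f \<longleftrightarrow> (\<forall>n. Ck_on n S f)"

text \<open>A chart is a pair of a domain and a coordinate map; the values of the coordinate map outside
  its domain are irrelevant. The dimension of a manifold is that of the model space \<open>'e\<close>.\<close>

type_synonym ('p, 'e) chart = "'p set \<times> ('p \<Rightarrow> 'e)"

definition chart_image :: "('p, 'e) chart \<Rightarrow> 'e set" where
  "chart_image c = snd c ` fst c"

definition chart_inv :: "('p, 'e) chart \<Rightarrow> 'e \<Rightarrow> 'p" where
  "chart_inv c = inv_into (fst c) (snd c)"

text \<open>Coordinate representation of a map \<open>F\<close> in charts \<open>c\<close>, \<open>c'\<close>, and its domain.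
  For \<open>F = id\<close> these are the change of coordinates and the image of the overlap.\<close>

definition coord_rep :: "('p, 'e) chart \<Rightarrow> ('q, 'f) chart \<Rightarrow> ('p \<Rightarrow> 'q) \<Rightarrow> 'e \<Rightarrow> 'f" where
  "coord_rep c c' F x = snd c' (F (chart_inv c x))"

definition coord_dom :: "('p, 'e) chart \<Rightarrow> ('q, 'f) chart \<Rightarrow> ('p \<Rightarrow> 'q) \<Rightarrow> 'e set" where
  "coord_dom c c' F = {x \<in> chart_image c. F (chart_inv c x) \<in> fst c'}"

definition smooth_manifold :: "'p topology \<Rightarrow> ('p, 'e::euclidean_space) chart set \<Rightarrow> bool" where
  "smooth_manifold X A \<longleftrightarrow>
     Hausdorff_space X \<and> second_countable X \<and>
     (\<forall>c\<in>A. openin X (fst c) \<and> open (chart_image c) \<and>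
        homeomorphic_map (subtopology X (fst c)) (top_of_set (chart_image c)) (snd c)) \<and>
     (\<Union>c\<in>A. fst c) = topspace X \<and>
     (\<forall>c\<in>A. \<forall>c'\<in>A. smooth_on (coord_dom c c' id) (coord_rep c c' id))"

definition smooth_map ::
  "'p topology \<Rightarrow> ('p, 'e::euclidean_space) chart set \<Rightarrow>
   'q topology \<Rightarrow> ('q, 'f::euclidean_space) chart set \<Rightarrow> ('p \<Rightarrow> 'q) \<Rightarrow> bool" where
  "smooth_map X A Y B F \<longleftrightarrow> continuous_map X Y F \<and>
     (\<forall>c\<in>A. \<forall>c'\<in>B. smooth_on (coord_dom c c' F) (coord_rep c c' F))"

definition smooth_immersion ::
  "'p topology \<Rightarrow> ('p, 'e::euclidean_space) chart set \<Rightarrow>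
   'q topology \<Rightarrow> ('q, 'f::euclidean_space) chart set \<Rightarrow> ('p \<Rightarrow> 'q) \<Rightarrow> bool" where
  "smooth_immersion X A Y B F \<longleftrightarrow> smooth_map X A Y B F \<and>
     (\<forall>c\<in>A. \<forall>c'\<in>B. \<forall>x\<in>coord_dom c c' F. inj (frechet_derivative (coord_rep c c' F) (at x)))"

definition smooth_submersion ::
  "'p topology \<Rightarrow> ('p, 'e::euclidean_space) chart set \<Rightarrow>
   'q topology \<Rightarrow> ('q, 'f::euclidean_space) chart set \<Rightarrow> ('p \<Rightarrow> 'q) \<Rightarrow> bool" where
  "smooth_submersion X A Y B F \<longleftrightarrow> smooth_map X A Y B F \<and>
     (\<forall>c\<in>A. \<forall>c'\<in>B. \<forall>x\<in>coord_dom c c' F. surj (frechet_derivative (coord_rep c c' F) (at x)))"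

definition prod_atlas ::
  "('p, 'e) chart set \<Rightarrow> ('q, 'f) chart set \<Rightarrow> ('p \<times> 'q, 'e \<times> 'f) chart set" where
  "prod_atlas A B = {(fst c \<times> fst d, map_prod (snd c) (snd d)) | c d. c \<in> A \<and> d \<in> B}"

definition quotient_topology :: "'p topology \<Rightarrow> ('p \<Rightarrow> 'q) \<Rightarrow> 'q topology" where
  "quotient_topology X f =
     topology (\<lambda>W. W \<subseteq> f ` topspace X \<and> openin X {p \<in> topspace X. f p \<in> W})"

lemma openin_quotient_topology:
  "openin (quotient_topology X f) W \<longleftrightarrow>
     W \<subseteq> f ` topspace X \<and> openin X {p \<in> topspace X. f p \<in> W}"
proof -
  let ?L = "\<lambda>W. W \<subseteq> f ` topspace X \<and> openin X {p \<in> topspace X. f p \<in> W}"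
  have "istopology ?L"
    unfolding istopology_def
  proof (intro conjI allI impI)
    fix S T assume S: "?L S" and T: "?L T"
    show "S \<inter> T \<subseteq> f ` topspace X" using S by blast
    have "{p \<in> topspace X. f p \<in> S \<inter> T} =
        {p \<in> topspace X. f p \<in> S} \<inter> {p \<in> topspace X. f p \<in> T}" by auto
    then show "openin X {p \<in> topspace X. f p \<in> S \<inter> T}" using S T by (simp add: openin_Int)
  next
    fix K assume K: "\<forall>W\<in>K. ?L W"
    then show "\<Union>K \<subseteq> f ` topspace X" by blast
    have "{p \<in> topspace X. f p \<in> \<Union>K} = (\<Union>W\<in>K. {p \<in> topspace X. f p \<in> W})" by auto
    moreover have "openin X (\<Union>W\<in>K. {p \<in> topspace X. f p \<in> W})"
      using K by (intro openin_Union) blast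
    ultimately show "openin X {p \<in> topspace X. f p \<in> \<Union>K}" by (simp only:)
  qed
  then have "openin (topology ?L) = ?L" by (rule topology_inverse')
  then show ?thesis by (simp only: quotient_topology_def)
qed

lemma quotient_map_quotient_topology: "quotient_map X (quotient_topology X f) f"
proof -
  have "{p \<in> topspace X. f p \<in> f ` topspace X} = topspace X" by auto
  then have "openin X {p \<in> topspace X. f p \<in> f ` topspace X}" by (simp only: openin_topspace)
  then have "openin (quotient_topology X f) (f ` topspace X)"
    by (simp only: openin_quotient_topology subset_refl simp_thms)
  then have "f ` topspace X \<subseteq> topspace (quotient_topology X f)" by (rule openin_subset)
  moreover have "topspace (quotient_topology X f) \<subseteq> f ` topspace X"
    using openin_topspace[of "quotient_topology X f"] by (simp only: openin_quotient_topology)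
  ultimately have top: "f ` topspace X = topspace (quotient_topology X f)" by (rule subset_antisym)
  show ?thesis
    unfolding quotient_map_def
  proof (intro conjI allI impI)
    show "f ` topspace X = topspace (quotient_topology X f)" by (rule top)
  next
    fix W assume "W \<subseteq> topspace (quotient_topology X f)"
    then show "openin X {p \<in> topspace X. f p \<in> W} = openin (quotient_topology X f) W"
      by (simp only: openin_quotient_topology top[symmetric] simp_thms)
  qed
qed


section \<open>Tensor fields and differential forms\<close>

text \<open>A covariant tensor of degree \<open>k\<close> is a function of lists of \<open>k\<close> vectors.\<close>

definition multilin :: "nat \<Rightarrow> ('e::real_vector list \<Rightarrow> 'b::real_vector) \<Rightarrow> bool" where
  "multilin k \<alpha> \<longleftrightarrow> (\<forall>vs. length vs = k \<longrightarrow> (\<forall>i<k. linear (\<lambda>v. \<alpha> (vs[i := v]))))"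

definition alternating :: "nat \<Rightarrow> ('e list \<Rightarrow> 'b::zero) \<Rightarrow> bool" where
  "alternating k \<alpha> \<longleftrightarrow> (\<forall>vs. length vs = k \<and> \<not> distinct vs \<longrightarrow> \<alpha> vs = 0)"

text \<open>Tensor fields are given by their representatives on the images of all the charts of an atlas,
  subject to the transformation law under changes of coordinates: \<open>T c x\<close> is the tensor at the point
  with coordinates \<open>x\<close> in the chart \<open>c\<close>. The law is the case \<open>F = id\<close> of invariance under a
  smooth map \<open>F\<close>, which for covariant tensors reads \<open>F\<^sup>* T = T\<close>.\<close>

type_synonym ('p, 'e, 'b) tensor = "('p, 'e) chart \<Rightarrow> 'e \<Rightarrow> 'e list \<Rightarrow> 'b"
type_synonym ('p, 'e) endo = "('p, 'e) chart \<Rightarrow> 'e \<Rightarrow> 'e \<Rightarrow> 'e"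
type_synonym ('p, 'e) vfield = "('p, 'e) chart \<Rightarrow> 'e \<Rightarrow> 'e"

definition preserves_tensor ::
  "('p, 'e::euclidean_space) chart set \<Rightarrow> ('p \<Rightarrow> 'p) \<Rightarrow> nat \<Rightarrow> ('p, 'e, 'b) tensor \<Rightarrow> bool" where
  "preserves_tensor A F k T \<longleftrightarrow>
     (\<forall>c\<in>A. \<forall>c'\<in>A. \<forall>x\<in>coord_dom c c' F. \<forall>vs. length vs = k \<longrightarrow>
        T c' (coord_rep c c' F x) (map (frechet_derivative (coord_rep c c' F) (at x)) vs) = T c x vs)"

definition preserves_endo ::
  "('p, 'e::euclidean_space) chart set \<Rightarrow> ('p \<Rightarrow> 'p) \<Rightarrow> ('p, 'e) endo \<Rightarrow> bool" where
  "preserves_endo A F J \<longleftrightarrow>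
     (\<forall>c\<in>A. \<forall>c'\<in>A. \<forall>x\<in>coord_dom c c' F. \<forall>v.
        J c' (coord_rep c c' F x) (frechet_derivative (coord_rep c c' F) (at x) v) =
        frechet_derivative (coord_rep c c' F) (at x) (J c x v))"

definition tensor_field ::
  "('p, 'e::euclidean_space) chart set \<Rightarrow> nat \<Rightarrow> ('p, 'e, 'b::real_normed_vector) tensor \<Rightarrow> bool" where
  "tensor_field A k T \<longleftrightarrow>
     (\<forall>c\<in>A. (\<forall>x\<in>chart_image c. multilin k (T c x)) \<and>
        (\<forall>vs. length vs = k \<longrightarrow> smooth_on (chart_image c) (\<lambda>x. T c x vs))) \<and>
     preserves_tensor A id k T"

definition diff_form ::
  "('p, 'e::euclidean_space) chart set \<Rightarrow> nat \<Rightarrow> ('p, 'e, 'b::real_normed_vector) tensor \<Rightarrow> bool" where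
  "diff_form A k \<omega> \<longleftrightarrow> tensor_field A k \<omega> \<and> (\<forall>c\<in>A. \<forall>x\<in>chart_image c. alternating k (\<omega> c x))"

definition endo_field :: "('p, 'e::euclidean_space) chart set \<Rightarrow> ('p, 'e) endo \<Rightarrow> bool" where
  "endo_field A J \<longleftrightarrow>
     (\<forall>c\<in>A. (\<forall>x\<in>chart_image c. linear (J c x)) \<and>
        (\<forall>v. smooth_on (chart_image c) (\<lambda>x. J c x v))) \<and>
     preserves_endo A id J"

text \<open>Normalised so that \<open>(\<alpha> \<and> \<beta>)(v, w) = \<alpha>(v) \<beta>(w) - \<alpha>(w) \<beta>(v)\<close> for one-forms.\<close>

definition wedge ::
  "nat \<Rightarrow> nat \<Rightarrow> ('e list \<Rightarrow> 'b) \<Rightarrow> ('e list \<Rightarrow> 'b) \<Rightarrow> 'e list \<Rightarrow> 'b::real_normed_field" where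
  "wedge p q \<alpha> \<beta> vs =
     (\<Sum>\<pi> | \<pi> permutes {..<p + q}.
        of_int (sign \<pi>) * \<alpha> (map (\<lambda>i. vs ! \<pi> i) [0..<p]) * \<beta> (map (\<lambda>i. vs ! \<pi> i) [p..<p + q]))
     / (fact p * fact q)"

text \<open>Exterior derivative in coordinates: the invariant formula on constant vector fields,
  \<open>d\<omega>(v\<^sub>0, \<dots>, v\<^sub>k) = \<Sum>\<^sub>i (-1)^i v\<^sub>i(\<omega>(v\<^sub>0, \<dots>, v\<^sub>k with v\<^sub>i omitted))\<close>.\<close>

definition ext_deriv ::
  "('e::euclidean_space \<Rightarrow> 'e list \<Rightarrow> 'b::real_normed_vector) \<Rightarrow> 'e \<Rightarrow> 'e list \<Rightarrow> 'b" where
  "ext_deriv \<omega> x vs =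
     (\<Sum>i<length vs. (- 1) ^ i *\<^sub>R
        frechet_derivative (\<lambda>y. \<omega> y (take i vs @ drop (Suc i) vs)) (at x) (vs ! i))"


section \<open>SU(3)-structures and nearly Kaehler manifolds\<close>

definition riemannian_metric ::
  "('p, 'e::euclidean_space) chart set \<Rightarrow> ('p, 'e, real) tensor \<Rightarrow> bool" where
  "riemannian_metric A g \<longleftrightarrow> tensor_field A 2 g \<and>
     (\<forall>c\<in>A. \<forall>x\<in>chart_image c.
        (\<forall>v w. g c x [v, w] = g c x [w, v]) \<and> (\<forall>v. v \<noteq> 0 \<longrightarrow> g c x [v, v] > 0))"

definition almost_complex ::
  "('p, 'e::euclidean_space) chart set \<Rightarrow> ('p, 'e) endo \<Rightarrow> bool" where
  "almost_complex A J \<longleftrightarrow> endo_field A J \<and> (\<forall>c\<in>A. \<forall>x\<in>chart_image c. \<forall>v. J c x (J c x v) = - v)"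

definition fund_form ::
  "('p, 'e, real) tensor \<Rightarrow> ('p, 'e) endo \<Rightarrow> ('p, 'e, real) tensor" where
  "fund_form g J c x vs = g c x [J c x (vs ! 0), vs ! 1]"

definition re_part :: "('p, 'e, complex) tensor \<Rightarrow> ('p, 'e, real) tensor" where
  "re_part \<Psi> c x vs = Re (\<Psi> c x vs)"

definition im_part :: "('p, 'e, complex) tensor \<Rightarrow> ('p, 'e, real) tensor" where
  "im_part \<Psi> c x vs = Im (\<Psi> c x vs)"

text \<open>\<open>F k, J\<^sub>0 (F k)\<close> for \<open>k = 1, 2, 3\<close> is an orthonormal basis with dual basis \<open>f k, h k\<close>;
  thus \<open>h k\<close> is the covector written \<open>Jf\<^sub>k\<close>.\<close>

definition adapted_basis ::
  "('e::euclidean_space list \<Rightarrow> real) \<Rightarrow> ('e \<Rightarrow> 'e) \<Rightarrow>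
   (nat \<Rightarrow> 'e) \<Rightarrow> (nat \<Rightarrow> 'e \<Rightarrow> real) \<Rightarrow> (nat \<Rightarrow> 'e \<Rightarrow> real) \<Rightarrow> bool" where
  "adapted_basis g\<^sub>0 J\<^sub>0 F f h \<longleftrightarrow>
     span (F ` {1..3} \<union> (\<lambda>k. J\<^sub>0 (F k)) ` {1..3}) = UNIV \<and>
     (\<forall>j\<in>{1..3}. \<forall>k\<in>{1..3}.
        g\<^sub>0 [F j, F k] = of_bool (j = k) \<and> g\<^sub>0 [J\<^sub>0 (F j), J\<^sub>0 (F k)] = of_bool (j = k) \<and>
        g\<^sub>0 [F j, J\<^sub>0 (F k)] = 0) \<and>
     (\<forall>j\<in>{1..3}. linear (f j) \<and> linear (h j)) \<and>
     (\<forall>j\<in>{1..3}. \<forall>k\<in>{1..3}.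
        f j (F k) = of_bool (j = k) \<and> f j (J\<^sub>0 (F k)) = 0 \<and>
        h j (F k) = 0 \<and> h j (J\<^sub>0 (F k)) = of_bool (j = k))"

definition one_form :: "('e \<Rightarrow> 'b) \<Rightarrow> 'e list \<Rightarrow> 'b" where
  "one_form a vs = a (vs ! 0)"

text \<open>The penultimate clause says that \<open>\<Psi>\<close> has type \<open>(3,0)\<close>.\<close>

definition su3_structure ::
  "('p, real ^ 6) chart set \<Rightarrow> ('p, real ^ 6, real) tensor \<Rightarrow> ('p, real ^ 6) endo \<Rightarrow>
   ('p, real ^ 6, complex) tensor \<Rightarrow> bool" where
  "su3_structure A g J \<Psi> \<longleftrightarrow>
     riemannian_metric A g \<and> almost_complex A J \<and> diff_form A 3 \<Psi> \<and>
     (\<forall>c\<in>A. \<forall>x\<in>chart_image c.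
        (\<forall>v w. g c x [J c x v, J c x w] = g c x [v, w]) \<and>
        (\<forall>u v w. \<Psi> c x [J c x u, v, w] = \<i> * \<Psi> c x [u, v, w]) \<and>
        (\<exists>F f h. adapted_basis (g c x) (J c x) F f h \<and>
           (\<forall>vs. length vs = 2 \<longrightarrow>
              fund_form g J c x vs = (\<Sum>k=1..3. wedge 1 1 (one_form (f k)) (one_form (h k)) vs)) \<and>
           (let \<theta> = (\<lambda>k. one_form (\<lambda>v. complex_of_real (f k v) + \<i> * complex_of_real (h k v))) in
            \<forall>vs. length vs = 3 \<longrightarrow> \<Psi> c x vs = wedge 2 1 (wedge 1 1 (\<theta> 1) (\<theta> 2)) (\<theta> 3) vs)))"

definition nearly_kaehler ::
  "('p, real ^ 6) chart set \<Rightarrow> ('p, real ^ 6, real) tensor \<Rightarrow> ('p, real ^ 6) endo \<Rightarrow>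
   ('p, real ^ 6, complex) tensor \<Rightarrow> bool" where
  "nearly_kaehler A g J \<Psi> \<longleftrightarrow> su3_structure A g J \<Psi> \<and>
     (\<forall>c\<in>A. \<forall>x\<in>chart_image c.
        (\<forall>vs. length vs = 3 \<longrightarrow>
           ext_deriv (fund_form g J c) x vs = 3 * re_part \<Psi> c x vs) \<and>
        (\<forall>vs. length vs = 4 \<longrightarrow>
           ext_deriv (im_part \<Psi> c) x vs =
             - 2 * wedge 2 2 (fund_form g J c x) (fund_form g J c x) vs))"


section \<open>Actions of the two-torus\<close>

definition circle_group :: "complex monoid" where
  "circle_group = \<lparr>carrier = sphere 0 1, mult = (*), one = 1\<rparr>"

definition torus :: "(complex \<times> complex) monoid" where
  "torus = circle_group \<times>\<times> circle_group"

text \<open>The exponential map of the torus, which identifies its Lie algebra with \<open>real \<times> real\<close>.\<close>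

definition torus_exp :: "real \<times> real \<Rightarrow> complex \<times> complex" where
  "torus_exp a = (cis (fst a), cis (snd a))"

text \<open>The charts of the torus are local inverses of the exponential map, which is injective on
  balls of radius \<open>\<pi>\<close>.\<close>

definition torus_atlas :: "(complex \<times> complex, real \<times> real) chart set" where
  "torus_atlas = {(torus_exp ` ball a pi, inv_into (ball a pi) torus_exp) | a. True}"

definition smooth_effective_torus_action ::
  "'p topology \<Rightarrow> ('p, 'e::euclidean_space) chart set \<Rightarrow> (complex \<times> complex \<Rightarrow> 'p \<Rightarrow> 'p) \<Rightarrow> bool" where
  "smooth_effective_torus_action X A act \<longleftrightarrow>
     faithful_action torus (topspace X) act \<and>
     smooth_map (prod_topology (top_of_set (carrier torus)) X) (prod_atlas torus_atlas A) X A
       (\<lambda>(t, p). act t p)"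

text \<open>The vector field generated by the element \<open>\<xi>\<close> of the Lie algebra.\<close>

definition generating_field ::
  "(complex \<times> complex \<Rightarrow> 'p \<Rightarrow> 'p) \<Rightarrow> real \<times> real \<Rightarrow> ('p, 'e::real_normed_vector) vfield" where
  "generating_field act \<xi> c x =
     vector_derivative (\<lambda>t. snd c (act (torus_exp (t *\<^sub>R \<xi>)) (chart_inv c x))) (at 0)"

text \<open>The value at \<open>p\<close> does not depend on the chart around \<open>p\<close> that is chosen.\<close>

definition multi_moment ::
  "('p, 'e) chart set \<Rightarrow> ('p, 'e, real) tensor \<Rightarrow> ('p, 'e) vfield \<Rightarrow> ('p, 'e) vfield \<Rightarrow> 'p \<Rightarrow> real" where
  "multi_moment A \<sigma> U V p =
     (let c = (SOME c. c \<in> A \<and> p \<in> fst c); x = snd c p in \<sigma> c x [U c x, V c x])"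

definition level_set :: "'p topology \<Rightarrow> ('p \<Rightarrow> real) \<Rightarrow> real \<Rightarrow> 'p set" where
  "level_set X \<nu> s = {p \<in> topspace X. \<nu> p = s}"

definition regular_value ::
  "'p topology \<Rightarrow> ('p, 'e::euclidean_space) chart set \<Rightarrow> ('p \<Rightarrow> real) \<Rightarrow> real \<Rightarrow> bool" where
  "regular_value X A \<nu> s \<longleftrightarrow> s \<in> \<nu> ` topspace X \<and>
     (\<forall>p\<in>level_set X \<nu> s. \<forall>c\<in>A. p \<in> fst c \<longrightarrow>
        frechet_derivative (\<lambda>x. \<nu> (chart_inv c x)) (at (snd c p)) \<noteq> (\<lambda>v. 0))"

end

theory Submission
  imports Defs
begin

text \<open>At a point where \<open>d\<nu>\<close> is nonzero, the formula \<open>d\<nu> = 3 \<psi>\<^sub>+ (U, V, \<cdot>)\<close> shows that \<open>U\<close> and \<open>V\<close> are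
  linearly independent over the complex numbers, so the derivative of an element of the stabilizer,
  being in SU(3) and fixing both, is the identity. Independence also makes the stabilizer discrete,
  hence finite. A transformation of finite order whose iterates have derivative one at a fixed point
  is trivial near it (average the iterates), hence everywhere by connectedness, and since the action
  is effective the stabilizer is trivial.

  If \<open>d\<nu>\<close> vanished identically, so would \<open>\<psi>\<^sub>- (U, V, \<cdot>)\<close>, and contracting \<open>d\<psi>\<^sub>- = -2 \<sigma> \<and> \<sigma>\<close> with \<open>U\<close> and
  \<open>V\<close> would give \<open>\<nu> \<sigma> = \<iota>\<^sub>U \<sigma> \<and> \<iota>\<^sub>V \<sigma>\<close>. Comparing ranks, \<open>\<nu> = 0\<close>, and \<open>U\<close>, \<open>V\<close> are linearly dependent over
  the reals everywhere. Since \<open>V\<close> preserves \<open>J\<close>, the factor in \<open>V = a U\<close> is locally constant, so some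
  nonzero element of the Lie algebra has a generating field that vanishes on an open set. The closure
  of its one-parameter group contains a nontrivial element of finite order fixing that set, which
  again contradicts effectiveness. So \<open>\<nu>\<close> is not constant, its image is a nondegenerate interval, and
  Sard's theorem provides nonzero regular values.

  Charts of the level set and of its quotient come from coordinates \<open>(a, y, r)\<close> near a point of the
  level set in which the torus acts by translation of \<open>a\<close> and \<open>\<nu> = s + r\<close>.\<close>

section \<open>Smooth functions on open sets\<close>

text \<open>An isometry whose derivative at a fixed point is the identity is usually shown to be
  trivial by following geodesics. Finite order allows averaging instead, without any connection;
  this is why elements of the stabilizer are first shown to have finite order. The same local result
  makes the interior of a fixed point set closed.

  Smoothness is expressed by directional derivatives in charts, and a chart need not be invariant
  under the torus. Lie derivatives are therefore taken pointwise: an invariance identity is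
  differentiated at time zero of a flow that stays in the chart only near that time, and symmetry of
  second derivatives turns the time derivative of the linearized flow into the derivative of the
  generating field.

  Sard's theorem for a real function of six variables involves derivatives of higher order, hence
  the induction over coordinate subspaces.

  Freeness alone does not prevent an orbit from returning to a small slice. Compactness of the torus
  does, and it also makes the orbit space Hausdorff.\<close>

lemma Ck_on_subset: "Ck_on n S f \<Longrightarrow> T \<subseteq> S \<Longrightarrow> Ck_on n T f"
proof (induction n arbitrary: f)
  case 0
  then show ?case by (auto intro: continuous_on_subset)
next
  case (Suc n)
  then show ?case by (auto simp: subset_iff)
qed

text \<open>\<open>frechet_derivative\<close> is a choice among the derivatives at the point.
  Functions that agree nearby have the same derivatives there, so the choices agree even where there
  is none.\<close>

lemma frechet_derivative_cong_open:
  assumes "open S" "x \<in> S" "\<And>y. y \<in> S \<Longrightarrow> f y = g y"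
  shows "frechet_derivative f (at x) = frechet_derivative g (at x)"
proof -
  have "(f has_derivative D) (at x) \<longleftrightarrow> (g has_derivative D) (at x)" for D
    using assms by (metis has_derivative_transform_within_open)
  then show ?thesis by (simp add: frechet_derivative_def)
qed

lemma Ck_on_cong:
  assumes "open S" "\<And>y. y \<in> S \<Longrightarrow> f y = g y"
  shows "Ck_on n S f \<longleftrightarrow> Ck_on n S g"
  using assms(2)
proof (induction n arbitrary: f g)
  case 0
  then show ?case by (simp cong: continuous_on_cong)
next
  case (Suc n)
  have 1: "f differentiable (at x) \<longleftrightarrow> g differentiable (at x)" if "x \<in> S" for x
    using Suc.prems \<open>open S\<close> that unfolding differentiable_def
    by (metis has_derivative_transform_within_open)
  have "Ck_on n S (\<lambda>x. frechet_derivative f (at x) v) \<longleftrightarrow> Ck_on n S (\<lambda>x. frechet_derivative g (at x) v)" for v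
    by (rule Suc.IH) (use frechet_derivative_cong_open[OF \<open>open S\<close>] Suc.prems in metis)
  with 1 show ?case by simp
qed

text \<open>Lets the closure proofs below supply a derivative by a formula instead of reasoning
  about the choice in \<open>frechet_derivative\<close>.\<close>

lemma Ck_on_SucI:
  assumes "open S" "\<And>x. x \<in> S \<Longrightarrow> (f has_derivative f' x) (at x)" "\<And>v. Ck_on n S (\<lambda>x. f' x v)"
  shows "Ck_on (Suc n) S f"
proof -
  have "Ck_on n S (\<lambda>x. frechet_derivative f (at x) v)" for v
    using assms(3) by (subst Ck_on_cong[OF assms(1), where g = "\<lambda>x. f' x v"])
      (metis assms(2) frechet_derivative_at)+
  then show ?thesis using assms(2) by (auto simp: differentiable_def)
qed

lemma Ck_on_SucD:
  assumes "Ck_on (Suc n) S f" "x \<in> S"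
  shows "(f has_derivative frechet_derivative f (at x)) (at x)"
  using assms by (auto simp: frechet_derivative_works)

lemma Ck_on_Suc_imp: "Ck_on (Suc n) S f \<Longrightarrow> Ck_on n S f"
proof (induction n arbitrary: f)
  case 0
  then show ?case
    by (auto simp: continuous_at_imp_continuous_on differentiable_imp_continuous_within)
next
  case (Suc n)
  then show ?case by (metis Ck_on.simps(2))
qed

lemma Ck_on_local:
  assumes "\<And>x. x \<in> S \<Longrightarrow> \<exists>T. open T \<and> x \<in> T \<and> Ck_on n T f"
  shows "Ck_on n S f"
  using assms
proof (induction n arbitrary: f)
  case 0
  then have "isCont f x" if "x \<in> S" for x
    using that by (metis Ck_on.simps(1) continuous_on_eq_continuous_at)
  then show ?case by (simp add: continuous_at_imp_continuous_on)
next
  case (Suc n)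
  have "f differentiable (at x)" if "x \<in> S" for x using Suc.prems that by fastforce
  moreover have "Ck_on n S (\<lambda>x. frechet_derivative f (at x) v)" for v
    by (rule Suc.IH) (use Suc.prems in fastforce)
  ultimately show ?case by simp
qed

lemma Ck_on_const: "open S \<Longrightarrow> Ck_on n S (\<lambda>x. c)"
proof (induction n arbitrary: c)
  case (Suc n)
  show ?case by (rule Ck_on_SucI[where f' = "\<lambda>x v. 0"]) (use Suc in auto)
qed simp

lemma Ck_on_bounded_linear:
  assumes "open S" "bounded_linear L" "Ck_on n S f"
  shows "Ck_on n S (\<lambda>x. L (f x))"
  using assms(3)
proof (induction n arbitrary: f)
  case 0
  then show ?case using assms(2) by (auto intro: bounded_linear.continuous_on)
next
  case (Suc n)
  show ?case
    by (rule Ck_on_SucI[OF assms(1), where f' = "\<lambda>x v. L (frechet_derivative f (at x) v)"])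
      (use Suc Ck_on_SucD[OF Suc.prems] assms in \<open>auto intro: bounded_linear.has_derivative\<close>)
qed

lemma Ck_on_add:
  assumes "open S" "Ck_on n S f" "Ck_on n S g"
  shows "Ck_on n S (\<lambda>x. f x + g x)"
  using assms(2,3)
proof (induction n arbitrary: f g)
  case 0
  then show ?case by (auto intro: continuous_intros)
next
  case (Suc n)
  show ?case
    by (rule Ck_on_SucI[OF assms(1),
          where f' = "\<lambda>x v. frechet_derivative f (at x) v + frechet_derivative g (at x) v"])
      (use Suc Ck_on_SucD[OF Suc.prems(1)] Ck_on_SucD[OF Suc.prems(2)]
       in \<open>auto intro: has_derivative_add\<close>)
qed

lemma Ck_on_bounded_bilinear:
  assumes "open S" "bounded_bilinear B" "Ck_on n S f" "Ck_on n S g"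
  shows "Ck_on n S (\<lambda>x. B (f x) (g x))"
  using assms(3,4)
proof (induction n arbitrary: f g)
  case 0
  then show ?case using assms(2) by (auto intro: bounded_bilinear.continuous_on)
next
  case (Suc n)
  show ?case
    by (rule Ck_on_SucI[OF assms(1), where
          f' = "\<lambda>x v. B (f x) (frechet_derivative g (at x) v) + B (frechet_derivative f (at x) v) (g x)"])
      (use Suc Ck_on_SucD[OF Suc.prems(1)] Ck_on_SucD[OF Suc.prems(2)] assms(1,2)
          Ck_on_Suc_imp[OF Suc.prems(1)] Ck_on_Suc_imp[OF Suc.prems(2)]
       in \<open>auto intro!: bounded_bilinear.FDERIV Ck_on_add simp del: Ck_on.simps(1) simp: Ck_on.simps(2)\<close>)
qed

lemma Ck_on_sum:
  assumes "open S" "\<And>i. i \<in> I \<Longrightarrow> Ck_on n S (f i)"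
  shows "Ck_on n S (\<lambda>x. \<Sum>i\<in>I. f i x)"
  using assms(2)
  by (induction I rule: infinite_finite_induct) (auto intro: Ck_on_const Ck_on_add assms(1))

text \<open>The chain rule feeds the derivative of \<open>f\<close> a direction that varies with
  \<open>x\<close>, whereas \<open>Ck_on\<close> speaks of fixed directions. Expanding that
  direction in the basis leaves products of scalar coefficients with compositions to which the
  induction hypothesis applies.\<close>

lemma Ck_on_compose:
  fixes g :: "'a::euclidean_space \<Rightarrow> 'b::euclidean_space"
  assumes "open S" "open T" "g ` S \<subseteq> T" "Ck_on n T f" "Ck_on n S g"
  shows "Ck_on n S (\<lambda>x. f (g x))"
  using assms(4,5)
proof (induction n arbitrary: f)
  case 0
  then show ?case using assms(3) by (auto intro: continuous_on_compose2)
next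
  case (Suc n)
  let ?f = "\<lambda>b y. frechet_derivative f (at y) b"
  let ?g = "\<lambda>x v. frechet_derivative g (at x) v"
  have g1: "Ck_on n S g" using Suc.prems(2) by (rule Ck_on_Suc_imp)
  show ?case
  proof (rule Ck_on_SucI[OF assms(1), where f' = "\<lambda>x v. \<Sum>b\<in>Basis. (?g x v \<bullet> b) *\<^sub>R ?f b (g x)"])
    fix x assume x: "x \<in> S"
    then have gx: "g x \<in> T" using assms(3) by auto
    note fd = Ck_on_SucD[OF Suc.prems(1) gx]
    have lin: "linear (frechet_derivative f (at (g x)))"
      using fd by (rule has_derivative_linear)
    have "?f (?g x v) (g x) = (\<Sum>b\<in>Basis. (?g x v \<bullet> b) *\<^sub>R ?f b (g x))" for v
      by (subst euclidean_representation[of "?g x v", symmetric])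
        (simp only: linear_sum[OF lin] linear_scale[OF lin])
    then show "((\<lambda>x. f (g x)) has_derivative (\<lambda>v. \<Sum>b\<in>Basis. (?g x v \<bullet> b) *\<^sub>R ?f b (g x))) (at x)"
      using has_derivative_compose[OF Ck_on_SucD[OF Suc.prems(2) x] fd] by simp
  next
    fix v
    show "Ck_on n S (\<lambda>x. \<Sum>b\<in>Basis. (?g x v \<bullet> b) *\<^sub>R ?f b (g x))"
      by (intro Ck_on_sum Ck_on_bounded_bilinear[OF _ bounded_bilinear_scaleR]
            Ck_on_bounded_linear[OF _ bounded_linear_inner_left] Suc.IH assms(1) g1)
        (use Suc.prems in auto)
  qed
qed

lemma smooth_on_subset: "smooth_on S f \<Longrightarrow> T \<subseteq> S \<Longrightarrow> smooth_on T f"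
  by (auto simp: smooth_on_def intro: Ck_on_subset)

lemma smooth_on_cong: "open S \<Longrightarrow> (\<And>y. y \<in> S \<Longrightarrow> f y = g y) \<Longrightarrow> smooth_on S f \<longleftrightarrow> smooth_on S g"
  unfolding smooth_on_def using Ck_on_cong by metis

lemma smooth_on_local:
  assumes "\<And>x. x \<in> S \<Longrightarrow> \<exists>T. open T \<and> x \<in> T \<and> smooth_on T f"
  shows "smooth_on S f"
  unfolding smooth_on_def
proof
  fix n
  show "Ck_on n S f" by (rule Ck_on_local) (use assms smooth_on_def in metis)
qed

lemma smooth_on_has_derivative:
  assumes "smooth_on S f" "x \<in> S"
  shows "(f has_derivative frechet_derivative f (at x)) (at x)"
  using assms Ck_on_SucD unfolding smooth_on_def by blast

lemma smooth_on_continuous_on: "smooth_on S f \<Longrightarrow> continuous_on S f"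
  unfolding smooth_on_def using Ck_on.simps(1) by blast

lemma smooth_on_frechet_derivative:
  "smooth_on S f \<Longrightarrow> smooth_on S (\<lambda>x. frechet_derivative f (at x) v)"
  unfolding smooth_on_def using Ck_on.simps(2) by blast

lemma smooth_on_const: "open S \<Longrightarrow> smooth_on S (\<lambda>x. c)"
  by (simp add: smooth_on_def Ck_on_const)

lemma smooth_on_bounded_linear:
  "open S \<Longrightarrow> bounded_linear L \<Longrightarrow> smooth_on S f \<Longrightarrow> smooth_on S (\<lambda>x. L (f x))"
  by (simp add: smooth_on_def Ck_on_bounded_linear)

lemma smooth_on_add: "open S \<Longrightarrow> smooth_on S f \<Longrightarrow> smooth_on S g \<Longrightarrow> smooth_on S (\<lambda>x. f x + g x)"
  by (simp add: smooth_on_def Ck_on_add)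

lemma smooth_on_bounded_bilinear:
  "open S \<Longrightarrow> bounded_bilinear B \<Longrightarrow> smooth_on S f \<Longrightarrow> smooth_on S g \<Longrightarrow> smooth_on S (\<lambda>x. B (f x) (g x))"
  by (simp add: smooth_on_def Ck_on_bounded_bilinear)

lemma smooth_on_sum:
  "open S \<Longrightarrow> (\<And>i. i \<in> I \<Longrightarrow> smooth_on S (f i)) \<Longrightarrow> smooth_on S (\<lambda>x. \<Sum>i\<in>I. f i x)"
  by (simp add: smooth_on_def Ck_on_sum)

lemma smooth_on_compose:
  fixes g :: "'a::euclidean_space \<Rightarrow> 'b::euclidean_space"
  shows "open S \<Longrightarrow> open T \<Longrightarrow> g ` S \<subseteq> T \<Longrightarrow> smooth_on T f \<Longrightarrow> smooth_on S g \<Longrightarrow> smooth_on S (\<lambda>x. f (g x))"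
  by (simp add: smooth_on_def Ck_on_compose)

lemma smooth_on_id: "open S \<Longrightarrow> smooth_on S (\<lambda>x. x)"
  unfolding smooth_on_def
proof
  fix n assume "open S"
  show "Ck_on n S (\<lambda>x. x)"
  proof (cases n)
    case (Suc m)
    show ?thesis unfolding Suc
      by (rule Ck_on_SucI[where f' = "\<lambda>x v. v"]) (auto intro: \<open>open S\<close> Ck_on_const)
  qed simp
qed

lemma smooth_on_linear:
  fixes L :: "'a::euclidean_space \<Rightarrow> 'b::real_normed_vector"
  shows "open S \<Longrightarrow> linear L \<Longrightarrow> smooth_on S L"
  using smooth_on_bounded_linear[OF _ _ smooth_on_id] by (simp add: linear_conv_bounded_linear)

lemma smooth_on_uminus: "open S \<Longrightarrow> smooth_on S f \<Longrightarrow> smooth_on S (\<lambda>x. - f x)"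
  by (rule smooth_on_bounded_linear[OF _ bounded_linear_minus[OF bounded_linear_ident]])

lemma smooth_on_diff: "open S \<Longrightarrow> smooth_on S f \<Longrightarrow> smooth_on S g \<Longrightarrow> smooth_on S (\<lambda>x. f x - g x)"
  using smooth_on_add[OF _ _ smooth_on_uminus] by fastforce

lemma smooth_on_scaleR:
  "open S \<Longrightarrow> smooth_on S f \<Longrightarrow> smooth_on S g \<Longrightarrow> smooth_on S (\<lambda>x. f x *\<^sub>R g x)"
  by (rule smooth_on_bounded_bilinear[OF _ bounded_bilinear_scaleR])

lemma smooth_on_Pair:
  assumes "open S" "smooth_on S f" "smooth_on S g"
  shows "smooth_on S (\<lambda>x. (f x, g x))"
proof -
  have "smooth_on S (\<lambda>x. (f x, 0) + (0, g x))"
    by (intro smooth_on_add smooth_on_bounded_linear[OF _ _ assms(2)]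
          smooth_on_bounded_linear[OF _ _ assms(3)] assms(1) bounded_linear_Pair
          bounded_linear_ident bounded_linear_zero)
  then show ?thesis by simp
qed

lemma smooth_on_fst: "open S \<Longrightarrow> smooth_on S f \<Longrightarrow> smooth_on S (\<lambda>x. fst (f x))"
  by (rule smooth_on_bounded_linear[OF _ bounded_linear_fst])

lemma smooth_on_snd: "open S \<Longrightarrow> smooth_on S f \<Longrightarrow> smooth_on S (\<lambda>x. snd (f x))"
  by (rule smooth_on_bounded_linear[OF _ bounded_linear_snd])

text \<open>The derivative is a multiple of the square of the function itself, so each order of
  differentiability yields the next.\<close>

lemma smooth_on_inverse: "smooth_on (- {0}) (inverse :: real \<Rightarrow> real)"
  unfolding smooth_on_def
proof
  fix n
  show "Ck_on n (- {0}) (inverse :: real \<Rightarrow> real)"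
  proof (induction n)
    case 0
    show ?case by (auto intro: continuous_intros)
  next
    case (Suc n)
    show ?case
    proof (rule Ck_on_SucI[where f' = "\<lambda>x v. - (inverse x * v * inverse x)"])
      fix x :: real assume "x \<in> - {0}"
      then show "(inverse has_derivative (\<lambda>v. - (inverse x * v * inverse x))) (at x)"
        using has_derivative_inverse'[of x UNIV] by simp
    next
      fix v :: real
      have "Ck_on n (- {0}) (\<lambda>x::real. - v * (inverse x * inverse x))"
        by (intro Ck_on_bounded_bilinear[OF _ bounded_bilinear_mult] Ck_on_const Suc) auto
      then show "Ck_on n (- {0}) (\<lambda>x::real. - (inverse x * v * inverse x))"
        by (simp add: mult_ac)
    qed auto
  qed
qed

section \<open>Cramer's rule and the smooth inverse function theorem\<close>

lemma Ck_on_prod: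
  fixes f :: "'i \<Rightarrow> 'a::euclidean_space \<Rightarrow> real"
  assumes "open S" "\<And>i. i \<in> I \<Longrightarrow> Ck_on n S (f i)"
  shows "Ck_on n S (\<lambda>x. \<Prod>i\<in>I. f i x)"
  using assms(2)
  by (induction I rule: infinite_finite_induct)
    (auto intro: Ck_on_const Ck_on_bounded_bilinear[OF _ bounded_bilinear_mult] assms(1))

lemma Ck_on_vec_components:
  fixes f :: "'a::euclidean_space \<Rightarrow> real ^ 'n"
  assumes "open S" "\<And>i. Ck_on n S (\<lambda>x. f x $ i)"
  shows "Ck_on n S f"
proof -
  have "Ck_on n S (\<lambda>x. \<Sum>i\<in>UNIV. (f x $ i) *\<^sub>R axis i (1::real))"
    by (intro Ck_on_sum Ck_on_bounded_bilinear[OF _ bounded_bilinear_scaleR] Ck_on_const assms)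
  moreover have "(\<Sum>i\<in>UNIV. (f x $ i) *\<^sub>R axis i (1::real)) = f x" for x
    by (simp add: vec_eq_iff axis_def if_distrib cong: if_cong)
  ultimately show ?thesis by simp
qed

lemma Ck_on_det:
  fixes M :: "'a::euclidean_space \<Rightarrow> real ^ 'n ^ 'n"
  assumes "open S" "\<And>i j. Ck_on n S (\<lambda>x. M x $ i $ j)"
  shows "Ck_on n S (\<lambda>x. det (M x))"
  unfolding det_def
  by (intro Ck_on_sum Ck_on_bounded_bilinear[OF _ bounded_bilinear_mult] Ck_on_const Ck_on_prod assms)

lemma Ck_on_divide:
  fixes f g :: "'a::euclidean_space \<Rightarrow> real"
  assumes "open S" "Ck_on n S f" "Ck_on n S g" "\<And>x. x \<in> S \<Longrightarrow> g x \<noteq> 0"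
  shows "Ck_on n S (\<lambda>x. f x / g x)"
  unfolding divide_inverse
  by (intro Ck_on_bounded_bilinear[OF _ bounded_bilinear_mult] assms
      Ck_on_compose[where T = "- {0}" and f = inverse and g = g])
    (use smooth_on_inverse assms(4) in \<open>auto simp: smooth_on_def\<close>)

text \<open>By Cramer's rule the solution is a quotient of determinants in the matrix entries, with
  nonzero denominator. With \<open>M\<close> the derivative of a map along its inverse, this yields
  the regularity of the derivative of the inverse.\<close>

lemma Ck_on_solve_linear:
  fixes M :: "'a::euclidean_space \<Rightarrow> real ^ 'n \<Rightarrow> real ^ 'n"
  assumes "open S" "\<And>v. Ck_on n S (\<lambda>x. M x v)"
    and "\<And>x. x \<in> S \<Longrightarrow> linear (M x)" "\<And>x. x \<in> S \<Longrightarrow> bij (M x)"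
    and "\<And>x. x \<in> S \<Longrightarrow> M x (w x) = b"
  shows "Ck_on n S w"
proof -
  define c where "c x = (\<chi> k. det (\<chi> i j. if j = k then b $ i else matrix (M x) $ i $ j) / det (matrix (M x)))"
    for x
  have nz: "det (matrix (M x)) \<noteq> 0" if "x \<in> S" for x
    using assms(3,4)[OF that] det_nz_iff_inj bij_is_inj by blast
  have "w x = c x" if "x \<in> S" for x
    unfolding c_def
    by (rule iffD1[OF cramer[OF nz[OF that]]])
      (use assms(5)[OF that] matrix_vector_mul(2)[OF assms(3)[OF that]] in metis)
  moreover have "Ck_on n S c"
  proof (rule Ck_on_vec_components[OF assms(1)])
    fix k
    have ent: "Ck_on n S (\<lambda>x. matrix (M x) $ i $ j)" for i j
      using Ck_on_bounded_linear[OF assms(1) bounded_linear_vec_nth assms(2)]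
      by (simp add: matrix_def)
    have ent': "Ck_on n S (\<lambda>x. (\<chi> i j. if j = k then b $ i else matrix (M x) $ i $ j) $ i $ j)" for i j
      by (cases "j = k") (use ent Ck_on_const assms(1) in auto)
    show "Ck_on n S (\<lambda>x. c x $ k)"
      unfolding c_def vec_lambda_beta
      by (intro Ck_on_divide Ck_on_det assms(1) ent ent' nz)
  qed
  ultimately show ?thesis by (subst Ck_on_cong[OF assms(1), where g = c])
qed

text \<open>Bootstrapping: the derivative of \<open>G\<close> at \<open>y\<close> inverts the
  derivative of \<open>f\<close> at \<open>G y\<close>, so if \<open>G\<close> has \<open>n\<close>
  continuous derivatives then so does its derivative. The start is the C^1 inverse function
  theorem.\<close>

theorem smooth_inverse_function:
  fixes f :: "real ^ 'n \<Rightarrow> real ^ 'n"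
  assumes S: "open S" and f: "smooth_on S f" and "x0 \<in> S"
    and inj: "inj (frechet_derivative f (at x0))"
  obtains T W G where "open T" "x0 \<in> T" "T \<subseteq> S" "open W" "homeomorphism T W f G" "smooth_on W G"
proof -
  define f' where "f' x = Blinfun (frechet_derivative f (at x))" for x
  have bl: "bounded_linear (frechet_derivative f (at x))" if "x \<in> S" for x
    using smooth_on_has_derivative[OF f that] has_derivative_bounded_linear by blast
  then have f'a: "blinfun_apply (f' x) = frechet_derivative f (at x)" if "x \<in> S" for x
    using that by (simp add: f'_def bounded_linear_Blinfun_apply)
  have "continuous_on S f'"
  proof (rule continuous_on_blinfun_componentwise)
    fix i :: "real ^ 'n"
    show "continuous_on S (\<lambda>x. blinfun_apply (f' x) i)"
      using smooth_on_continuous_on[OF smooth_on_frechet_derivative[OF f]] f'a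
      by (simp cong: continuous_on_cong)
  qed
  moreover obtain h where h: "linear h" "h \<circ> frechet_derivative f (at x0) = id"
    using linear_injective_left_inverse inj bl[OF \<open>x0 \<in> S\<close>] bounded_linear.linear by blast
  have "Blinfun h o\<^sub>L f' x0 = id_blinfun"
    using h f'a[OF \<open>x0 \<in> S\<close>]
    by (intro blinfun_eqI)
      (metis (no_types) blinfun_apply_blinfun_compose bounded_linear_Blinfun_apply comp_apply
        id_apply id_blinfun.rep_eq linear_conv_bounded_linear)
  moreover have "(f has_derivative blinfun_apply (f' x)) (at x)" if "x \<in> S" for x
    using smooth_on_has_derivative[OF f that] f'a[OF that] by simp
  ultimately obtain T W G g' where T: "open T" "T \<subseteq> S" "x0 \<in> T" and W: "open W"
    and hom: "homeomorphism T W f G"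
    and der: "\<And>y. y \<in> W \<Longrightarrow> (G has_derivative g' y) (at y)"
    and g': "\<And>y. y \<in> W \<Longrightarrow> g' y = inv_into UNIV (blinfun_apply (f' (G y)))"
    and bij: "\<And>y. y \<in> W \<Longrightarrow> bij (blinfun_apply (f' (G y)))"
    using inverse_function_theorem[OF S] \<open>x0 \<in> S\<close> by metis
  have GW: "G y \<in> S" if "y \<in> W" for y
    using hom T(2) that unfolding homeomorphism_def by blast
  have "Ck_on n W G" for n
  proof (induction n)
    case 0
    show ?case using hom by (simp add: homeomorphism_def)
  next
    case (Suc n)
    show ?case
    proof (rule Ck_on_SucI[OF W der])
      fix v
      show "Ck_on n W (\<lambda>y. g' y v)"
      proof (rule Ck_on_solve_linear[OF W, where M = "\<lambda>y. frechet_derivative f (at (G y))" and b = v])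
        show "Ck_on n W (\<lambda>y. frechet_derivative f (at (G y)) u)" for u
          by (rule Ck_on_compose[OF W S, where f = "\<lambda>x. frechet_derivative f (at x) u"])
            (use GW Suc smooth_on_frechet_derivative[OF f, of u] in \<open>auto simp: smooth_on_def\<close>)
      qed (use bij g' GW f'a bl in \<open>auto simp: bounded_linear.linear bij_is_surj surj_f_inv_f\<close>)
    qed
  qed
  then show thesis using that T W hom by (simp add: smooth_on_def)
qed

section \<open>Symmetry of second derivatives\<close>

lemma has_real_derivative_directional:
  fixes f :: "'a::real_normed_vector \<Rightarrow> real"
  assumes "(f has_derivative D) (at (x + t *\<^sub>R u))"
  shows "((\<lambda>t. f (x + t *\<^sub>R u)) has_real_derivative D u) (at t)"
proof -
  have lin: "linear D" using assms by (rule has_derivative_linear)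
  have "((\<lambda>t. x + t *\<^sub>R u) has_derivative (\<lambda>h. h *\<^sub>R u)) (at t)"
    by (auto intro!: derivative_eq_intros)
  from has_derivative_compose[OF this assms]
  have "((\<lambda>t. f (x + t *\<^sub>R u)) has_derivative (\<lambda>h. D (h *\<^sub>R u))) (at t)" .
  then show ?thesis
    by (simp add: has_field_derivative_def linear_scale[OF lin] mult_commute_abs)
qed

text \<open>The mean value theorem is applied along \<open>u\<close> to the first difference in
  direction \<open>v\<close>, and then along \<open>v\<close>. The second difference is symmetric in
  \<open>u\<close> and \<open>v\<close>, so it gives access to both orders of
  differentiation.\<close>

lemma second_difference_mvt:
  fixes f :: "'a::euclidean_space \<Rightarrow> real"
  assumes f: "smooth_on (ball x r) f" and h: "h > 0" "h * (norm u + norm v) < r"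
  shows "\<exists>y\<in>cball x (h * (norm u + norm v)).
     f (x + h *\<^sub>R u + h *\<^sub>R v) - f (x + h *\<^sub>R u) - f (x + h *\<^sub>R v) + f x =
       h * h * frechet_derivative (\<lambda>y. frechet_derivative f (at y) u) (at y) v"
proof -
  let ?D = "\<lambda>y. frechet_derivative f (at y) u"
  have in_cb: "x + s *\<^sub>R u + t *\<^sub>R v \<in> cball x (h * (norm u + norm v))"
    if "0 \<le> s" "s \<le> h" "0 \<le> t" "t \<le> h" for s t
  proof -
    have "norm (s *\<^sub>R u + t *\<^sub>R v) \<le> s * norm u + t * norm v"
      using norm_triangle_ineq[of "s *\<^sub>R u" "t *\<^sub>R v"] that by simp
    also have "\<dots> \<le> h * norm u + h * norm v"
      using that by (intro add_mono mult_right_mono) auto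
    finally show ?thesis by (simp add: dist_norm algebra_simps norm_minus_commute)
  qed
  then have in_b: "x + s *\<^sub>R u + t *\<^sub>R v \<in> ball x r"
    if "0 \<le> s" "s \<le> h" "0 \<le> t" "t \<le> h" for s t
    using that h(2) by fastforce
  define g where "g s = f (x + s *\<^sub>R u + h *\<^sub>R v) - f (x + s *\<^sub>R u)" for s
  have "\<exists>z>0. z < h \<and> g h - g 0 = (h - 0) * (?D (x + z *\<^sub>R u + h *\<^sub>R v) - ?D (x + z *\<^sub>R u))"
  proof (rule MVT2[OF h(1)])
    fix s assume s: "0 \<le> s" "s \<le> h"
    have 1: "((\<lambda>s. f ((x + h *\<^sub>R v) + s *\<^sub>R u)) has_real_derivative ?D ((x + h *\<^sub>R v) + s *\<^sub>R u)) (at s)"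
      by (rule has_real_derivative_directional, rule smooth_on_has_derivative[OF f])
        (use in_b[OF s, of h] h in \<open>simp add: add_ac\<close>)
    have 2: "((\<lambda>s. f (x + s *\<^sub>R u)) has_real_derivative ?D (x + s *\<^sub>R u)) (at s)"
      by (rule has_real_derivative_directional, rule smooth_on_has_derivative[OF f])
        (use in_b[OF s, of 0] h in simp)
    show "(g has_real_derivative ?D (x + s *\<^sub>R u + h *\<^sub>R v) - ?D (x + s *\<^sub>R u)) (at s)"
      unfolding g_def using DERIV_diff[OF 1 2] by (simp add: add_ac)
  qed
  then obtain z where z: "0 < z" "z < h"
    and gz: "g h - g 0 = h * (?D (x + z *\<^sub>R u + h *\<^sub>R v) - ?D (x + z *\<^sub>R u))" by auto
  have "\<exists>w>0. w < h \<and> ?D (x + z *\<^sub>R u + h *\<^sub>R v) - ?D (x + z *\<^sub>R u + 0 *\<^sub>R v) =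
      (h - 0) * frechet_derivative ?D (at (x + z *\<^sub>R u + w *\<^sub>R v)) v"
  proof (rule MVT2[OF h(1)])
    fix t assume "0 \<le> t" "t \<le> h"
    then show "((\<lambda>t. ?D (x + z *\<^sub>R u + t *\<^sub>R v)) has_real_derivative
        frechet_derivative ?D (at (x + z *\<^sub>R u + t *\<^sub>R v)) v) (at t)"
      by (intro has_real_derivative_directional
          smooth_on_has_derivative[OF smooth_on_frechet_derivative[OF f]] in_b) (use z in auto)
  qed
  then obtain w where w: "0 < w" "w < h" and
    "?D (x + z *\<^sub>R u + h *\<^sub>R v) - ?D (x + z *\<^sub>R u) =
      h * frechet_derivative ?D (at (x + z *\<^sub>R u + w *\<^sub>R v)) v" by auto
  with gz have "g h - g 0 = h * h * frechet_derivative ?D (at (x + z *\<^sub>R u + w *\<^sub>R v)) v" by simp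
  moreover have "g h - g 0 = f (x + h *\<^sub>R u + h *\<^sub>R v) - f (x + h *\<^sub>R u) - f (x + h *\<^sub>R v) + f x"
    by (simp add: g_def)
  ultimately show ?thesis using in_cb[of z w] z w by fastforce
qed

lemma symmetric_second_derivative_real:
  fixes f :: "'a::euclidean_space \<Rightarrow> real"
  assumes "open S" "smooth_on S f" "x \<in> S"
  shows "frechet_derivative (\<lambda>y. frechet_derivative f (at y) u) (at x) v =
         frechet_derivative (\<lambda>y. frechet_derivative f (at y) v) (at x) u" (is "?A x = ?B x")
proof (rule ccontr)
  assume ne: "?A x \<noteq> ?B x"
  \<comment> \<open>Half the gap: two values equal to each other, each within \<open>e\<close> of
    one side, cannot bridge it.\<close>
  define e where "e = \<bar>?A x - ?B x\<bar> / 2"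
  have e: "e > 0" using ne by (simp add: e_def)
  obtain r where r: "r > 0" "ball x r \<subseteq> S" using assms openE by blast
  have f: "smooth_on (ball x r) f" using assms r smooth_on_subset by blast
  have "continuous_on (ball x r) ?A" "continuous_on (ball x r) ?B"
    by (intro smooth_on_continuous_on smooth_on_frechet_derivative f)+
  then have "isCont ?A x" "isCont ?B x"
    using r by (auto simp: continuous_on_eq_continuous_at)
  then obtain d1 d2 where d: "d1 > 0" "\<And>y. dist y x < d1 \<Longrightarrow> dist (?A y) (?A x) < e"
      "d2 > 0" "\<And>y. dist y x < d2 \<Longrightarrow> dist (?B y) (?B x) < e"
    using e unfolding continuous_at_eps_delta by metis
  \<comment> \<open>The summand one keeps \<open>N\<close> positive when both vectors
    vanish.\<close>
  define N where "N = norm u + norm v + 1"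
  have N: "N > 0" by (simp add: N_def add_nonneg_pos)
  define h where "h = min r (min d1 d2) / (2 * N)"
  have h: "h > 0" using r d N by (simp add: h_def)
  have "h * (norm u + norm v) < h * N" using h by (simp add: N_def)
  also have "\<dots> = min r (min d1 d2) / 2" using N by (simp add: h_def)
  also have "\<dots> < min r (min d1 d2)" using r d by linarith
  finally have hlt: "h * (norm u + norm v) < min r (min d1 d2)" .
  obtain y where y: "y \<in> cball x (h * (norm u + norm v))" and
    yA: "f (x + h *\<^sub>R u + h *\<^sub>R v) - f (x + h *\<^sub>R u) - f (x + h *\<^sub>R v) + f x = h * h * ?A y"
    using second_difference_mvt[OF f h] hlt by force
  obtain z where z: "z \<in> cball x (h * (norm v + norm u))" and
    zB: "f (x + h *\<^sub>R v + h *\<^sub>R u) - f (x + h *\<^sub>R v) - f (x + h *\<^sub>R u) + f x = h * h * ?B z"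
    using second_difference_mvt[OF f h, of v u] hlt by (force simp: add.commute)
  have "x + h *\<^sub>R v + h *\<^sub>R u = x + h *\<^sub>R u + h *\<^sub>R v" by simp
  then have "h * h * ?A y = h * h * ?B z" using yA zB by (simp only:)
  then have "?A y = ?B z" using h by simp
  moreover have "dist (?A y) (?A x) < e" using y hlt by (intro d) (auto simp: dist_commute)
  moreover have "dist (?B z) (?B x) < e" using z hlt by (intro d) (auto simp: dist_commute add_ac)
  ultimately have "\<bar>?A x - ?B x\<bar> < 2 * e" by (simp add: dist_real_def)
  then show False by (simp add: e_def)
qed

lemma frechet_derivative_bounded_linear:
  assumes "f differentiable (at x)" "bounded_linear L"
  shows "frechet_derivative (\<lambda>y. L (f y)) (at x) = (\<lambda>v. L (frechet_derivative f (at x) v))"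
  using bounded_linear.has_derivative[OF assms(2)] assms(1)
  by (metis frechet_derivative_at frechet_derivative_works)

lemma smooth_on_differentiable: "smooth_on S f \<Longrightarrow> x \<in> S \<Longrightarrow> f differentiable (at x)"
  using smooth_on_has_derivative differentiable_def by blast

theorem symmetric_second_derivative:
  fixes f :: "'a::euclidean_space \<Rightarrow> 'b::euclidean_space"
  assumes S: "open S" and f: "smooth_on S f" and x: "x \<in> S"
  shows "frechet_derivative (\<lambda>y. frechet_derivative f (at y) u) (at x) v =
         frechet_derivative (\<lambda>y. frechet_derivative f (at y) v) (at x) u"
proof (rule euclidean_eqI)
  fix b :: 'b assume "b \<in> Basis"
  have *: "frechet_derivative (\<lambda>y. frechet_derivative (\<lambda>y. f y \<bullet> b) (at y) u) (at x) v =
      frechet_derivative (\<lambda>y. frechet_derivative f (at y) u) (at x) v \<bullet> b" for u v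
  proof -
    have "frechet_derivative (\<lambda>y. frechet_derivative (\<lambda>y. f y \<bullet> b) (at y) u) (at x) =
        frechet_derivative (\<lambda>y. frechet_derivative f (at y) u \<bullet> b) (at x)"
      by (rule frechet_derivative_cong_open[OF S x])
        (simp add: frechet_derivative_bounded_linear[OF smooth_on_differentiable[OF f]
            bounded_linear_inner_left])
    then show ?thesis
      by (simp add: frechet_derivative_bounded_linear[OF
            smooth_on_differentiable[OF smooth_on_frechet_derivative[OF f] x] bounded_linear_inner_left])
  qed
  show "frechet_derivative (\<lambda>y. frechet_derivative f (at y) u) (at x) v \<bullet> b =
        frechet_derivative (\<lambda>y. frechet_derivative f (at y) v) (at x) u \<bullet> b"
    using symmetric_second_derivative_real[OF S smooth_on_bounded_linear[OF S bounded_linear_inner_left f] x, of b u v]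
    by (simp add: *)
qed

text \<open>The product rule for a field of linear maps applied to a moving vector. Only derivatives
  with a constant argument are given, so the vector is expanded in the basis, where the ordinary
  product rule applies.\<close>

lemma has_derivative_linear_field:
  fixes T :: "'a::real_normed_vector \<Rightarrow> 'e::euclidean_space \<Rightarrow> 'b::real_normed_vector"
  assumes "open S" "x \<in> S" "\<And>y. y \<in> S \<Longrightarrow> linear (T y)"
    and T': "\<And>v. ((\<lambda>y. T y v) has_derivative T' v) (at x)"
    and u: "(u has_derivative u') (at x)"
  shows "((\<lambda>y. T y (u y)) has_derivative (\<lambda>w. T' (u x) w + T x (u' w))) (at x)"
proof -
  have rep: "T y v = (\<Sum>b\<in>Basis. (v \<bullet> b) *\<^sub>R T y b)" if "y \<in> S" for y v
    by (subst euclidean_representation[of v, symmetric])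
      (simp only: linear_sum[OF assms(3)[OF that]] linear_scale[OF assms(3)[OF that]])
  have "((\<lambda>y. \<Sum>b\<in>Basis. (u x \<bullet> b) *\<^sub>R T y b) has_derivative (\<lambda>w. \<Sum>b\<in>Basis. (u x \<bullet> b) *\<^sub>R T' b w)) (at x)"
    by (auto intro!: derivative_eq_intros T')
  then have "((\<lambda>y. T y (u x)) has_derivative (\<lambda>w. \<Sum>b\<in>Basis. (u x \<bullet> b) *\<^sub>R T' b w)) (at x)"
    by (rule has_derivative_transform_within_open[OF _ assms(1,2)]) (simp add: rep[symmetric])
  \<comment> \<open>\<open>T'\<close> was given for each argument separately; uniqueness of
    derivatives shows that it depends linearly on the argument.\<close>
  then have T'u: "T' (u x) = (\<lambda>w. \<Sum>b\<in>Basis. (u x \<bullet> b) *\<^sub>R T' b w)"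
    using T' has_derivative_unique by blast
  have "((\<lambda>y. \<Sum>b\<in>Basis. (u y \<bullet> b) *\<^sub>R T y b) has_derivative
     (\<lambda>w. \<Sum>b\<in>Basis. (u x \<bullet> b) *\<^sub>R T' b w + (u' w \<bullet> b) *\<^sub>R T x b)) (at x)"
    by (auto intro!: derivative_eq_intros T' u)
  then have "((\<lambda>y. \<Sum>b\<in>Basis. (u y \<bullet> b) *\<^sub>R T y b) has_derivative (\<lambda>w. T' (u x) w + T x (u' w))) (at x)"
    by (simp add: T'u sum.distrib rep[OF assms(2), of "u' _"])
  then show ?thesis
    by (rule has_derivative_transform_within_open[OF _ assms(1,2)]) (simp add: rep[symmetric])
qed

lemma smooth_on_eqI:
  "open S \<Longrightarrow> smooth_on S g \<Longrightarrow> (\<And>y. y \<in> S \<Longrightarrow> f y = g y) \<Longrightarrow> smooth_on S f"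
  using smooth_on_cong[of S f g] by blast

lemma smooth_on_linear_field:
  fixes T :: "'a::euclidean_space \<Rightarrow> 'e::euclidean_space \<Rightarrow> 'b::real_normed_vector"
  assumes "open S" "\<And>y. y \<in> S \<Longrightarrow> linear (T y)" "\<And>v. smooth_on S (\<lambda>y. T y v)" "smooth_on S u"
  shows "smooth_on S (\<lambda>y. T y (u y))"
proof -
  have "smooth_on S (\<lambda>y. \<Sum>b\<in>Basis. (u y \<bullet> b) *\<^sub>R T y b)"
    by (intro smooth_on_sum smooth_on_scaleR smooth_on_bounded_linear[OF _ bounded_linear_inner_left] assms)
  then show ?thesis
  proof (rule smooth_on_eqI[OF assms(1)])
    fix y assume "y \<in> S"
    note lin = assms(2)[OF this]
    show "T y (u y) = (\<Sum>b\<in>Basis. (u y \<bullet> b) *\<^sub>R T y b)"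
      by (subst euclidean_representation[of "u y", symmetric])
        (simp only: linear_sum[OF lin] linear_scale[OF lin])
  qed
qed

section \<open>Sard's theorem for real-valued functions\<close>

text \<open>If \<open>f\<close> varies by less than any multiple of the \<open>m\<close>-th power of
  the distance, \<open>m\<close> being the dimension, it maps the part of \<open>S\<close> in a
  small cube into an interval whose length is a small multiple of the volume of the cube. Disjoint
  such cubes in a bounded box have bounded total volume.\<close>

lemma negligible_image_small_order_bounded:
  fixes f :: "real ^ 'm \<Rightarrow> real"
  assumes S: "S \<subseteq> cbox (- vec c) (vec c)" and c: "c > 0"
    and small: "\<And>x e. x \<in> S \<Longrightarrow> e > 0 \<Longrightarrow>
      \<exists>d>0. \<forall>y\<in>S. norm (y - x) < d \<longrightarrow> \<bar>f y - f x\<bar> \<le> e * norm (y - x) ^ CARD('m)"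
  shows "negligible (f ` S)"
  unfolding negligible_outer_le
proof (intro allI impI)
  fix e :: real assume e: "e > 0"
  let ?m = "CARD('m)"
  \<comment> \<open>The diagonal of a cube of side \<open>t\<close> in dimension \<open>m\<close>
    has 1-norm \<open>m t\<close>, and the \<open>m\<close>-th power of this is \<open>M\<close>
    times the volume.\<close>
  define M where "M = real (?m ^ ?m)"
  have M: "M > 0" by (simp add: M_def)
  \<comment> \<open>Then an interval of radius \<open>d * (M * vol)\<close> has length
    \<open>e * vol / (2 * c) ^ m\<close>, and the cubes have total volume at most
    \<open>(2 * c) ^ m\<close>.\<close>
  define d where "d = e / (2 * M * (2 * c) ^ ?m)"
  have d: "d > 0" using e c M by (simp add: d_def)
  obtain r where r: "\<And>x. x \<in> S \<Longrightarrow> 0 < r x"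
      "\<And>x y. x \<in> S \<Longrightarrow> y \<in> S \<Longrightarrow> norm (y - x) < r x \<Longrightarrow> \<bar>f y - f x\<bar> \<le> d * norm (y - x) ^ ?m"
    using small[OF _ d] by metis
  \<comment> \<open>A gauge must be positive everywhere; the value one is a filler off
    \<open>S\<close>, as every cube is attached to a point of \<open>S\<close>.\<close>
  define r' where "r' x = (if x \<in> S then r x else 1)" for x
  have ga: "gauge (\<lambda>x. ball x (r' x))"
    using r(1) by (auto simp: gauge_def r'_def)
  have box_cc: "box (- vec c) (vec c :: real ^ 'm) \<noteq> {}"
    using c by (auto simp: interval_ne_empty_cart)
  obtain \<D> where \<D>: "countable \<D>" and sub_cc: "\<Union>\<D> \<subseteq> cbox (- vec c) (vec c :: real ^ 'm)"
    and cbox: "\<And>K. K \<in> \<D> \<Longrightarrow> interior K \<noteq> {} \<and> (\<exists>u v. K = cbox u v)"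
    and disj: "pairwise (\<lambda>A B. interior A \<inter> interior B = {}) \<D>"
    and covered: "\<And>K. K \<in> \<D> \<Longrightarrow> \<exists>x \<in> S \<inter> K. K \<subseteq> ball x (r' x)"
    and close: "\<And>u v. cbox u v \<in> \<D> \<Longrightarrow> \<exists>n. \<forall>i::'m. v $ i - u $ i = 2 * c / 2 ^ n"
    and covers: "S \<subseteq> \<Union>\<D>"
    by (rule covering_lemma[OF S box_cc ga])
      (auto simp: Basis_vec_def cart_eq_inner_axis[symmetric])
  let ?\<mu> = "measure lebesgue"
  have "\<exists>T. T \<in> lmeasurable \<and> f ` (K \<inter> S) \<subseteq> T \<and> ?\<mu> T \<le> e / (2 * c) ^ ?m * ?\<mu> K" if K: "K \<in> \<D>" for K
  proof -
    obtain u v where uv: "K = cbox u v" using cbox K by blast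
    then have uv_ne: "cbox u v \<noteq> {}" using cbox K by fastforce
    obtain x where x: "x \<in> S \<inter> cbox u v" "cbox u v \<subseteq> ball x (r' x)" using K covered uv by blast
    define \<delta> where "\<delta> = d * norm (v - u) ^ ?m"
    have \<delta>: "\<delta> \<ge> 0" using d by (simp add: \<delta>_def)
    obtain n where n: "\<And>i. v $ i - u $ i = 2 * c / 2 ^ n" using close K uv by blast
    have "norm (v - u) ^ ?m \<le> (\<Sum>i\<in>UNIV. \<bar>(v - u) $ i\<bar>) ^ ?m"
      by (intro norm_le_l1_cart power_mono) auto
    also have "\<dots> \<le> (\<Prod>i\<in>UNIV. v $ i - u $ i) * M"
      by (simp add: n field_simps \<open>c > 0\<close> less_eq_real_def M_def)
    also have "\<dots> = ?\<mu> K * M" by (simp add: uv uv_ne content_cbox_cart)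
    finally have vol: "norm (v - u) ^ ?m \<le> ?\<mu> K * M" .
    show ?thesis
    proof (intro exI conjI)
      show "cbox (f x - \<delta>) (f x + \<delta>) \<in> lmeasurable" by simp
      show "f ` (K \<inter> S) \<subseteq> cbox (f x - \<delta>) (f x + \<delta>)"
      proof
        fix z assume "z \<in> f ` (K \<inter> S)"
        then obtain y where z: "z = f y" and y: "y \<in> cbox u v" "y \<in> S" using uv by blast
        have "norm (y - x) < r x"
          using x y by (auto simp: r'_def dist_norm norm_minus_commute)
        then have "\<bar>f y - f x\<bar> \<le> d * norm (y - x) ^ ?m" using r(2) x y by blast
        also have "norm (y - x) \<le> norm (v - u)"
        proof (rule norm_le_componentwise_cart)
          show "norm ((y - x) $ i) \<le> norm ((v - u) $ i)" for i
            using x y by (force simp: mem_box_cart dest!: spec[where x = i])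
        qed
        then have "d * norm (y - x) ^ ?m \<le> \<delta>"
          unfolding \<delta>_def using d by (intro mult_left_mono power_mono) auto
        finally show "z \<in> cbox (f x - \<delta>) (f x + \<delta>)" unfolding z by (simp add: abs_le_iff)
      qed
      have "?\<mu> (cbox (f x - \<delta>) (f x + \<delta>)) = 2 * \<delta>" using \<delta> by simp
      also have "\<dots> \<le> 2 * d * (?\<mu> K * M)"
        unfolding \<delta>_def using mult_left_mono[OF vol, of "2 * d"] d by simp
      also have "\<dots> = e / (2 * c) ^ ?m * ?\<mu> K" using M c by (simp add: d_def)
      finally show "?\<mu> (cbox (f x - \<delta>) (f x + \<delta>)) \<le> e / (2 * c) ^ ?m * ?\<mu> K" .
    qed
  qed
  then obtain g where meas_g: "\<And>K. K \<in> \<D> \<Longrightarrow> g K \<in> lmeasurable"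
    and sub_g: "\<And>K. K \<in> \<D> \<Longrightarrow> f ` (K \<inter> S) \<subseteq> g K"
    and le_g: "\<And>K. K \<in> \<D> \<Longrightarrow> ?\<mu> (g K) \<le> e / (2 * c) ^ ?m * ?\<mu> K"
    by metis
  have le_e: "?\<mu> (\<Union>i\<in>\<F>. g i) \<le> e" if "\<F> \<subseteq> \<D>" "finite \<F>" for \<F>
  proof -
    have "?\<mu> (\<Union>i\<in>\<F>. g i) \<le> (\<Sum>i\<in>\<F>. ?\<mu> (g i))"
      using meas_g that by (auto intro: measure_UNION_le[OF \<open>finite \<F>\<close>])
    also have "\<dots> \<le> (\<Sum>K\<in>\<F>. e / (2 * c) ^ ?m * ?\<mu> K)"
      using that by (meson le_g subsetCE sum_mono)
    also have "\<dots> = e / (2 * c) ^ ?m * (\<Sum>K\<in>\<F>. ?\<mu> K)" by (simp add: sum_distrib_left)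
    also have "\<dots> \<le> e"
    proof -
      have div: "\<F> division_of \<Union>\<F>"
      proof (rule division_ofI)
        show "K \<subseteq> \<Union>\<F>" "K \<noteq> {}" "\<exists>a b. K = cbox a b" if "K \<in> \<F>" for K
          using that covered cbox \<open>\<F> \<subseteq> \<D>\<close> by (auto simp: Union_upper)
        show "interior K \<inter> interior L = {}" if "K \<in> \<F>" and "L \<in> \<F>" and "K \<noteq> L" for K L
          using that \<open>\<F> \<subseteq> \<D>\<close> disj unfolding pairwise_def by blast
      qed (use that in auto)
      then have "sum ?\<mu> \<F> \<le> ?\<mu> (\<Union>\<F>)" by (simp add: content_division)
      also have "\<dots> \<le> ?\<mu> (cbox (- vec c) (vec c :: real ^ 'm))"
      proof (rule measure_mono_fmeasurable)
        show "\<Union>\<F> \<subseteq> cbox (- vec c) (vec c)"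
          using that sub_cc by blast
      qed (use div lmeasurable_division in auto)
      also have "\<dots> \<le> (2 * c) ^ ?m" using c by (simp add: content_cbox_if_cart)
      finally have "sum ?\<mu> \<F> \<le> (2 * c) ^ ?m" .
      then have "e / (2 * c) ^ ?m * sum ?\<mu> \<F> \<le> e / (2 * c) ^ ?m * (2 * c) ^ ?m"
        using e c by (intro mult_left_mono) auto
      then show ?thesis using c by simp
    qed
    finally show ?thesis .
  qed
  show "\<exists>T. f ` S \<subseteq> T \<and> T \<in> lmeasurable \<and> ?\<mu> T \<le> e"
  proof (intro exI conjI)
    show "f ` S \<subseteq> \<Union> (g ` \<D>)" using covers sub_g by force
    show "\<Union> (g ` \<D>) \<in> lmeasurable" by (rule fmeasurable_UN_bound[OF \<open>countable \<D>\<close> meas_g le_e])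
    show "?\<mu> (\<Union> (g ` \<D>)) \<le> e" by (rule measure_UN_bound[OF \<open>countable \<D>\<close> meas_g le_e])
  qed
qed

lemma negligible_image_small_order:
  fixes f :: "real ^ 'm \<Rightarrow> real"
  assumes small: "\<And>x e. x \<in> S \<Longrightarrow> e > 0 \<Longrightarrow>
      \<exists>d>0. \<forall>y\<in>S. norm (y - x) < d \<longrightarrow> \<bar>f y - f x\<bar> \<le> e * norm (y - x) ^ CARD('m)"
  shows "negligible (f ` S)"
proof -
  let ?C = "\<lambda>n::nat. cbox (- vec (real (Suc n))) (vec (real (Suc n))) :: (real ^ 'm) set"
  have "negligible (f ` (S \<inter> ?C n))" for n
  proof (rule negligible_image_small_order_bounded)
    fix x and e :: real assume "x \<in> S \<inter> ?C n" "e > 0"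
    then show "\<exists>d>0. \<forall>y\<in>S \<inter> ?C n. norm (y - x) < d \<longrightarrow> \<bar>f y - f x\<bar> \<le> e * norm (y - x) ^ CARD('m)"
      using small[of x e] by blast
  qed auto
  then have "negligible (\<Union>n. f ` (S \<inter> ?C n))" by (intro negligible_Union_nat)
  moreover have "f ` S \<subseteq> (\<Union>n. f ` (S \<inter> ?C n))"
  proof
    fix y assume "y \<in> f ` S"
    then obtain x where x: "x \<in> S" "y = f x" by blast
    obtain n where n: "norm x \<le> real n" using real_arch_simple by blast
    have "- real (Suc n) \<le> x $ i \<and> x $ i \<le> real (Suc n)" for i
      using component_le_norm_cart[of x i] n by auto
    then have "x \<in> ?C n" unfolding mem_box_cart by simp
    then show "y \<in> (\<Union>n. f ` (S \<inter> ?C n))" using x by blast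
  qed
  ultimately show ?thesis using negligible_subset by blast
qed

text \<open>The head of the list is differentiated first, so the last direction is the outermost.
  Splitting at the front suits induction on the function, splitting at the end exhibits the first
  derivative that fails to vanish.\<close>

primrec iter_deriv :: "'a::euclidean_space list \<Rightarrow> ('a \<Rightarrow> real) \<Rightarrow> 'a \<Rightarrow> real" where
  "iter_deriv [] f = f"
| "iter_deriv (b # bs) f = iter_deriv bs (\<lambda>x. frechet_derivative f (at x) b)"

lemma iter_deriv_snoc: "iter_deriv (bs @ [b]) f = (\<lambda>x. frechet_derivative (iter_deriv bs f) (at x) b)"
  by (induction bs arbitrary: f) auto

lemma smooth_on_iter_deriv: "smooth_on S f \<Longrightarrow> smooth_on S (iter_deriv bs f)"
  by (induction bs arbitrary: f) (auto intro: smooth_on_frechet_derivative)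

lemma span_Basis_subset_representation:
  fixes v :: "'a::euclidean_space"
  assumes "B \<subseteq> Basis" "v \<in> span B"
  shows "v = (\<Sum>b\<in>B. (v \<bullet> b) *\<^sub>R b)"
proof -
  have "v = (\<Sum>b\<in>Basis. (v \<bullet> b) *\<^sub>R b)" by (simp add: euclidean_representation)
  also have "\<dots> = (\<Sum>b\<in>B. (v \<bullet> b) *\<^sub>R b)"
    using assms span_substd_basis[OF assms(1)] by (intro sum.mono_neutral_right) auto
  finally show ?thesis .
qed

text \<open>Each partial derivative along \<open>B\<close> is flat again, hence of order
  \<open>n\<close> by induction; the mean value theorem on the segment from \<open>x\<close>, which
  stays in the translate of \<open>span B\<close>, gains one order.\<close>

lemma flat_point_small_order:
  fixes f :: "'a::euclidean_space \<Rightarrow> real"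
  assumes S: "open S" "x \<in> S" and B: "B \<subseteq> Basis"
    and f: "smooth_on S f"
    and flat: "\<And>bs. bs \<noteq> [] \<Longrightarrow> set bs \<subseteq> B \<Longrightarrow> iter_deriv bs f x = 0"
    and e: "e > 0"
  shows "\<exists>d>0. \<forall>y. y - x \<in> span B \<and> norm (y - x) < d \<longrightarrow> \<bar>f y - f x\<bar> \<le> e * norm (y - x) ^ n"
  using f flat e
proof (induction n arbitrary: f e)
  case 0
  have "isCont f x"
    using smooth_on_continuous_on[OF 0(1)] S by (simp add: continuous_on_eq_continuous_at)
  then obtain d where "d > 0" "\<And>y. dist y x < d \<Longrightarrow> dist (f y) (f x) < e"
    using \<open>e > 0\<close> unfolding continuous_at_eps_delta by metis
  then show ?case by (force simp: dist_norm intro!: exI[of _ d])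
next
  case (Suc n)
  have finB: "finite B" using B finite_Basis finite_subset by blast
  \<comment> \<open>Shares \<open>e\<close> among the coordinates; the added one avoids a division
    by zero when \<open>B\<close> is empty.\<close>
  define e' where "e' = e / (real (card B) + 1)"
  have e': "e' > 0" using Suc.prems(3) by (simp add: e'_def)
  let ?D = "\<lambda>b y. frechet_derivative f (at y) b"
  have "\<exists>d>0. \<forall>y. y - x \<in> span B \<and> norm (y - x) < d \<longrightarrow> \<bar>?D b y\<bar> \<le> e' * norm (y - x) ^ n"
    if b: "b \<in> B" for b
  proof -
    have "?D b x = 0" using Suc.prems(2)[of "[b]"] b by simp
    moreover have "\<exists>d>0. \<forall>y. y - x \<in> span B \<and> norm (y - x) < d \<longrightarrow>
        \<bar>?D b y - ?D b x\<bar> \<le> e' * norm (y - x) ^ n"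
    proof (rule Suc.IH[OF smooth_on_frechet_derivative[OF Suc.prems(1)] _ e'])
      fix bs assume "bs \<noteq> []" "set bs \<subseteq> B"
      then show "iter_deriv bs (?D b) x = 0" using Suc.prems(2)[of "b # bs"] b by simp
    qed
    ultimately show ?thesis by simp
  qed
  then obtain dd where dd: "\<And>b. b \<in> B \<Longrightarrow> dd b > 0"
    "\<And>b y. b \<in> B \<Longrightarrow> y - x \<in> span B \<Longrightarrow> norm (y - x) < dd b \<Longrightarrow> \<bar>?D b y\<bar> \<le> e' * norm (y - x) ^ n"
    by metis
  obtain r where r: "r > 0" "ball x r \<subseteq> S" using S openE by blast
  \<comment> \<open>Inserting \<open>r\<close> keeps the segment inside \<open>S\<close> and makes
    the set nonempty when \<open>B\<close> is empty.\<close>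
  define d where "d = Min (insert r (dd ` B))"
  have d: "d > 0" "d \<le> r" "\<And>b. b \<in> B \<Longrightarrow> d \<le> dd b"
    using finB r dd by (auto simp: d_def)
  show ?case
  proof (intro exI[of _ d] conjI allI impI)
    fix y assume "y - x \<in> span B \<and> norm (y - x) < d"
    then have yB: "y - x \<in> span B" and yd: "norm (y - x) < d" by auto
    define v where "v = y - x"
    have "\<exists>z>0. z < 1 \<and> f (x + 1 *\<^sub>R v) - f (x + 0 *\<^sub>R v) = (1 - 0) * ?D v (x + z *\<^sub>R v)"
    proof (rule MVT2)
      fix t :: real assume t: "0 \<le> t" "t \<le> 1"
      have "norm (t *\<^sub>R v) < r"
        using t yd d(2) mult_left_le_one_le[of "norm v" t] by (simp add: v_def)
      then have "x + t *\<^sub>R v \<in> S" using r by (auto simp: dist_norm)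
      then show "((\<lambda>t. f (x + t *\<^sub>R v)) has_real_derivative ?D v (x + t *\<^sub>R v)) (at t)"
        by (intro has_real_derivative_directional smooth_on_has_derivative[OF Suc.prems(1)])
    qed simp
    then obtain z where z: "0 < z" "z < 1" "f y - f x = ?D v (x + z *\<^sub>R v)"
      by (auto simp: v_def)
    define w where "w = x + z *\<^sub>R v"
    have wx: "w - x = z *\<^sub>R v" by (simp add: w_def)
    have nw: "norm (w - x) \<le> norm v" using z by (simp add: wx mult_left_le_one_le)
    have wB: "w - x \<in> span B" using yB by (simp add: wx v_def span_scale)
    have wS: "w \<in> S" using nw yd d(2) r(2) by (auto simp: v_def dist_norm norm_minus_commute)
    have lin: "linear (frechet_derivative f (at w))"
      using smooth_on_has_derivative[OF Suc.prems(1) wS] has_derivative_linear by blast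
    have "?D v w = (\<Sum>b\<in>B. (v \<bullet> b) *\<^sub>R ?D b w)"
      by (subst span_Basis_subset_representation[OF B, of v])
        (use yB in \<open>simp_all add: v_def linear_sum[OF lin] linear_scale[OF lin]\<close>)
    also have "\<bar>\<dots>\<bar> \<le> (\<Sum>b\<in>B. \<bar>v \<bullet> b\<bar> * \<bar>?D b w\<bar>)"
      using sum_abs[of "\<lambda>b. (v \<bullet> b) *\<^sub>R ?D b w" B] by (simp add: abs_mult)
    also have "\<dots> \<le> (\<Sum>b\<in>B. norm v * (e' * norm v ^ n))"
    proof (intro sum_mono mult_mono)
      fix b assume b: "b \<in> B"
      show "\<bar>v \<bullet> b\<bar> \<le> norm v" using b B Basis_le_norm by blast
      have "\<bar>?D b w\<bar> \<le> e' * norm (w - x) ^ n"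
        by (rule dd(2)[OF b wB]) (use nw yd d(3)[OF b] in \<open>simp add: v_def\<close>)
      also have "\<dots> \<le> e' * norm v ^ n" using nw e' by (intro mult_left_mono power_mono) auto
      finally show "\<bar>?D b w\<bar> \<le> e' * norm v ^ n" .
    qed auto
    also have "\<dots> = (real (card B) * e') * norm v ^ Suc n" by simp
    also have "\<dots> \<le> e * norm v ^ Suc n"
    proof (rule mult_right_mono)
      have "real (card B) * e' \<le> (real (card B) + 1) * e'" using e' by (simp add: algebra_simps)
      also have "\<dots> = e" by (simp add: e'_def add_nonneg_eq_0_iff)
      finally show "real (card B) * e' \<le> e" .
    qed simp
    finally show "\<bar>f y - f x\<bar> \<le> e * norm (y - x) ^ Suc n"
      using z by (simp add: w_def v_def)
  qed (fact d(1))
qed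


text \<open>By the Lindelof property countably many of the neighbourhoods cover
  \<open>Z\<close>.\<close>

lemma negligible_image_local:
  fixes f :: "'a::second_countable_topology \<Rightarrow> 'b::euclidean_space"
  assumes "\<And>x. x \<in> Z \<Longrightarrow> \<exists>T. open T \<and> x \<in> T \<and> negligible (f ` (Z \<inter> T))"
  shows "negligible (f ` Z)"
proof -
  let ?F = "{T. open T \<and> negligible (f ` (Z \<inter> T))}"
  obtain F where F: "F \<subseteq> ?F" "countable F" "\<Union>F = \<Union>?F"
    using Lindelof[of ?F] by blast
  have "negligible (\<Union>T\<in>F. f ` (Z \<inter> T))"
    using F by (intro negligible_countable_Union) auto
  moreover have "f ` Z \<subseteq> (\<Union>T\<in>F. f ` (Z \<inter> T))"
  proof clarify
    fix x assume x: "x \<in> Z"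
    then have "x \<in> \<Union>?F" using assms by blast
    then obtain T where "T \<in> F" "x \<in> T" using F(3) by blast
    then show "f x \<in> (\<Union>T\<in>F. f ` (Z \<inter> T))" using x by blast
  qed
  ultimately show ?thesis using negligible_subset by blast
qed

text \<open>Critical points on the subspace \<open>span B\<close>: if an iterated derivative \<open>h\<close> vanishes at such a point
  but has a nonzero derivative along \<open>b\<close>, replacing the coordinate \<open>b\<close> by \<open>h\<close> reduces to the subspace
  \<open>span (B - {b})\<close>; at the remaining points the function is flat.\<close>

lemma sard_real_valued_subspace:
  fixes f :: "real ^ 'm \<Rightarrow> real"
  assumes "B \<subseteq> Basis" "open S" "smooth_on S f"
  shows "negligible (f ` {x \<in> S \<inter> span B. \<forall>b\<in>B. frechet_derivative f (at x) b = 0})"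
  using assms
proof (induction "card B" arbitrary: B S f rule: less_induct)
  case less
  note B = \<open>B \<subseteq> Basis\<close> and S = \<open>open S\<close> and f = \<open>smooth_on S f\<close>
  have finB: "finite B" using B finite_Basis finite_subset by blast
  define C where "C = {x \<in> S \<inter> span B. \<forall>b\<in>B. frechet_derivative f (at x) b = 0}"
  define F where "F = {x \<in> C. \<forall>bs. bs \<noteq> [] \<and> set bs \<subseteq> B \<longrightarrow> iter_deriv bs f x = 0}"
  \<comment> \<open>The index pairs form the countable set \<open>lists B \<times> B\<close>, so
    each set may be treated separately, and near each of its points.\<close>
  define Z where "Z = (\<lambda>(bs, b). {x \<in> C. iter_deriv bs f x = 0 \<and>
      frechet_derivative (iter_deriv bs f) (at x) b \<noteq> 0})"
  \<comment> \<open>Flatness provides every order, in particular the full dimension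
    \<open>CARD('m)\<close>, however small the subspace is.\<close>
  have F: "negligible (f ` F)"
  proof (rule negligible_image_small_order)
    fix x and e :: real assume x: "x \<in> F" and e: "e > 0"
    have "y - x \<in> span B" if "y \<in> F" for y
      using that x by (simp add: F_def C_def span_diff)
    moreover have "\<exists>d>0. \<forall>y. y - x \<in> span B \<and> norm (y - x) < d \<longrightarrow>
        \<bar>f y - f x\<bar> \<le> e * norm (y - x) ^ CARD('m)"
      by (rule flat_point_small_order[OF S _ B f _ e]) (use x in \<open>auto simp: F_def C_def\<close>)
    ultimately show "\<exists>d>0. \<forall>y\<in>F. norm (y - x) < d \<longrightarrow> \<bar>f y - f x\<bar> \<le> e * norm (y - x) ^ CARD('m)"
      by blast
  qed
  have Z: "negligible (f ` Z (bs, b))" if b: "b \<in> B" for bs b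
  proof (rule negligible_image_local)
    fix x0 assume x0: "x0 \<in> Z (bs, b)"
    define h where "h = iter_deriv bs f"
    have hs: "smooth_on S h" unfolding h_def using f by (rule smooth_on_iter_deriv)
    have x0': "x0 \<in> S" "h x0 = 0" "frechet_derivative h (at x0) b \<noteq> 0"
      using x0 by (auto simp: Z_def C_def h_def)
    have bb: "b \<bullet> b = 1" using b B by (meson inner_same_Basis subsetD)
    \<comment> \<open>The coordinate along \<open>b\<close> becomes \<open>h x\<close> and all
      others are kept. The map is a local diffeomorphism because \<open>h\<close> has a nonzero
      derivative along \<open>b\<close>, and it sends zeros of \<open>h\<close> in
      \<open>span B\<close> into \<open>span (B - {b})\<close>.\<close>
    define \<Phi> where "\<Phi> x = x + (h x - x \<bullet> b) *\<^sub>R b" for x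
    have \<Phi>s: "smooth_on S \<Phi>"
      unfolding \<Phi>_def using hs
      by (intro smooth_on_add smooth_on_scaleR smooth_on_diff smooth_on_id smooth_on_const S
          smooth_on_bounded_linear[OF S bounded_linear_inner_left])
    have \<Phi>': "frechet_derivative \<Phi> (at x) = (\<lambda>v. v + (frechet_derivative h (at x) v - v \<bullet> b) *\<^sub>R b)"
      if "x \<in> S" for x
    proof -
      have "(\<Phi> has_derivative (\<lambda>v. v + (frechet_derivative h (at x) v - v \<bullet> b) *\<^sub>R b)) (at x)"
        unfolding \<Phi>_def
        by (intro has_derivative_add has_derivative_ident has_derivative_scaleR_left has_derivative_diff
            smooth_on_has_derivative[OF hs that] has_derivative_inner_left)
      then show ?thesis by (rule frechet_derivative_at[symmetric])
    qed
    have lin_h: "linear (frechet_derivative h (at x))" if "x \<in> S" for x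
      using smooth_on_has_derivative[OF hs that] has_derivative_linear by blast
    have lin_f: "linear (frechet_derivative f (at x))" if "x \<in> S" for x
      using smooth_on_has_derivative[OF f that] has_derivative_linear by blast
    have lin_\<Phi>: "linear (frechet_derivative \<Phi> (at x0))"
      using smooth_on_has_derivative[OF \<Phi>s x0'(1)] has_derivative_linear by blast
    have "inj (frechet_derivative \<Phi> (at x0))"
      unfolding linear_injective_0[OF lin_\<Phi>] unfolding \<Phi>'[OF x0'(1)]
    proof (intro allI impI)
      fix v assume v0: "v + (frechet_derivative h (at x0) v - v \<bullet> b) *\<^sub>R b = 0"
      define \<tau> where "\<tau> = - (frechet_derivative h (at x0) v - v \<bullet> b)"
      have v: "v = \<tau> *\<^sub>R b" using v0 by (simp add: \<tau>_def add_eq_0_iff2 scaleR_left_diff_distrib)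
      have "\<tau> = - (\<tau> * frechet_derivative h (at x0) b - \<tau>)"
        using \<tau>_def unfolding v by (simp add: linear_scale[OF lin_h[OF x0'(1)]] bb)
      then show "v = 0" using x0'(3) v by simp
    qed
    from smooth_inverse_function[OF S \<Phi>s x0'(1) this]
    obtain T W G where T: "open T" "x0 \<in> T" "T \<subseteq> S" and W: "open W"
      and hom: "homeomorphism T W \<Phi> G" and G: "smooth_on W G" .
    have GT: "G y \<in> T" "\<Phi> (G y) = y" if "y \<in> W" for y
      using hom that by (auto simp: homeomorphism_def)
    have \<Phi>W: "\<Phi> x \<in> W" "G (\<Phi> x) = x" if "x \<in> T" for x
      using hom that by (auto simp: homeomorphism_def)
    have fG: "smooth_on W (\<lambda>y. f (G y))"
      by (rule smooth_on_compose[OF W S _ f G]) (use GT T in auto)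
    have neg: "negligible ((\<lambda>y. f (G y)) `
        {y \<in> W \<inter> span (B - {b}). \<forall>b'\<in>B - {b}. frechet_derivative (\<lambda>y. f (G y)) (at y) b' = 0})"
      by (rule less.hyps) (use card_Diff1_less[OF finB b] B W fG in auto)
    have "f ` (Z (bs, b) \<inter> T) \<subseteq> (\<lambda>y. f (G y)) `
        {y \<in> W \<inter> span (B - {b}). \<forall>b'\<in>B - {b}. frechet_derivative (\<lambda>y. f (G y)) (at y) b' = 0}"
    proof clarify
      fix x assume xZ: "x \<in> Z (bs, b)" and xT: "x \<in> T"
      have xS: "x \<in> S" and xB: "x \<in> span B" and hx: "h x = 0"
        and crit: "\<And>b'. b' \<in> B \<Longrightarrow> frechet_derivative f (at x) b' = 0"
        using xZ by (auto simp: Z_def C_def h_def)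
      define y where "y = \<Phi> x"
      have yW: "y \<in> W" and Gy: "G y = x" using \<Phi>W[OF xT] by (auto simp: y_def)
      have "y \<bullet> i = 0" if i: "i \<in> Basis" "i \<notin> B - {b}" for i
      proof (cases "i = b")
        case True
        then show ?thesis by (simp add: y_def \<Phi>_def hx bb inner_add_left inner_diff_left)
      next
        case False
        then have "b \<bullet> i = 0" "x \<bullet> i = 0"
          using i b B xB span_substd_basis[OF B] by (auto simp: inner_Basis)
        then show ?thesis by (simp add: y_def \<Phi>_def inner_add_left)
      qed
      then have yB: "y \<in> span (B - {b})"
        using span_substd_basis[of "B - {b}"] B by auto
      have "frechet_derivative (\<lambda>y. f (G y)) (at y) b' = 0" if b': "b' \<in> B - {b}" for b'
      proof -
        note dG = smooth_on_has_derivative[OF G yW]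
        have df: "(f has_derivative frechet_derivative f (at x)) (at (G y))"
          using smooth_on_has_derivative[OF f xS] Gy by simp
        have d\<Phi>: "(\<Phi> has_derivative frechet_derivative \<Phi> (at x)) (at (G y))"
          using smooth_on_has_derivative[OF \<Phi>s xS] Gy by simp
        define w where "w = frechet_derivative G (at y) b'"
        have "((\<lambda>y. y) has_derivative (\<lambda>v. frechet_derivative \<Phi> (at x) (frechet_derivative G (at y) v))) (at y)"
          by (rule has_derivative_transform_within_open[OF has_derivative_compose[OF dG d\<Phi>] W yW])
            (use GT in auto)
        then have "(\<lambda>v. frechet_derivative \<Phi> (at x) (frechet_derivative G (at y) v)) = (\<lambda>v. v)"
          using has_derivative_unique has_derivative_ident by blast
        then have "frechet_derivative \<Phi> (at x) w = b'" unfolding w_def by meson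
        then have "w + (frechet_derivative h (at x) w - w \<bullet> b) *\<^sub>R b = b'"
          by (simp add: \<Phi>'[OF xS])
        \<comment> \<open>The derivative of \<open>G\<close> changes \<open>b'\<close> only by a
          multiple of \<open>b\<close>. Both directions lie in \<open>B\<close>, so being critical
          along \<open>B\<close> carries over to \<open>f \<circ> G\<close>.\<close>
        then have w: "w = b' - (frechet_derivative h (at x) w - w \<bullet> b) *\<^sub>R b" by (simp add: eq_diff_eq)
        have "frechet_derivative f (at x) w = 0"
          by (subst w) (use crit b b' in \<open>simp add: linear_diff[OF lin_f[OF xS]] linear_scale[OF lin_f[OF xS]]\<close>)
        then show ?thesis
          using frechet_derivative_at[OF has_derivative_compose[OF dG df], symmetric]
          by (simp add: w_def)
      qed
      then have "y \<in> {y \<in> W \<inter> span (B - {b}). \<forall>b'\<in>B - {b}. frechet_derivative (\<lambda>y. f (G y)) (at y) b' = 0}"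
        using yW yB by blast
      then show "f x \<in> (\<lambda>y. f (G y)) `
        {y \<in> W \<inter> span (B - {b}). \<forall>b'\<in>B - {b}. frechet_derivative (\<lambda>y. f (G y)) (at y) b' = 0}"
        using Gy by (intro image_eqI[of _ _ y]) auto
    qed
    then have "negligible (f ` (Z (bs, b) \<inter> T))" using neg negligible_subset by blast
    then show "\<exists>T. open T \<and> x0 \<in> T \<and> negligible (f ` (Z (bs, b) \<inter> T))" using T by blast
  qed
  have cover: "C \<subseteq> F \<union> (\<Union>p\<in>lists B \<times> B. Z p)"
  proof
    fix x assume x: "x \<in> C"
    show "x \<in> F \<union> (\<Union>p\<in>lists B \<times> B. Z p)"
    proof (rule ccontr)
      assume not: "x \<notin> F \<union> (\<Union>p\<in>lists B \<times> B. Z p)"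
      \<comment> \<open>A first nonvanishing derivative would put \<open>x\<close> into some
        \<open>Z (bs, b)\<close>; those of order one vanish because \<open>x\<close> is
        critical.\<close>
      have "iter_deriv bs f x = 0" if "bs \<noteq> []" "set bs \<subseteq> B" for bs
        using that
      proof (induction bs rule: rev_induct)
        case (snoc b bs)
        show ?case
        proof (cases "bs = []")
          case True
          then show ?thesis using x snoc.prems by (simp add: C_def)
        next
          case False
          then have "iter_deriv bs f x = 0" using snoc by simp
          moreover have "x \<notin> Z (bs, b)" using not snoc.prems by (auto simp: in_lists_conv_set)
          ultimately show ?thesis using x by (simp add: Z_def iter_deriv_snoc)
        qed
      qed simp
      then show False using not x by (auto simp: F_def)
    qed
  qed
  have "countable (lists B \<times> B)" using finB by (intro countable_SIGMA countable_lists countable_finite)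
  moreover have "negligible (f ` Z p)" if "p \<in> lists B \<times> B" for p
    using that Z by (cases p) auto
  ultimately have "negligible (\<Union>p\<in>lists B \<times> B. f ` Z p)"
    by (intro negligible_countable_Union countable_image) blast+
  with F have "negligible (f ` F \<union> (\<Union>p\<in>lists B \<times> B. f ` Z p))" by (rule negligible_Un)
  then have "negligible (f ` C)" 
    by (rule negligible_subset) (use image_mono[OF cover, of f] in \<open>simp add: image_Un image_UN\<close>)
  then show ?case by (simp add: C_def)
qed

theorem sard_real_valued:
  fixes f :: "real ^ 'm \<Rightarrow> real"
  assumes "open S" "smooth_on S f"
  shows "negligible (f ` {x \<in> S. frechet_derivative f (at x) = (\<lambda>v. 0)})"
proof -
  have "{x \<in> S. frechet_derivative f (at x) = (\<lambda>v. 0)} \<subseteq>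
      {x \<in> S \<inter> span Basis. \<forall>b\<in>Basis. frechet_derivative f (at x) b = 0}" by auto
  then show ?thesis
    by (intro negligible_subset[OF sard_real_valued_subspace[OF order_refl assms] image_mono])
qed

section \<open>Smooth maps into and out of manifolds\<close>

lemma has_derivative_bilinear_field:
  fixes T :: "'a::real_normed_vector \<Rightarrow> 'e::euclidean_space \<Rightarrow> 'f::euclidean_space \<Rightarrow> 'b::real_normed_vector"
  assumes S: "open S" "x \<in> S"
    and lin1: "\<And>y v. y \<in> S \<Longrightarrow> linear (\<lambda>u. T y u v)"
    and lin2: "\<And>y u. y \<in> S \<Longrightarrow> linear (\<lambda>v. T y u v)"
    and T': "\<And>u v. ((\<lambda>y. T y u v) has_derivative T' u v) (at x)"
    and u: "(u has_derivative u') (at x)" and v: "(v has_derivative v') (at x)"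
  shows "((\<lambda>y. T y (u y) (v y)) has_derivative
     (\<lambda>w. T' (u x) (v x) w + T x (u x) (v' w) + T x (u' w) (v x))) (at x)"
  by (rule has_derivative_linear_field[OF S lin1 _ u], assumption,
      rule has_derivative_linear_field[OF S lin2 T' v])

lemma has_derivative_trilinear_field:
  fixes T :: "'a::real_normed_vector \<Rightarrow> 'e::euclidean_space \<Rightarrow> 'f::euclidean_space \<Rightarrow>
    'g::euclidean_space \<Rightarrow> 'b::real_normed_vector"
  assumes S: "open S" "x \<in> S"
    and lin1: "\<And>y v w. y \<in> S \<Longrightarrow> linear (\<lambda>u. T y u v w)"
    and lin2: "\<And>y u w. y \<in> S \<Longrightarrow> linear (\<lambda>v. T y u v w)"
    and lin3: "\<And>y u v. y \<in> S \<Longrightarrow> linear (\<lambda>w. T y u v w)"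
    and T': "\<And>u v w. ((\<lambda>y. T y u v w) has_derivative T' u v w) (at x)"
    and u: "(u has_derivative u') (at x)" and v: "(v has_derivative v') (at x)"
    and w: "(w has_derivative w') (at x)"
  shows "((\<lambda>y. T y (u y) (v y) (w y)) has_derivative
     (\<lambda>h. T' (u x) (v x) (w x) h + T x (u x) (v x) (w' h) + T x (u x) (v' h) (w x) + T x (u' h) (v x) (w x)))
     (at x)"
  by (rule has_derivative_linear_field[OF S lin1 _ u], assumption,
      rule has_derivative_bilinear_field[OF S lin2 lin3 T' v w])

text \<open>Smoothness of functions on an open set \<open>Q\<close> of the manifold, and of maps from an open set \<open>B\<close> of
  a Euclidean space to the manifold; compositions of the latter with the former are all that is
  needed to check the changes of coordinates below.\<close>

definition smooth_to ::
  "'p topology \<Rightarrow> ('p, 'e::euclidean_space) chart set \<Rightarrow> 'p set \<Rightarrow> ('p \<Rightarrow> 'b::real_normed_vector) \<Rightarrow> bool" where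
  "smooth_to X A Q \<phi> \<longleftrightarrow> openin X Q \<and>
     (\<forall>c\<in>A. smooth_on {x \<in> chart_image c. chart_inv c x \<in> Q} (\<lambda>x. \<phi> (chart_inv c x)))"

definition smooth_from ::
  "'p topology \<Rightarrow> ('p, 'e::euclidean_space) chart set \<Rightarrow> 'a::euclidean_space set \<Rightarrow> ('a \<Rightarrow> 'p) \<Rightarrow> bool" where
  "smooth_from X A B S \<longleftrightarrow> open B \<and> S ` B \<subseteq> topspace X \<and>
     (\<forall>Q. openin X Q \<longrightarrow> open {y \<in> B. S y \<in> Q}) \<and>
     (\<forall>c\<in>A. smooth_on {y \<in> B. S y \<in> fst c} (\<lambda>y. snd c (S y)))"

lemma chart_inv_in: "x \<in> chart_image c \<Longrightarrow> chart_inv c x \<in> fst c"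
  by (simp add: chart_image_def chart_inv_def inv_into_into)

lemma chart_chart_inv: "x \<in> chart_image c \<Longrightarrow> snd c (chart_inv c x) = x"
  by (simp add: chart_image_def chart_inv_def f_inv_into_f)

lemma chart_in_image: "p \<in> fst c \<Longrightarrow> snd c p \<in> chart_image c"
  by (simp add: chart_image_def)

locale smooth_mfd =
  fixes X :: "'p topology" and A :: "('p, 'e::euclidean_space) chart set"
  assumes mfd: "smooth_manifold X A"
begin

lemma chart_open: "c \<in> A \<Longrightarrow> openin X (fst c)"
  and chart_image_open: "c \<in> A \<Longrightarrow> open (chart_image c)"
  and chart_homeo: "c \<in> A \<Longrightarrow>
    homeomorphic_map (subtopology X (fst c)) (top_of_set (chart_image c)) (snd c)"
  and Hausdorff: "Hausdorff_space X"
  using mfd by (auto simp: smooth_manifold_def)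

lemma chart_subset: "c \<in> A \<Longrightarrow> fst c \<subseteq> topspace X"
  using chart_open openin_subset by blast

lemma ex_chart: "p \<in> topspace X \<Longrightarrow> \<exists>c\<in>A. p \<in> fst c"
  using mfd by (auto simp: smooth_manifold_def)

lemma transition_smooth: "c \<in> A \<Longrightarrow> c' \<in> A \<Longrightarrow>
    smooth_on {x \<in> chart_image c. chart_inv c x \<in> fst c'} (\<lambda>x. snd c' (chart_inv c x))"
  using mfd by (auto simp: smooth_manifold_def coord_dom_def coord_rep_def[abs_def])

lemma chart_inj: "c \<in> A \<Longrightarrow> inj_on (snd c) (fst c)"
  using homeomorphic_imp_injective_map[OF chart_homeo] chart_subset
  by (auto simp: topspace_subtopology Int_absorb1)

lemma chart_inv_chart: "c \<in> A \<Longrightarrow> p \<in> fst c \<Longrightarrow> chart_inv c (snd c p) = p"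
  by (simp add: chart_inv_def chart_inj)

lemma chart_inv_topspace: "c \<in> A \<Longrightarrow> x \<in> chart_image c \<Longrightarrow> chart_inv c x \<in> topspace X"
  using chart_inv_in[of x c] chart_subset[of c] by auto

lemma open_chart_inv_preimage:
  assumes "c \<in> A" "openin X Q" shows "open {x \<in> chart_image c. chart_inv c x \<in> Q}"
proof -
  have "{x \<in> chart_image c. chart_inv c x \<in> Q} = snd c ` (fst c \<inter> Q)"
  proof (intro subset_antisym subsetI)
    fix x assume "x \<in> {x \<in> chart_image c. chart_inv c x \<in> Q}"
    then show "x \<in> snd c ` (fst c \<inter> Q)"
      by (intro image_eqI[of _ _ "chart_inv c x"]) (auto simp: chart_chart_inv chart_inv_in)
  next
    fix x assume "x \<in> snd c ` (fst c \<inter> Q)"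
    then show "x \<in> {x \<in> chart_image c. chart_inv c x \<in> Q}"
      using chart_inv_chart[OF assms(1)] by (auto simp: chart_in_image)
  qed
  moreover have "openin (top_of_set (chart_image c)) (snd c ` (fst c \<inter> Q))"
    by (subst homeomorphic_map_openness[OF chart_homeo[OF assms(1)]])
      (use assms chart_subset[OF assms(1)] in \<open>auto simp: openin_subtopology_Int2 topspace_subtopology\<close>)
  ultimately show ?thesis using openin_open_eq[OF chart_image_open[OF assms(1)]] by simp
qed

lemma openin_chart_preimage:
  assumes "c \<in> A" "open T" shows "openin X {p \<in> fst c. snd c p \<in> T}"
proof -
  have "continuous_map (subtopology X (fst c)) (top_of_set (chart_image c)) (snd c)"
    using chart_homeo[OF assms(1)] by (rule homeomorphic_imp_continuous_map)
  then have "continuous_map (subtopology X (fst c)) euclidean (snd c)"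
    using continuous_map_in_subtopology by blast
  then have "openin (subtopology X (fst c)) {p \<in> topspace (subtopology X (fst c)). snd c p \<in> T}"
    using assms(2) openin_continuous_map_preimage[of "subtopology X (fst c)" euclidean "snd c" T] by simp
  moreover have "topspace (subtopology X (fst c)) = fst c"
    using chart_subset[OF assms(1)] by (auto simp: topspace_subtopology)
  ultimately have "openin (subtopology X (fst c)) {p \<in> fst c. snd c p \<in> T}" by (simp only:)
  then show ?thesis unfolding openin_open_subtopology[OF chart_open[OF assms(1)]] by blast
qed

lemma smooth_toD:
  assumes "smooth_to X A Q \<phi>" "c \<in> A"
  shows "open {x \<in> chart_image c. chart_inv c x \<in> Q}"
    and "smooth_on {x \<in> chart_image c. chart_inv c x \<in> Q} (\<lambda>x. \<phi> (chart_inv c x))"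
  using assms open_chart_inv_preimage by (auto simp: smooth_to_def)

lemma smooth_fromD:
  assumes "smooth_from X A B S" "c \<in> A"
  shows "open {y \<in> B. S y \<in> fst c}" and "smooth_on {y \<in> B. S y \<in> fst c} (\<lambda>y. snd c (S y))"
  using assms chart_open by (auto simp: smooth_from_def)

lemma smooth_to_chart: "c \<in> A \<Longrightarrow> smooth_to X A (fst c) (snd c)"
  by (simp add: smooth_to_def transition_smooth chart_open)

lemma smooth_from_chart_inv: "c \<in> A \<Longrightarrow> smooth_from X A (chart_image c) (chart_inv c)"
  by (simp add: smooth_from_def transition_smooth chart_image_open open_chart_inv_preimage
      chart_inv_topspace image_subset_iff)

text \<open>Both notions are tested in every chart, so near each parameter any chart around its
  image can be inserted between the two maps.\<close>

lemma smooth_to_from: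
  assumes "smooth_to X A Q \<phi>" "smooth_from X A B S"
  shows "open {y \<in> B. S y \<in> Q}" "smooth_on {y \<in> B. S y \<in> Q} (\<lambda>y. \<phi> (S y))"
proof -
  show "open {y \<in> B. S y \<in> Q}" using assms by (auto simp: smooth_from_def smooth_to_def)
  show "smooth_on {y \<in> B. S y \<in> Q} (\<lambda>y. \<phi> (S y))"
  proof (rule smooth_on_local)
    fix y assume y: "y \<in> {y \<in> B. S y \<in> Q}"
    then have "S y \<in> topspace X" using assms by (auto simp: smooth_from_def)
    then obtain c where c: "c \<in> A" "S y \<in> fst c" using ex_chart by blast
    let ?T = "{y \<in> B. S y \<in> fst c \<inter> Q}"
    have "openin X (fst c \<inter> Q)" using assms(1) c chart_open[of c] by (auto simp: smooth_to_def)
    then have T: "open ?T" using assms(2) unfolding smooth_from_def by blast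
    have "smooth_on ?T (\<lambda>y. \<phi> (chart_inv c (snd c (S y))))"
    proof (rule smooth_on_compose[OF T smooth_toD(1)[OF assms(1) c(1)] _ smooth_toD(2)[OF assms(1) c(1)]])
      show "smooth_on ?T (\<lambda>y. snd c (S y))"
        by (rule smooth_on_subset[OF smooth_fromD(2)[OF assms(2) c(1)]]) auto
      show "(\<lambda>y. snd c (S y)) ` ?T \<subseteq> {x \<in> chart_image c. chart_inv c x \<in> Q}"
        using chart_inv_chart[OF c(1)] by (auto simp: chart_in_image)
    qed
    then have "smooth_on ?T (\<lambda>y. \<phi> (S y))"
      by (rule smooth_on_eqI[OF T]) (simp add: chart_inv_chart[OF c(1)])
    then show "\<exists>T. open T \<and> y \<in> T \<and> smooth_on T (\<lambda>y. \<phi> (S y))" using T y c by blast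
  qed
qed

lemma smooth_from_compose:
  fixes h :: "'a::euclidean_space \<Rightarrow> 'b::euclidean_space"
  assumes S: "smooth_from X A B S" and B': "open B'" and h: "smooth_on B' h" "h ` B' \<subseteq> B"
  shows "smooth_from X A B' (\<lambda>y. S (h y))"
  unfolding smooth_from_def
proof (intro conjI allI impI ballI)
  show "(\<lambda>y. S (h y)) ` B' \<subseteq> topspace X" using S h by (auto simp: smooth_from_def)
  have op: "open {y \<in> B'. S (h y) \<in> Q}" if "openin X Q" for Q
  proof -
    have "open {y \<in> B. S y \<in> Q}" using S that by (auto simp: smooth_from_def)
    then have "open (B' \<inter> h -` {y \<in> B. S y \<in> Q})"
      using continuous_open_preimage smooth_on_continuous_on h(1) B' by blast
    moreover have "B' \<inter> h -` {y \<in> B. S y \<in> Q} = {y \<in> B'. S (h y) \<in> Q}" using h(2) by auto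
    ultimately show ?thesis by simp
  qed
  then show "open {y \<in> B'. S (h y) \<in> Q}" if "openin X Q" for Q using that .
  fix c assume c: "c \<in> A"
  show "smooth_on {y \<in> B'. S (h y) \<in> fst c} (\<lambda>y. snd c (S (h y)))"
    by (rule smooth_on_compose[OF op[OF chart_open[OF c]] smooth_fromD(1)[OF S c] _ smooth_fromD(2)[OF S c]
          smooth_on_subset[OF h(1)]]) (use h in auto)
qed (fact B')

lemma smooth_from_subset: "smooth_from X A B S \<Longrightarrow> open B' \<Longrightarrow> B' \<subseteq> B \<Longrightarrow> smooth_from X A B' S"
  by (drule smooth_from_compose[OF _ _ smooth_on_id]) auto

lemma smooth_to_subset: "smooth_to X A Q \<phi> \<Longrightarrow> openin X Q' \<Longrightarrow> Q' \<subseteq> Q \<Longrightarrow> smooth_to X A Q' \<phi>"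
  unfolding smooth_to_def by (blast intro: smooth_on_subset)

lemma smooth_to_compose:
  fixes \<phi> :: "'p \<Rightarrow> 'b::euclidean_space"
  assumes "smooth_to X A Q \<phi>" "open W" "smooth_on W f" "\<phi> ` Q \<subseteq> W"
  shows "smooth_to X A Q (\<lambda>p. f (\<phi> p))"
  unfolding smooth_to_def
proof (intro conjI ballI)
  show "openin X Q" using assms by (simp add: smooth_to_def)
  fix c assume c: "c \<in> A"
  show "smooth_on {x \<in> chart_image c. chart_inv c x \<in> Q} (\<lambda>x. f (\<phi> (chart_inv c x)))"
    by (rule smooth_on_compose[OF smooth_toD(1)[OF assms(1) c] assms(2) _ assms(3) smooth_toD(2)[OF assms(1) c]])
      (use assms in auto)
qed

lemma smooth_from_continuous_map:
  assumes "smooth_from X A B S" shows "continuous_map (top_of_set B) X S"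
  using assms unfolding continuous_map_def smooth_from_def
  by (auto simp: openin_open_eq)

end

section \<open>The torus and its exponential map\<close>

lemma torus_carrier: "carrier torus = sphere 0 1 \<times> sphere 0 1"
  by (simp add: torus_def circle_group_def DirProd_def)

lemma torus_mult: "(a, b) \<otimes>\<^bsub>torus\<^esub> (c, d) = (a * c, b * d)"
  by (simp add: torus_def circle_group_def DirProd_def)

lemma torus_one: "\<one>\<^bsub>torus\<^esub> = (1, 1)"
  by (simp add: torus_def circle_group_def DirProd_def)

lemma torus_exp_carrier [simp]: "torus_exp a \<in> carrier torus"
  by (simp add: torus_carrier torus_exp_def)

lemma torus_exp_add: "torus_exp (a + b) = torus_exp a \<otimes>\<^bsub>torus\<^esub> torus_exp b"
  by (simp add: torus_exp_def torus_mult cis_mult)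

lemma torus_exp_0: "torus_exp 0 = \<one>\<^bsub>torus\<^esub>"
  by (simp add: torus_exp_def torus_one)

text \<open>The bound keeps representatives in a compact ball, from which later arguments extract
  convergent sequences of Lie algebra elements.\<close>

lemma torus_exp_surj:
  assumes "t \<in> carrier torus" obtains a where "t = torus_exp a" "norm a \<le> 2 * pi"
proof -
  have *: "\<exists>a. z = cis a \<and> \<bar>a\<bar> \<le> pi" if "z \<in> sphere 0 1" for z :: complex
    using that cis_Arg[of z] Arg_bounded[of z]
    by (intro exI[of _ "Arg z"]) (cases "z = 0"; auto simp: sgn_div_norm)
  have "fst t \<in> sphere 0 1" "snd t \<in> sphere 0 1" using assms by (auto simp: torus_carrier)
  then obtain a b where ab: "fst t = cis a" "\<bar>a\<bar> \<le> pi" "snd t = cis b" "\<bar>b\<bar> \<le> pi" using * by metis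
  have "norm (a, b) \<le> 2 * pi" using norm_Pair_le[of a b] ab by simp
  with ab show ?thesis by (intro that[of "(a, b)"]) (simp_all add: torus_exp_def prod_eq_iff)
qed

lemma cis_inj_near: assumes "cis a = cis b" "\<bar>a - b\<bar> < 2 * pi" shows "a = b"
proof -
  obtain n :: int where n: "a = b + 2 * pi * n"
    using assms(1) sin_cos_eq_iff[of a b] by (auto simp: complex_eq_iff)
  then have "\<bar>real_of_int n\<bar> < 1" using assms(2) by (auto simp: abs_mult)
  then have "n = 0" by linarith
  then show ?thesis using n by simp
qed

lemma torus_exp_inj_near:
  assumes "torus_exp a = torus_exp b" "dist a b < 2 * pi" shows "a = b"
proof -
  have "dist (fst a) (fst b) \<le> dist a b" "dist (snd a) (snd b) \<le> dist a b"
    by (rule dist_fst_le dist_snd_le)+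
  then show ?thesis
    using assms cis_inj_near[of "fst a" "fst b"] cis_inj_near[of "snd a" "snd b"]
    by (auto simp: torus_exp_def dist_real_def prod_eq_iff)
qed

lemma torus_exp_inj_on_ball: "inj_on torus_exp (ball a pi)"
proof (rule inj_onI)
  fix x y assume xy: "x \<in> ball a pi" "y \<in> ball a pi" "torus_exp x = torus_exp y"
  then have "dist x y < 2 * pi" using dist_triangle_less_add[of x a pi y pi] by (simp add: dist_commute)
  then show "x = y" using torus_exp_inj_near xy(3) by blast
qed

lemma continuous_on_torus_exp: "continuous_on S torus_exp"
  unfolding torus_exp_def by (intro continuous_intros)

section \<open>Torus actions and their generating fields\<close>

locale torus_action_mfd = smooth_mfd X A
  for X :: "'p topology" and A :: "('p, 'e::euclidean_space) chart set" +
  fixes act :: "complex \<times> complex \<Rightarrow> 'p \<Rightarrow> 'p"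
  assumes action: "smooth_effective_torus_action X A act"
begin

sublocale faithful_action torus "topspace X" act
  using action by (simp add: smooth_effective_torus_action_def)

lemma act_topspace: "t \<in> carrier torus \<Longrightarrow> p \<in> topspace X \<Longrightarrow> act t p \<in> topspace X"
  using element_image by blast

lemma act_mult: "s \<in> carrier torus \<Longrightarrow> t \<in> carrier torus \<Longrightarrow> p \<in> topspace X \<Longrightarrow>
    act (s \<otimes>\<^bsub>torus\<^esub> t) p = act s (act t p)"
  by (rule composition_rule)

lemma act_one: "p \<in> topspace X \<Longrightarrow> act \<one>\<^bsub>torus\<^esub> p = p"
  using id_eq_one by (metis restrict_apply')

lemma act_exp_0: "p \<in> topspace X \<Longrightarrow> act (torus_exp 0) p = p"
  by (simp add: torus_exp_0 act_one)

lemma act_exp_add: "p \<in> topspace X \<Longrightarrow> act (torus_exp (a + b)) p = act (torus_exp a) (act (torus_exp b) p)"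
  by (simp add: torus_exp_add act_mult)

lemma act_exp_minus: "p \<in> topspace X \<Longrightarrow> act (torus_exp (- a)) (act (torus_exp a) p) = p"
  using act_exp_add[of p "- a" a] act_exp_0 by simp

lemma act_commute:
  assumes "s \<in> carrier torus" "t \<in> carrier torus" "p \<in> topspace X"
  shows "act s (act t p) = act t (act s p)"
proof -
  have "s \<otimes>\<^bsub>torus\<^esub> t = t \<otimes>\<^bsub>torus\<^esub> s" by (cases s; cases t) (simp add: torus_mult mult.commute)
  then show ?thesis using assms act_mult by metis
qed

text \<open>Faithfulness is injectivity of \<open>act\<close> into bijections that are extensional
  on the space, so agreement with the identity on \<open>topspace X\<close> already means equality
  with the function of the neutral element.\<close>

lemma effective:
  assumes t: "t \<in> carrier torus" and fixed: "\<And>p. p \<in> topspace X \<Longrightarrow> act t p = p"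
  shows "t = \<one>\<^bsub>torus\<^esub>"
proof -
  have one: "\<one>\<^bsub>torus\<^esub> \<in> carrier torus" by (simp add: torus_one torus_carrier)
  have "act t \<in> extensional (topspace X)" "act \<one>\<^bsub>torus\<^esub> \<in> extensional (topspace X)"
    using bij_prop0 t one by (auto simp: Bij_def)
  then have "act t = act \<one>\<^bsub>torus\<^esub>"
    by (rule extensionalityI) (simp add: fixed act_one)
  then show ?thesis using faithful t one by (simp add: inj_on_eq_iff)
qed

lemma action_continuous:
  "continuous_map (prod_topology (top_of_set (carrier torus)) X) X (\<lambda>(t, p). act t p)"
  using action by (simp add: smooth_effective_torus_action_def smooth_map_def)

lemma act_continuous: assumes "t \<in> carrier torus" shows "continuous_map X X (act t)"
proof -
  have "continuous_map X (prod_topology (top_of_set (carrier torus)) X) (\<lambda>p. (t, p))"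
    using assms by (auto intro: continuous_map_pairedI)
  from continuous_map_compose[OF this action_continuous] show ?thesis by (simp add: o_def)
qed

lemma open_action_preimage:
  assumes S: "smooth_from X A B S" and Q: "openin X Q"
  shows "open {z \<in> UNIV \<times> B. act (torus_exp (fst z)) (S (snd z)) \<in> Q}"
proof -
  have B: "open B" using S by (simp add: smooth_from_def)
  have "continuous_map (top_of_set (UNIV \<times> B)) X
      ((\<lambda>(t, p). act t p) \<circ> (\<lambda>z. (torus_exp (fst z), S (snd z))))"
  proof (rule continuous_map_compose[OF _ action_continuous], rule continuous_map_pairedI)
    show "continuous_map (top_of_set (UNIV \<times> B)) (top_of_set (carrier torus)) (\<lambda>z. torus_exp (fst z))"
      by (auto intro!: continuous_on_compose2[OF continuous_on_torus_exp[of UNIV]] continuous_intros)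
    have "continuous_map (top_of_set (UNIV \<times> B)) (top_of_set B) snd"
      by (auto intro: continuous_intros)
    from continuous_map_compose[OF this smooth_from_continuous_map[OF S]]
    show "continuous_map (top_of_set (UNIV \<times> B)) X (\<lambda>z. S (snd z))" by (simp add: o_def)
  qed
  from openin_continuous_map_preimage[OF this Q]
  have "openin (top_of_set (UNIV \<times> B)) {z \<in> UNIV \<times> B. act (torus_exp (fst z)) (S (snd z)) \<in> Q}"
    by (rule back_subst[of "openin _"]) auto
  then show ?thesis using openin_open_eq[OF open_Times[OF open_UNIV B]] by blast
qed

lemma open_action_chart:
  assumes c: "c \<in> A" and c': "c' \<in> A"
  shows "open {z. fst z \<in> ball a pi \<and> snd z \<in> chart_image c \<and>
       act (torus_exp (fst z)) (chart_inv c (snd z)) \<in> fst c'}"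
proof -
  have "open ((ball a pi \<times> UNIV) \<inter>
      {z \<in> UNIV \<times> chart_image c. act (torus_exp (fst z)) (chart_inv c (snd z)) \<in> fst c'})"
    by (intro open_Int open_Times open_action_preimage[OF smooth_from_chart_inv[OF c] chart_open[OF c']]) auto
  then show ?thesis by (rule back_subst[of "open"]) (auto simp: mem_Times_iff)
qed

text \<open>The inverse of the torus chart over \<open>ball a pi\<close> is
  \<open>torus_exp\<close>, so this is the representation of the action in a product chart, with
  time measured in the Lie algebra.\<close>

lemma smooth_action_chart:
  assumes c: "c \<in> A" and c': "c' \<in> A"
  shows "smooth_on {z. fst z \<in> ball a pi \<and> snd z \<in> chart_image c \<and>
       act (torus_exp (fst z)) (chart_inv c (snd z)) \<in> fst c'}
     (\<lambda>z. snd c' (act (torus_exp (fst z)) (chart_inv c (snd z))))" (is "smooth_on ?D ?f")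
proof -
  let ?i = "inv_into (ball a pi) torus_exp"
  define d where "d = (torus_exp ` ball a pi \<times> fst c, map_prod ?i (snd c))"
  have "(torus_exp ` ball a pi, ?i) \<in> torus_atlas" unfolding torus_atlas_def by blast
  then have d: "d \<in> prod_atlas torus_atlas A"
    unfolding prod_atlas_def d_def using c
    by (intro CollectI exI[of _ "(torus_exp ` ball a pi, ?i)"] exI[of _ c]) simp
  have "inj_on (snd d) (fst d)"
    unfolding d_def fst_conv snd_conv
    by (rule map_prod_inj_on[OF inj_on_inv_into[OF order_refl] chart_inj[OF c]])
  then have inv: "chart_inv d z = (torus_exp (fst z), chart_inv c (snd z))"
    if "fst z \<in> ball a pi" "snd z \<in> chart_image c" for z
    using that inv_into_f_f[of "snd d" "fst d" "(torus_exp (fst z), chart_inv c (snd z))"]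
      inv_into_f_f[OF torus_exp_inj_on_ball that(1)]
    by (simp add: chart_inv_def d_def chart_chart_inv[unfolded chart_inv_def] chart_inv_in[unfolded chart_inv_def])
  have img: "chart_image d = ball a pi \<times> chart_image c"
    unfolding chart_image_def d_def fst_conv snd_conv
    by (rule map_prod_surj_on[OF _ refl])
      (simp add: image_image inv_into_f_f[OF torus_exp_inj_on_ball])
  let ?F = "\<lambda>(t, p). act t p"
  have D: "coord_dom d c' ?F = ?D"
    by (auto simp: coord_dom_def img inv mem_Times_iff)
  have "smooth_on (coord_dom d c' ?F) (coord_rep d c' ?F)"
    using action d c' by (auto simp: smooth_effective_torus_action_def smooth_map_def)
  moreover have "open ?D" by (rule open_action_chart[OF c c'])
  ultimately show ?thesis
    unfolding D by (elim smooth_on_eqI[rotated]) (simp_all add: coord_rep_def inv)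
qed

text \<open>Time runs through the whole Lie algebra here, although a torus chart only covers a ball
  of radius \<open>pi\<close>; smoothness is local, and such a ball is taken around each
  time.\<close>

lemma smooth_from_action:
  fixes S :: "'b::euclidean_space \<Rightarrow> 'p"
  assumes S: "smooth_from X A B S"
  shows "smooth_from X A (UNIV \<times> B) (\<lambda>z. act (torus_exp (fst z)) (S (snd z)))"
  unfolding smooth_from_def
proof (intro conjI allI impI ballI)
  have B: "open B" "S ` B \<subseteq> topspace X" using S by (auto simp: smooth_from_def)
  show "open (UNIV \<times> B :: ((real \<times> real) \<times> 'b) set)" using B by (simp add: open_Times)
  show "(\<lambda>z. act (torus_exp (fst z)) (S (snd z))) ` (UNIV \<times> B) \<subseteq> topspace X"
    using B by (auto intro!: act_topspace)
  note op = open_action_preimage[OF S]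
  show "open {z \<in> UNIV \<times> B. act (torus_exp (fst z)) (S (snd z)) \<in> Q}" if "openin X Q" for Q
    using op[OF that] .
  fix c' assume c': "c' \<in> A"
  show "smooth_on {z \<in> UNIV \<times> B. act (torus_exp (fst z)) (S (snd z)) \<in> fst c'}
      (\<lambda>z. snd c' (act (torus_exp (fst z)) (S (snd z))))"
  proof (rule smooth_on_local)
    fix z0 :: "(real \<times> real) \<times> 'b"
    assume z0: "z0 \<in> {z \<in> UNIV \<times> B. act (torus_exp (fst z)) (S (snd z)) \<in> fst c'}"
    then have "S (snd z0) \<in> topspace X" using B by auto
    then obtain c where c: "c \<in> A" "S (snd z0) \<in> fst c" using ex_chart by blast
    let ?B = "{y \<in> B. S y \<in> fst c}"
    have oB: "open ?B" using smooth_fromD(1)[OF S c(1)] .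
    let ?T = "{z \<in> UNIV \<times> B. act (torus_exp (fst z)) (S (snd z)) \<in> fst c'} \<inter> (ball (fst z0) pi \<times> ?B)"
    have T: "open ?T" using op[OF chart_open[OF c']] oB by (intro open_Int open_Times) auto
    let ?D = "{z. fst z \<in> ball (fst z0) pi \<and> snd z \<in> chart_image c \<and>
       act (torus_exp (fst z)) (chart_inv c (snd z)) \<in> fst c'}"
    note oD = open_action_chart[OF c(1) c', of "fst z0"]
    have "smooth_on ?T (\<lambda>z. snd c' (act (torus_exp (fst (fst z, snd c (S (snd z)))))
        (chart_inv c (snd (fst z, snd c (S (snd z)))))))"
    proof (rule smooth_on_compose[OF T oD _ smooth_action_chart[OF c(1) c']])
      show "(\<lambda>z. (fst z, snd c (S (snd z)))) ` ?T \<subseteq> ?D"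
        using chart_inv_chart[OF c(1)] by (auto simp: chart_in_image)
      show "smooth_on ?T (\<lambda>z. (fst z, snd c (S (snd z))))"
      proof (intro smooth_on_Pair smooth_on_fst smooth_on_id T)
        show "smooth_on ?T (\<lambda>z. snd c (S (snd z)))"
          by (rule smooth_on_compose[OF T oB _ smooth_fromD(2)[OF S c(1)] smooth_on_snd[OF T smooth_on_id[OF T]]])
            auto
      qed
    qed
    then have "smooth_on ?T (\<lambda>z. snd c' (act (torus_exp (fst z)) (S (snd z))))"
      by (rule smooth_on_eqI[OF T]) (auto simp: chart_inv_chart[OF c(1)])
    then show "\<exists>T. open T \<and> z0 \<in> T \<and> smooth_on T (\<lambda>z. snd c' (act (torus_exp (fst z)) (S (snd z))))"
      using T z0 c by (intro exI[of _ ?T]) auto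
  qed
qed

lemma smooth_from_act:
  assumes "smooth_from X A B S" "t \<in> carrier torus" shows "smooth_from X A B (\<lambda>y. act t (S y))"
proof -
  obtain a where t: "t = torus_exp a" using torus_exp_surj assms(2) by blast
  have B: "open B" using assms by (simp add: smooth_from_def)
  show ?thesis
    using smooth_from_compose[OF smooth_from_action[OF assms(1)] B
        smooth_on_Pair[OF B smooth_on_const[OF B, of a] smooth_on_id[OF B]]]
    by (simp add: t image_subset_iff)
qed

lemma smooth_to_act:
  assumes "smooth_to X A Q \<phi>" "t \<in> carrier torus"
  shows "smooth_to X A {p \<in> topspace X. act t p \<in> Q} (\<lambda>p. \<phi> (act t p))"
  unfolding smooth_to_def
proof (intro conjI ballI)
  show "openin X {p \<in> topspace X. act t p \<in> Q}"
    using openin_continuous_map_preimage[OF act_continuous[OF assms(2)]] assms(1)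
    by (simp add: smooth_to_def)
  fix c assume c: "c \<in> A"
  have "smooth_on {y \<in> chart_image c. act t (chart_inv c y) \<in> Q} (\<lambda>y. \<phi> (act t (chart_inv c y)))"
    by (rule smooth_to_from(2)[OF assms(1) smooth_from_act[OF smooth_from_chart_inv[OF c] assms(2)]])
  then show "smooth_on {x \<in> chart_image c. chart_inv c x \<in> {p \<in> topspace X. act t p \<in> Q}}
      (\<lambda>x. \<phi> (act t (chart_inv c x)))"
    by (rule smooth_on_subset) auto
qed

text \<open>The action read in a single chart, jointly in time and position. Orbits may leave the
  chart, so only values on \<open>flow_dom\<close> are meaningful.\<close>

definition flow :: "('p, 'e) chart \<Rightarrow> (real \<times> real) \<times> 'e \<Rightarrow> 'e" where
  "flow c z = snd c (act (torus_exp (fst z)) (chart_inv c (snd z)))"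

definition flow_dom :: "('p, 'e) chart \<Rightarrow> ((real \<times> real) \<times> 'e) set" where
  "flow_dom c = {z \<in> UNIV \<times> chart_image c. act (torus_exp (fst z)) (chart_inv c (snd z)) \<in> fst c}"

lemma open_flow_dom: "c \<in> A \<Longrightarrow> open (flow_dom c)"
  and smooth_flow: "c \<in> A \<Longrightarrow> smooth_on (flow_dom c) (flow c)"
  using smooth_fromD[OF smooth_from_action[OF smooth_from_chart_inv]]
  by (auto simp: flow_dom_def flow_def[abs_def])

lemma flow_0: assumes "c \<in> A" "x \<in> chart_image c" shows "(0, x) \<in> flow_dom c" "flow c (0, x) = x"
  using assms chart_inv_topspace[OF assms]
  by (auto simp: flow_dom_def flow_def act_exp_0 chart_inv_in chart_chart_inv)

lemma flow_derivative:
  "c \<in> A \<Longrightarrow> z \<in> flow_dom c \<Longrightarrow> (flow c has_derivative frechet_derivative (flow c) (at z)) (at z)"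
  using smooth_on_has_derivative[OF smooth_flow] .

lemma has_derivative_flow_fst:
  assumes c: "c \<in> A" and z: "(\<theta>, x) \<in> flow_dom c"
  shows "((\<lambda>\<theta>. flow c (\<theta>, x)) has_derivative (\<lambda>a. frechet_derivative (flow c) (at (\<theta>, x)) (a, 0))) (at \<theta>)"
  by (rule has_derivative_compose[of "\<lambda>\<theta>. (\<theta>, x)" "\<lambda>a. (a, 0)", OF _ flow_derivative[OF c z]])
    (auto intro!: derivative_eq_intros)

lemma has_derivative_flow_snd:
  assumes c: "c \<in> A" and z: "(\<theta>, x) \<in> flow_dom c"
  shows "((\<lambda>x. flow c (\<theta>, x)) has_derivative (\<lambda>v. frechet_derivative (flow c) (at (\<theta>, x)) (0, v))) (at x)"
  by (rule has_derivative_compose[of "\<lambda>x. (\<theta>, x)" "\<lambda>v. (0, v)", OF _ flow_derivative[OF c z]])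
    (auto intro!: derivative_eq_intros)

lemma generating_field_eq:
  assumes c: "c \<in> A" and x: "x \<in> chart_image c"
  shows "generating_field act \<xi> c x = frechet_derivative (flow c) (at (0, x)) (\<xi>, 0)"
proof -
  let ?D = "frechet_derivative (flow c) (at (0, x))"
  have lin: "linear ?D" using flow_derivative[OF c flow_0(1)[OF c x]] has_derivative_linear by blast
  have "((\<lambda>t. flow c (t *\<^sub>R \<xi>, x)) has_derivative (\<lambda>t. ?D (t *\<^sub>R \<xi>, 0))) (at 0)"
    by (rule has_derivative_compose[of "\<lambda>t. t *\<^sub>R \<xi>" "\<lambda>t. t *\<^sub>R \<xi>"])
      (use has_derivative_flow_fst[OF c flow_0(1)[OF c x]] in \<open>auto intro!: derivative_eq_intros\<close>)
  moreover have "?D (t *\<^sub>R \<xi>, 0) = t *\<^sub>R ?D (\<xi>, 0)" for t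
    using linear_scale[OF lin, of t "(\<xi>, 0)"] by simp
  ultimately have "((\<lambda>t. flow c (t *\<^sub>R \<xi>, x)) has_vector_derivative ?D (\<xi>, 0)) (at 0)"
    by (simp add: has_vector_derivative_def)
  then show ?thesis by (simp add: generating_field_def flow_def vector_derivative_at)
qed

lemma linear_generating_field:
  assumes c: "c \<in> A" and x: "x \<in> chart_image c" shows "linear (\<lambda>\<xi>. generating_field act \<xi> c x)"
proof -
  have "linear (frechet_derivative (flow c) (at (0, x)))"
    using flow_derivative[OF c flow_0(1)[OF c x]] has_derivative_linear by blast
  then have "linear (frechet_derivative (flow c) (at (0, x)) \<circ> (\<lambda>\<xi>. (\<xi>, 0)))"
    by (intro linear_compose) (auto intro: linearI)
  then show ?thesis using generating_field_eq[OF c x] by (simp add: o_def)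
qed

lemma smooth_generating_field:
  assumes c: "c \<in> A" shows "smooth_on (chart_image c) (generating_field act \<xi> c)"
proof -
  have I: "open (chart_image c)" using chart_image_open c .
  have "smooth_on (chart_image c) (\<lambda>x. frechet_derivative (flow c) (at (0, x)) (\<xi>, 0))"
    by (rule smooth_on_compose[OF I open_flow_dom[OF c] _ smooth_on_frechet_derivative[OF smooth_flow[OF c]]
          smooth_on_Pair[OF I smooth_on_const[OF I] smooth_on_id[OF I]]])
      (use flow_0[OF c] in auto)
  then show ?thesis by (rule smooth_on_eqI[OF I]) (rule generating_field_eq[OF c])
qed

lemma has_derivative_along_action:
  fixes \<phi> :: "'p \<Rightarrow> 'b::real_normed_vector"
  assumes \<phi>: "smooth_to X A Q \<phi>" and p: "p \<in> Q" and c: "c \<in> A" "p \<in> fst c"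
  shows "((\<lambda>\<theta>. \<phi> (act (torus_exp \<theta>) p)) has_derivative
    (\<lambda>\<xi>. frechet_derivative (\<lambda>y. \<phi> (chart_inv c y)) (at (snd c p)) (generating_field act \<xi> c (snd c p)))) (at 0)"
proof -
  let ?x = "snd c p" and ?f = "\<lambda>y. \<phi> (chart_inv c y)"
  have x: "?x \<in> chart_image c" using c by (simp add: chart_in_image)
  have px: "chart_inv c ?x = p" using chart_inv_chart c .
  have "(?f has_derivative frechet_derivative ?f (at ?x)) (at (flow c (0, ?x)))"
    using smooth_on_has_derivative[OF smooth_toD(2)[OF \<phi> c(1)], of ?x] p x px flow_0(2)[OF c(1) x] by simp
  from has_derivative_compose[OF has_derivative_flow_fst[OF c(1) flow_0(1)[OF c(1) x]] this]
  have *: "((\<lambda>\<theta>. ?f (flow c (\<theta>, ?x))) has_derivative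
      (\<lambda>\<xi>. frechet_derivative ?f (at ?x) (generating_field act \<xi> c ?x))) (at 0)"
    by (simp add: generating_field_eq[OF c(1) x])
  let ?T = "(\<lambda>\<theta>. (\<theta>, ?x)) -` flow_dom c"
  have "open ?T" by (intro open_vimage open_flow_dom c continuous_intros)
  with * show ?thesis
    by (rule has_derivative_transform_within_open)
      (use flow_0(1)[OF c(1) x] px in \<open>auto simp: flow_dom_def flow_def chart_inv_chart[OF c(1)]\<close>)
qed

text \<open>Identifies a generating field by differentiating the orbit map in another way: through
  another chart, after a translation by \<open>act t\<close>, or at a later time.\<close>

lemma generating_field_unique:
  assumes c: "c \<in> A" "p \<in> fst c"
    and D: "((\<lambda>\<theta>. snd c (act (torus_exp \<theta>) p)) has_derivative D) (at 0)"
  shows "generating_field act \<xi> c (snd c p) = D \<xi>"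
proof -
  have x: "snd c p \<in> chart_image c" using c by (simp add: chart_in_image)
  have "((\<lambda>\<theta>. snd c (act (torus_exp \<theta>) p)) has_derivative (\<lambda>\<xi>. generating_field act \<xi> c (snd c p))) (at 0)"
    using has_derivative_flow_fst[OF c(1) flow_0(1)[OF c(1) x]]
    by (simp add: flow_def chart_inv_chart[OF c] generating_field_eq[OF c(1) x])
  then have "(\<lambda>\<xi>. generating_field act \<xi> c (snd c p)) = D" using D by (rule has_derivative_unique)
  then show ?thesis by (rule fun_cong)
qed

text \<open>The torus is abelian, so \<open>act t\<close> carries the orbit map of \<open>p\<close>
  to that of \<open>act t p\<close> at the same times.\<close>

lemma generating_field_act:
  assumes c: "c \<in> A" "p \<in> fst c" and c': "c' \<in> A" "act t p \<in> fst c'" and t: "t \<in> carrier torus"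
  shows "generating_field act \<xi> c' (snd c' (act t p)) =
    frechet_derivative (coord_rep c c' (act t)) (at (snd c p)) (generating_field act \<xi> c (snd c p))"
proof (rule generating_field_unique[OF c'])
  have p: "p \<in> topspace X" using c chart_subset by blast
  have "p \<in> {p \<in> topspace X. act t p \<in> fst c'}" using p c' by simp
  from has_derivative_along_action[OF smooth_to_act[OF smooth_to_chart[OF c'(1)] t] this c]
  show "((\<lambda>\<theta>. snd c' (act (torus_exp \<theta>) (act t p))) has_derivative
     (\<lambda>\<xi>. frechet_derivative (coord_rep c c' (act t)) (at (snd c p)) (generating_field act \<xi> c (snd c p)))) (at 0)"
    by (simp add: coord_rep_def[abs_def] act_commute[OF t torus_exp_carrier p])
qed

lemma generating_field_chart:
  assumes c: "c \<in> A" "p \<in> fst c" and c': "c' \<in> A" "p \<in> fst c'"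
  shows "generating_field act \<xi> c' (snd c' p) =
    frechet_derivative (coord_rep c c' id) (at (snd c p)) (generating_field act \<xi> c (snd c p))"
  by (rule generating_field_unique[OF c'])
    (use has_derivative_along_action[OF smooth_to_chart[OF c'(1)] c'(2) c] in \<open>simp add: coord_rep_def[abs_def]\<close>)

end

section \<open>Lie derivatives\<close>

lemma multilin_linear2:
  assumes "multilin 2 \<alpha>" shows "linear (\<lambda>u. \<alpha> [u, v])" "linear (\<lambda>v. \<alpha> [u, v])"
  using assms[unfolded multilin_def, rule_format, of "[0, v]" 0]
    assms[unfolded multilin_def, rule_format, of "[u, 0]" 1] by simp_all

lemma multilin_linear3:
  assumes "multilin 3 \<alpha>"
  shows "linear (\<lambda>u. \<alpha> [u, v, w])" "linear (\<lambda>v. \<alpha> [u, v, w])" "linear (\<lambda>w. \<alpha> [u, v, w])"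
  using assms[unfolded multilin_def, rule_format, of "[0, v, w]" 0]
    assms[unfolded multilin_def, rule_format, of "[u, 0, w]" 1]
    assms[unfolded multilin_def, rule_format, of "[u, v, 0]" 2] by simp_all

lemma tensor_field_bounded_linear:
  assumes T: "tensor_field A k T" and L: "bounded_linear L"
    and op: "\<And>c. c \<in> A \<Longrightarrow> open (chart_image c)"
  shows "tensor_field A k (\<lambda>c x vs. L (T c x vs))"
  using T unfolding tensor_field_def preserves_tensor_def multilin_def
  by (auto intro!: smooth_on_bounded_linear[OF op L] linear_compose[OF _ bounded_linear.linear[OF L], unfolded o_def])

context torus_action_mfd
begin

lemma tensor_field_linear2:
  assumes "tensor_field A 2 T" "c \<in> A" "x \<in> chart_image c"
  shows "linear (\<lambda>u. T c x [u, v])" "linear (\<lambda>v. T c x [u, v])"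
  using assms multilin_linear2[of "T c x"] by (auto simp: tensor_field_def)

lemma tensor_field_linear3:
  assumes "tensor_field A 3 T" "c \<in> A" "x \<in> chart_image c"
  shows "linear (\<lambda>u. T c x [u, v, w])" "linear (\<lambda>v. T c x [u, v, w])" "linear (\<lambda>w. T c x [u, v, w])"
  using assms multilin_linear3[of "T c x"] by (auto simp: tensor_field_def)

lemma tensor_field_derivative:
  assumes "tensor_field A k T" "c \<in> A" "x \<in> chart_image c" "length vs = k"
  shows "((\<lambda>y. T c y vs) has_derivative frechet_derivative (\<lambda>y. T c y vs) (at x)) (at x)"
  using assms by (auto simp: tensor_field_def intro: smooth_on_has_derivative)

lemma generating_field_derivative:
  assumes "c \<in> A" "x \<in> chart_image c"
  shows "(generating_field act \<xi> c has_derivative frechet_derivative (generating_field act \<xi> c) (at x)) (at x)"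
  using smooth_on_has_derivative[OF smooth_generating_field] assms by blast

lemma open_flow_times: "c \<in> A \<Longrightarrow> open {\<theta>. (\<theta>, x) \<in> flow_dom c}"
  using open_vimage[OF open_flow_dom, of c "\<lambda>\<theta>. (\<theta>, x)"]
  by (simp add: vimage_def continuous_on_Pair)

lemma flow_in_image: "(\<theta>, x) \<in> flow_dom c \<Longrightarrow> flow c (\<theta>, x) \<in> chart_image c"
  by (auto simp: flow_dom_def flow_def chart_in_image)

lemma has_derivative_flow_time_at_0:
  assumes c: "c \<in> A" "x \<in> chart_image c"
  shows "((\<lambda>\<theta>. flow c (\<theta>, x)) has_derivative (\<lambda>\<xi>. generating_field act \<xi> c x)) (at 0)"
  using has_derivative_flow_fst[OF c(1) flow_0(1)[OF c]] by (simp add: generating_field_eq[OF c])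

lemma flow_derivative_at_0:
  assumes c: "c \<in> A" "x \<in> chart_image c"
  shows "frechet_derivative (flow c) (at (0, x)) (0, v) = v"
proof -
  have "((\<lambda>y. y) has_derivative (\<lambda>v. frechet_derivative (flow c) (at (0, x)) (0, v))) (at x)"
    by (rule has_derivative_transform_within_open[OF has_derivative_flow_snd[OF c(1) flow_0(1)[OF c]]
          chart_image_open[OF c(1)] c(2)]) (simp add: flow_0[OF c(1)])
  then have "(\<lambda>v. frechet_derivative (flow c) (at (0, x)) (0, v)) = (\<lambda>v. v)"
    using has_derivative_unique has_derivative_ident by blast
  then show ?thesis by meson
qed

text \<open>Time and space derivatives of the flow commute, and its time derivative at zero is the
  generating field.\<close>

lemma flow_mixed_derivative:
  assumes c: "c \<in> A" "x \<in> chart_image c"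
  shows "((\<lambda>\<theta>. frechet_derivative (flow c) (at (\<theta>, x)) (0, v)) has_derivative
     (\<lambda>\<xi>. frechet_derivative (generating_field act \<xi> c) (at x) v)) (at 0)"
proof -
  let ?D = "\<lambda>w z. frechet_derivative (flow c) (at z) w"
  note d = smooth_on_has_derivative[OF smooth_on_frechet_derivative[OF smooth_flow[OF c(1)]] flow_0(1)[OF c]]
  have 1: "((\<lambda>\<theta>. ?D (0, v) (\<theta>, x)) has_derivative
      (\<lambda>\<xi>. frechet_derivative (?D (0, v)) (at (0, x)) (\<xi>, 0))) (at 0)"
    by (rule has_derivative_compose[of "\<lambda>\<theta>. (\<theta>, x)" "\<lambda>a. (a, 0)", OF _ d]) (auto intro!: derivative_eq_intros)
  have 2: "frechet_derivative (?D (0, v)) (at (0, x)) (\<xi>, 0) = frechet_derivative (generating_field act \<xi> c) (at x) v"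
    for \<xi>
  proof -
    have "((\<lambda>y. ?D (\<xi>, 0) (0, y)) has_derivative (\<lambda>v. frechet_derivative (?D (\<xi>, 0)) (at (0, x)) (0, v))) (at x)"
      by (rule has_derivative_compose[of "\<lambda>y. (0, y)" "\<lambda>a. (0, a)", OF _ d]) (auto intro!: derivative_eq_intros)
    then have "(generating_field act \<xi> c has_derivative (\<lambda>v. frechet_derivative (?D (\<xi>, 0)) (at (0, x)) (0, v))) (at x)"
      by (rule has_derivative_transform_within_open[OF _ chart_image_open[OF c(1)] c(2)])
        (simp add: generating_field_eq[OF c(1)])
    then have "frechet_derivative (generating_field act \<xi> c) (at x) =
        (\<lambda>v. frechet_derivative (?D (\<xi>, 0)) (at (0, x)) (0, v))"
      by (rule frechet_derivative_at[symmetric])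
    then show ?thesis
      using symmetric_second_derivative[OF open_flow_dom[OF c(1)] smooth_flow[OF c(1)] flow_0(1)[OF c]] by simp
  qed
  show ?thesis using 1 by (simp only: 2)
qed

lemma coord_rep_act_derivative:
  assumes c: "c \<in> A" and z: "(\<theta>, x) \<in> flow_dom c"
  shows "frechet_derivative (coord_rep c c (act (torus_exp \<theta>))) (at x) =
    (\<lambda>v. frechet_derivative (flow c) (at (\<theta>, x)) (0, v))"
proof -
  have "coord_rep c c (act (torus_exp \<theta>)) = (\<lambda>y. flow c (\<theta>, y))"
    by (simp add: fun_eq_iff coord_rep_def flow_def)
  then show ?thesis using frechet_derivative_at[OF has_derivative_flow_snd[OF c z], symmetric] by simp
qed

lemma flow_dom_coord_dom: "(\<theta>, x) \<in> flow_dom c \<Longrightarrow> x \<in> coord_dom c c (act (torus_exp \<theta>))"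
  and flow_eq_coord_rep: "flow c (\<theta>, x) = coord_rep c c (act (torus_exp \<theta>)) x"
  by (auto simp: flow_dom_def coord_dom_def coord_rep_def flow_def)

lemma derivative_of_constant_on_flow_times:
  assumes c: "c \<in> A" "x \<in> chart_image c"
    and "\<And>\<theta>. (\<theta>, x) \<in> flow_dom c \<Longrightarrow> f \<theta> = k" and "(f has_derivative D) (at 0)"
  shows "D \<xi> = 0"
proof -
  have "(f has_derivative (\<lambda>\<xi>. 0)) (at 0)"
    by (rule has_derivative_transform_within_open[OF has_derivative_const open_flow_times[OF c(1), of x]])
      (use flow_0(1)[OF c] assms(3) in auto)
  then show ?thesis using assms(4) has_derivative_unique by metis
qed

text \<open>Vanishing of the Lie derivative, written with constant vectors: the invariance of
  \<open>T\<close> under the flow is differentiated at time zero by the product rule, with one term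
  for the moving base point and one for each moving argument.\<close>

lemma lie_derivative_tensor2:
  assumes T: "tensor_field A 2 T" and inv: "\<And>t. t \<in> carrier torus \<Longrightarrow> preserves_tensor A (act t) 2 T"
    and c: "c \<in> A" "x \<in> chart_image c"
  shows "frechet_derivative (\<lambda>y. T c y [v, w]) (at x) (generating_field act \<xi> c x)
    + T c x [v, frechet_derivative (generating_field act \<xi> c) (at x) w]
    + T c x [frechet_derivative (generating_field act \<xi> c) (at x) v, w] = 0"
proof -
  let ?D = "\<lambda>v \<theta>. frechet_derivative (flow c) (at (\<theta>, x)) (0, v)"
  have dT: "((\<lambda>\<theta>. T c (flow c (\<theta>, x)) [u, v]) has_derivative
     (\<lambda>\<xi>. frechet_derivative (\<lambda>y. T c y [u, v]) (at x) (generating_field act \<xi> c x))) (at 0)" for u v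
    by (rule has_derivative_compose[OF has_derivative_flow_time_at_0[OF c]])
      (use tensor_field_derivative[OF T c] flow_0(2)[OF c] in simp)
  have "((\<lambda>\<theta>. T c (flow c (\<theta>, x)) [?D v \<theta>, ?D w \<theta>]) has_derivative
     (\<lambda>\<xi>. frechet_derivative (\<lambda>y. T c y [?D v 0, ?D w 0]) (at x) (generating_field act \<xi> c x)
        + T c (flow c (0, x)) [?D v 0, frechet_derivative (generating_field act \<xi> c) (at x) w]
        + T c (flow c (0, x)) [frechet_derivative (generating_field act \<xi> c) (at x) v, ?D w 0])) (at 0)"
    by (rule has_derivative_bilinear_field[where T = "\<lambda>\<theta> u v. T c (flow c (\<theta>, x)) [u, v]"
          and S = "{\<theta>. (\<theta>, x) \<in> flow_dom c}",
          OF open_flow_times[OF c(1)] _ _ _ dT flow_mixed_derivative[OF c] flow_mixed_derivative[OF c]])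
      (use flow_0[OF c] tensor_field_linear2[OF T c(1) flow_in_image] in auto)
  note D = this
  have "T c (flow c (\<theta>, x)) [?D v \<theta>, ?D w \<theta>] = T c x [v, w]" if z: "(\<theta>, x) \<in> flow_dom c" for \<theta>
    using inv[OF torus_exp_carrier, of \<theta>, unfolded preserves_tensor_def, rule_format,
        OF c(1) c(1) flow_dom_coord_dom[OF z], of "[v, w]"]
    by (simp add: coord_rep_act_derivative[OF c(1) z] flow_eq_coord_rep)
  from derivative_of_constant_on_flow_times[OF c this D]
  show ?thesis by (simp only: flow_derivative_at_0[OF c] flow_0[OF c])
qed

lemma lie_derivative_tensor3:
  assumes T: "tensor_field A 3 T" and inv: "\<And>t. t \<in> carrier torus \<Longrightarrow> preserves_tensor A (act t) 3 T"
    and c: "c \<in> A" "x \<in> chart_image c"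
  shows "frechet_derivative (\<lambda>y. T c y [u, v, w]) (at x) (generating_field act \<xi> c x)
    + T c x [u, v, frechet_derivative (generating_field act \<xi> c) (at x) w]
    + T c x [u, frechet_derivative (generating_field act \<xi> c) (at x) v, w]
    + T c x [frechet_derivative (generating_field act \<xi> c) (at x) u, v, w] = 0"
proof -
  let ?D = "\<lambda>v \<theta>. frechet_derivative (flow c) (at (\<theta>, x)) (0, v)"
  have dT: "((\<lambda>\<theta>. T c (flow c (\<theta>, x)) [u, v, w]) has_derivative
     (\<lambda>\<xi>. frechet_derivative (\<lambda>y. T c y [u, v, w]) (at x) (generating_field act \<xi> c x))) (at 0)" for u v w
    by (rule has_derivative_compose[OF has_derivative_flow_time_at_0[OF c]])
      (use tensor_field_derivative[OF T c] flow_0(2)[OF c] in simp)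
  have "((\<lambda>\<theta>. T c (flow c (\<theta>, x)) [?D u \<theta>, ?D v \<theta>, ?D w \<theta>]) has_derivative
     (\<lambda>\<xi>. frechet_derivative (\<lambda>y. T c y [?D u 0, ?D v 0, ?D w 0]) (at x) (generating_field act \<xi> c x)
        + T c (flow c (0, x)) [?D u 0, ?D v 0, frechet_derivative (generating_field act \<xi> c) (at x) w]
        + T c (flow c (0, x)) [?D u 0, frechet_derivative (generating_field act \<xi> c) (at x) v, ?D w 0]
        + T c (flow c (0, x)) [frechet_derivative (generating_field act \<xi> c) (at x) u, ?D v 0, ?D w 0])) (at 0)"
    by (rule has_derivative_trilinear_field[where T = "\<lambda>\<theta> u v w. T c (flow c (\<theta>, x)) [u, v, w]"
          and S = "{\<theta>. (\<theta>, x) \<in> flow_dom c}",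
          OF open_flow_times[OF c(1)] _ _ _ _ dT flow_mixed_derivative[OF c] flow_mixed_derivative[OF c]
            flow_mixed_derivative[OF c]])
      (use flow_0[OF c] tensor_field_linear3[OF T c(1) flow_in_image] in auto)
  note D = this
  have "T c (flow c (\<theta>, x)) [?D u \<theta>, ?D v \<theta>, ?D w \<theta>] = T c x [u, v, w]" if z: "(\<theta>, x) \<in> flow_dom c" for \<theta>
    using inv[OF torus_exp_carrier, of \<theta>, unfolded preserves_tensor_def, rule_format,
        OF c(1) c(1) flow_dom_coord_dom[OF z], of "[u, v, w]"]
    by (simp add: coord_rep_act_derivative[OF c(1) z] flow_eq_coord_rep)
  from derivative_of_constant_on_flow_times[OF c this D]
  show ?thesis by (simp only: flow_derivative_at_0[OF c] flow_0[OF c])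
qed

text \<open>The identity saying that \<open>J\<close> commutes with the linearized flow is
  differentiated at time zero; on its right side the vector \<open>J c x v\<close> stays frozen at
  \<open>x\<close>.\<close>

lemma lie_derivative_endo:
  assumes J: "endo_field A J" and inv: "\<And>t. t \<in> carrier torus \<Longrightarrow> preserves_endo A (act t) J"
    and c: "c \<in> A" "x \<in> chart_image c"
  shows "frechet_derivative (\<lambda>y. J c y v) (at x) (generating_field act \<xi> c x)
    + J c x (frechet_derivative (generating_field act \<xi> c) (at x) v)
    = frechet_derivative (generating_field act \<xi> c) (at x) (J c x v)"
proof -
  let ?D = "\<lambda>v \<theta>. frechet_derivative (flow c) (at (\<theta>, x)) (0, v)"
  have "((\<lambda>y. J c y v) has_derivative frechet_derivative (\<lambda>y. J c y v) (at x)) (at (flow c (0, x)))" for v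
    using J c by (auto simp: endo_field_def flow_0[OF c] intro: smooth_on_has_derivative)
  from has_derivative_compose[OF has_derivative_flow_time_at_0[OF c] this]
  have dJ: "((\<lambda>\<theta>. J c (flow c (\<theta>, x)) v) has_derivative
     (\<lambda>\<xi>. frechet_derivative (\<lambda>y. J c y v) (at x) (generating_field act \<xi> c x))) (at 0)" for v .
  have "((\<lambda>\<theta>. J c (flow c (\<theta>, x)) (?D v \<theta>)) has_derivative
     (\<lambda>\<xi>. frechet_derivative (\<lambda>y. J c y (?D v 0)) (at x) (generating_field act \<xi> c x)
        + J c (flow c (0, x)) (frechet_derivative (generating_field act \<xi> c) (at x) v))) (at 0)"
    by (rule has_derivative_linear_field[where T = "\<lambda>\<theta>. J c (flow c (\<theta>, x))"
          and S = "{\<theta>. (\<theta>, x) \<in> flow_dom c}",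
          OF open_flow_times[OF c(1)] _ _ dJ flow_mixed_derivative[OF c]])
      (use flow_0[OF c] J c flow_in_image in \<open>auto simp: endo_field_def\<close>)
  note D = has_derivative_diff[OF this flow_mixed_derivative[OF c, of "J c x v"]]
  have "J c (flow c (\<theta>, x)) (?D v \<theta>) - ?D (J c x v) \<theta> = 0" if z: "(\<theta>, x) \<in> flow_dom c" for \<theta>
    using inv[OF torus_exp_carrier, of \<theta>, unfolded preserves_endo_def, rule_format,
        OF c(1) c(1) flow_dom_coord_dom[OF z], of v]
    by (simp add: coord_rep_act_derivative[OF c(1) z] flow_eq_coord_rep)
  from derivative_of_constant_on_flow_times[OF c this D]
  show ?thesis by (simp add: flow_derivative_at_0[OF c] flow_0[OF c])
qed

text \<open>By the group law, the flow after time \<open>\<theta>\<close> is the flow that starts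
  from the point reached at that time.\<close>

lemma flow_time_derivative:
  assumes c: "c \<in> A" "x \<in> chart_image c" and z: "(\<theta>, x) \<in> flow_dom c"
  shows "generating_field act \<eta> c (flow c (\<theta>, x)) = frechet_derivative (flow c) (at (\<theta>, x)) (\<eta>, 0)"
proof -
  let ?p = "act (torus_exp \<theta>) (chart_inv c x)" and ?D = "\<lambda>a. frechet_derivative (flow c) (at (\<theta>, x)) (a, 0)"
  have p: "?p \<in> fst c" using z by (simp add: flow_dom_def)
  have d: "((\<lambda>\<theta>'. flow c (\<theta>', x)) has_derivative ?D) (at (0 + \<theta>))"
    using has_derivative_flow_fst[OF c(1) z] by simp
  have "((\<lambda>\<theta>'. flow c (\<theta>' + \<theta>, x)) has_derivative ?D) (at 0)"
    by (rule has_derivative_compose[of "\<lambda>\<theta>'. \<theta>' + \<theta>" "\<lambda>a. a" 0 UNIV "\<lambda>\<theta>'. flow c (\<theta>', x)", OF _ d])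
      (auto intro!: derivative_eq_intros)
  then have "((\<lambda>\<theta>'. snd c (act (torus_exp \<theta>') ?p)) has_derivative ?D) (at 0)"
    by (simp add: flow_def act_exp_add chart_inv_topspace[OF c])
  from generating_field_unique[OF c(1) p this] show ?thesis by (simp add: flow_def)
qed

text \<open>In coordinates this says that the bracket of the two fields vanishes. Both sides are the
  mixed second derivative of the flow in the two time directions.\<close>

lemma generating_fields_commute:
  assumes c: "c \<in> A" "x \<in> chart_image c"
  shows "frechet_derivative (generating_field act \<eta> c) (at x) (generating_field act \<xi> c x) =
    frechet_derivative (generating_field act \<xi> c) (at x) (generating_field act \<eta> c x)"
proof -
  let ?D = "\<lambda>w z. frechet_derivative (flow c) (at z) w"
  have *: "frechet_derivative (generating_field act \<eta> c) (at x) (generating_field act \<xi> c x) =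
      frechet_derivative (?D (\<eta>, 0)) (at (0, x)) (\<xi>, 0)" for \<xi> \<eta>
  proof -
    have "(generating_field act \<eta> c has_derivative frechet_derivative (generating_field act \<eta> c) (at x))
        (at (flow c (0, x)))"
      using generating_field_derivative[OF c] flow_0(2)[OF c] by simp
    from has_derivative_compose[OF has_derivative_flow_time_at_0[OF c] this]
    have "((\<lambda>\<theta>. ?D (\<eta>, 0) (\<theta>, x)) has_derivative
        (\<lambda>\<xi>. frechet_derivative (generating_field act \<eta> c) (at x) (generating_field act \<xi> c x))) (at 0)"
      by (rule has_derivative_transform_within_open[OF _ open_flow_times[OF c(1), of x]])
        (simp_all add: flow_0[OF c] flow_time_derivative[OF c])
    moreover have "((\<lambda>\<theta>. ?D (\<eta>, 0) (\<theta>, x)) has_derivative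
        (\<lambda>\<xi>. frechet_derivative (?D (\<eta>, 0)) (at (0, x)) (\<xi>, 0))) (at 0)"
      by (rule has_derivative_compose[of "\<lambda>\<theta>. (\<theta>, x)" "\<lambda>a. (a, 0)", OF _
            smooth_on_has_derivative[OF smooth_on_frechet_derivative[OF smooth_flow[OF c(1)]] flow_0(1)[OF c]]])
        (auto intro!: derivative_eq_intros)
    ultimately show ?thesis using has_derivative_unique by metis
  qed
  show ?thesis
    using * symmetric_second_derivative[OF open_flow_dom[OF c(1)] smooth_flow[OF c(1)] flow_0(1)[OF c]] by metis
qed

end

section \<open>Torus elements of finite order\<close>

lemma torus_exp_2pi_multiple: "torus_exp (2 * pi * of_int m, 2 * pi * of_int n) = \<one>\<^bsub>torus\<^esub>"
  by (simp add: torus_exp_def torus_one cis_multiple_2pi)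

lemma norm_cis_diff_le: "norm (cis a - cis b) \<le> \<bar>a - b\<bar>"
proof -
  have "norm (cis a - cis b) \<le> 1 * norm (a - b)"
  proof (rule differentiable_bound[of UNIV cis "\<lambda>x h. h *\<^sub>R (\<i> * cis x)"])
    show "(cis has_derivative (\<lambda>h. h *\<^sub>R (\<i> * cis x))) (at x within UNIV)" for x
      by (intro has_derivative_cis has_derivative_ident)
    show "onorm (\<lambda>h. h *\<^sub>R (\<i> * cis x)) \<le> 1" for x
      by (rule onorm_le) (simp add: norm_mult)
  qed auto
  then show ?thesis by simp
qed

text \<open>The element \<open>torus_exp a\<close> is a point of the subgroup itself if this is a closed circle, and
  otherwise has order two in a coordinate circle, by the density of irrational rotations.\<close>

lemma torsion_in_closure_of_one_parameter_subgroup: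
  assumes w: "w \<noteq> 0"
  shows "\<exists>a m. m > 0 \<and> torus_exp (real m *\<^sub>R a) = \<one>\<^bsub>torus\<^esub> \<and> torus_exp a \<noteq> \<one>\<^bsub>torus\<^esub> \<and>
    (\<forall>e>0. \<exists>s. dist (torus_exp (s *\<^sub>R w)) (torus_exp a) < e)"
proof (cases "fst w = 0")
  case True
  then have w2: "snd w \<noteq> 0" using w by (metis prod.collapse zero_prod_def)
  show ?thesis
  proof (intro exI conjI allI impI)
    show "torus_exp (real 2 *\<^sub>R (0, pi)) = \<one>\<^bsub>torus\<^esub>" using torus_exp_2pi_multiple[of 0 1] by simp
    show "torus_exp (0, pi) \<noteq> \<one>\<^bsub>torus\<^esub>" by (simp add: torus_exp_def torus_one)
    fix e :: real assume "e > 0"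
    then show "dist (torus_exp ((pi / snd w) *\<^sub>R w)) (torus_exp (0, pi)) < e"
      using w2 True by (simp add: torus_exp_def)
  qed simp
next
  case w1: False
  define \<alpha> where "\<alpha> = snd w / fst w"
  show ?thesis
  proof (cases "\<alpha> \<in> \<rat>")
    case True
    then obtain i :: int and n :: nat where n: "n > 0" "\<alpha> = of_int i / of_nat n"
      by (auto elim!: Rats_cases' simp: Rats_eq_int_div_nat)
    show ?thesis
    proof (intro exI conjI allI impI)
      \<comment> \<open>The element has angle \<open>pi\<close> in the first circle, hence is not
        one; \<open>2 * n\<close> clears the denominator of the slope and makes both angles
        multiples of \<open>2 * pi\<close>.\<close>
      have "real (2 * n) *\<^sub>R ((pi / fst w) *\<^sub>R w) = (2 * pi * of_int (int n), 2 * pi * of_int i)"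
        using w1 n(1) n(2) by (cases w) (simp add: \<alpha>_def field_simps)
      then show "torus_exp (real (2 * n) *\<^sub>R ((pi / fst w) *\<^sub>R w)) = \<one>\<^bsub>torus\<^esub>"
        using torus_exp_2pi_multiple by metis
      show "torus_exp ((pi / fst w) *\<^sub>R w) \<noteq> \<one>\<^bsub>torus\<^esub>"
        using w1 by (simp add: torus_exp_def torus_one)
      fix e :: real assume "e > 0"
      then show "dist (torus_exp ((pi / fst w) *\<^sub>R w)) (torus_exp ((pi / fst w) *\<^sub>R w)) < e" by simp
    qed (use n in simp)
  next
    case False
    show ?thesis
    proof (rule exI[of _ "(0, pi)"], rule exI[of _ 2], intro conjI allI impI)
      show "torus_exp (real 2 *\<^sub>R (0, pi)) = \<one>\<^bsub>torus\<^esub>" using torus_exp_2pi_multiple[of 0 1] by simp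
      show "torus_exp (0, pi) \<noteq> \<one>\<^bsub>torus\<^esub>" by (simp add: torus_exp_def torus_one)
      fix e :: real assume e: "e > 0"
      \<comment> \<open>At the time \<open>2 * pi * k / fst w\<close> the first circle is back at
        one and the second is at angle \<open>2 * pi * k * \<alpha>\<close>, close to
        \<open>pi\<close> when the fractional part of \<open>k * \<alpha>\<close> is close to one
        half.\<close>
      obtain k where "\<bar>frac (real k * \<alpha>) - 1 / 2\<bar> < e / (2 * pi)"
        using Kronecker_approx_1_explicit[OF False, of "1 / 2" "e / (2 * pi)"] e by auto
      then have "2 * pi * \<bar>frac (real k * \<alpha>) - 1 / 2\<bar> < e" by (simp add: field_simps)
      moreover have "2 * pi * \<bar>frac (real k * \<alpha>) - 1 / 2\<bar> = \<bar>2 * pi * (frac (real k * \<alpha>) - 1 / 2)\<bar>"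
        by (simp add: abs_mult)
      moreover have "2 * pi * (frac (real k * \<alpha>) - 1 / 2)
          = (2 * pi * real k * \<alpha> - 2 * pi * of_int \<lfloor>real k * \<alpha>\<rfloor>) - pi"
        by (simp add: frac_def algebra_simps)
      ultimately have
        "\<bar>(2 * pi * real k * \<alpha> - 2 * pi * of_int \<lfloor>real k * \<alpha>\<rfloor>) - pi\<bar> < e" by simp
      with norm_cis_diff_le have lt: "norm (cis (2 * pi * real k * \<alpha> - 2 * pi * of_int \<lfloor>real k * \<alpha>\<rfloor>) - cis pi) < e"
        by (rule le_less_trans)
      have cis: "cis (2 * pi * real k * \<alpha> - 2 * pi * of_int \<lfloor>real k * \<alpha>\<rfloor>) = cis (2 * pi * real k * \<alpha>)"
        by (simp add: cis_divide[symmetric] cis_multiple_2pi)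
      have "torus_exp ((2 * pi * real k / fst w) *\<^sub>R w) = (1, cis (2 * pi * real k * \<alpha>))"
        using w1 cis_multiple_2pi[of "real k"] by (cases w) (simp add: torus_exp_def \<alpha>_def field_simps)
      then have "dist (torus_exp ((2 * pi * real k / fst w) *\<^sub>R w)) (torus_exp (0, pi)) < e"
        using lt cis by (simp add: torus_exp_def dist_Pair_Pair dist_norm)
      then show "\<exists>s. dist (torus_exp (s *\<^sub>R w)) (torus_exp (0, pi)) < e" by blast
    qed simp
  qed
qed

lemma smooth_on_divide:
  fixes f g :: "'a::euclidean_space \<Rightarrow> real"
  shows "open S \<Longrightarrow> smooth_on S f \<Longrightarrow> smooth_on S g \<Longrightarrow> (\<And>x. x \<in> S \<Longrightarrow> g x \<noteq> 0) \<Longrightarrow>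
    smooth_on S (\<lambda>x. f x / g x)"
  by (simp add: smooth_on_def Ck_on_divide)

locale real_torus_action_mfd = torus_action_mfd X A act
  for X :: "'p topology" and A :: "('p, real ^ 'n) chart set" and act
begin

lemma smooth_act_chart:
  assumes "c \<in> A" "c' \<in> A" "t \<in> carrier torus"
  shows "open (coord_dom c c' (act t))" "smooth_on (coord_dom c c' (act t)) (coord_rep c c' (act t))"
  using smooth_fromD[OF smooth_from_act[OF smooth_from_chart_inv[OF assms(1)] assms(3)] assms(2)]
  by (simp_all add: coord_dom_def coord_rep_def[abs_def])

lemma act_exp_iterate:
  assumes "q \<in> topspace X" "act (torus_exp a) q = q" shows "act (torus_exp (real k *\<^sub>R a)) q = q"
proof (induction k)
  case (Suc k)
  have "real (Suc k) *\<^sub>R a = a + real k *\<^sub>R a" by (simp add: algebra_simps)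
  then show ?case using act_exp_add[OF assms(1), of a "real k *\<^sub>R a"] Suc assms(2) by simp
qed (use assms act_exp_0 in simp)

text \<open>The average over the iterates of a periodic transformation is invariant, and it is a local
  diffeomorphism where all the iterates have derivative one; so the transformation is trivial there.\<close>

lemma periodic_action_locally_trivial:
  assumes c: "c \<in> A" "p \<in> fst c" and m: "m > 0" "torus_exp (real m *\<^sub>R a) = \<one>\<^bsub>torus\<^esub>"
    and fixed: "\<And>k. act (torus_exp (real k *\<^sub>R a)) p = p"
    and der: "\<And>k. frechet_derivative (coord_rep c c (act (torus_exp (real k *\<^sub>R a)))) (at (snd c p)) = (\<lambda>v. v)"
  shows "\<exists>Q. openin X Q \<and> p \<in> Q \<and> (\<forall>q\<in>Q. act (torus_exp a) q = q)"
proof -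
  let ?E = "\<lambda>k::nat. act (torus_exp (real k *\<^sub>R a))"
  let ?F = "\<lambda>k. coord_rep c c (?E k)"
  let ?S = "\<Inter>k\<in>{..m}. coord_dom c c (?E k)"
  have S: "open ?S" by (intro open_INT ballI smooth_act_chart(1) c torus_exp_carrier) simp
  have F: "smooth_on ?S (?F k)" if "k \<le> m" for k
    by (rule smooth_on_subset[OF smooth_act_chart(2)[OF c(1) c(1) torus_exp_carrier]]) (use that in auto)
  have px: "chart_inv c (snd c p) = p" by (rule chart_inv_chart[OF c])
  have pS: "snd c p \<in> ?S" using c fixed by (auto simp: coord_dom_def px chart_in_image)
  \<comment> \<open>The sum serves as well as the mean; its derivative is \<open>m\<close> times the
    identity.\<close>
  define \<phi> where "\<phi> x = (\<Sum>k<m. ?F k x)" for x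
  have \<phi>: "smooth_on ?S \<phi>" unfolding \<phi>_def by (intro smooth_on_sum S F) auto
  have "(\<phi> has_derivative (\<lambda>v. \<Sum>k<m. frechet_derivative (?F k) (at (snd c p)) v)) (at (snd c p))"
    unfolding \<phi>_def by (intro has_derivative_sum smooth_on_has_derivative[OF F pS]) auto
  from frechet_derivative_at[OF this, symmetric]
  have "frechet_derivative \<phi> (at (snd c p)) = (\<lambda>v. real m *\<^sub>R v)"
    by (simp add: der sum_constant_scaleR del: sum_constant)
  then have "inj (frechet_derivative \<phi> (at (snd c p)))" using m by (simp add: inj_on_def)
  from smooth_inverse_function[OF S \<phi> pS this] obtain T W G where T: "open T" "snd c p \<in> T" "T \<subseteq> ?S"
    and "open W" and hom: "homeomorphism T W \<phi> G" and "smooth_on W G" .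
  have inj: "x = y" if "x \<in> T" "y \<in> T" "\<phi> x = \<phi> y" for x y
    using homeomorphism_apply1[OF hom that(1)] homeomorphism_apply1[OF hom that(2)] that(3) by argo
  have m1: "1 \<le> m" using m by simp
  have "continuous_on T (?F 1)"
    using smooth_on_continuous_on[OF F[OF m1]] T(3) continuous_on_subset by blast
  \<comment> \<open>On this set both a point and its image lie in \<open>T\<close>, where
    \<open>\<phi>\<close> is injective.\<close>
  then have T': "open (T \<inter> ?F 1 -` T)" using T(1) by (intro continuous_open_preimage) auto
  let ?Q = "{q \<in> fst c. snd c q \<in> T \<inter> ?F 1 -` T}"
  have "act (torus_exp a) q = q" if q: "q \<in> ?Q" for q
  proof -
    have qc: "q \<in> fst c" "chart_inv c (snd c q) = q" "q \<in> topspace X"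
      using q chart_inv_chart[OF c(1)] chart_subset[OF c(1)] by auto
    have qE: "?E k q \<in> fst c" if "k \<le> m" for k using q T(3) that by (auto simp: coord_dom_def qc)
    have Eadd: "?E k (?E 1 q) = ?E (Suc k) q" for k
      using act_exp_add[OF qc(3), of "real k *\<^sub>R a" a] by (simp add: algebra_simps)
    have F1: "?F k (?F 1 (snd c q)) = ?F (Suc k) (snd c q)" for k
      using chart_inv_chart[OF c(1) qE[OF m1]] Eadd[of k] by (simp add: coord_rep_def qc)
    have "?F m (snd c q) = ?F 0 (snd c q)"
      using m(2) by (simp add: coord_rep_def torus_exp_0)
    \<comment> \<open>Periodicity makes the shifted sum have the same terms, so
      \<open>\<phi>\<close> takes the same value at a point and at its image.\<close>
    then have "(\<Sum>k<m. ?F (Suc k) (snd c q)) = \<phi> (snd c q)"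
      using sum.lessThan_Suc_shift[of "\<lambda>k. ?F k (snd c q)" m] sum.lessThan_Suc[of "\<lambda>k. ?F k (snd c q)" m]
      by (simp add: \<phi>_def)
    then have "\<phi> (?F 1 (snd c q)) = \<phi> (snd c q)" unfolding \<phi>_def by (simp only: F1)
    then have "?F 1 (snd c q) = snd c q" using q inj by auto
    then have "snd c (?E 1 q) = snd c q" by (simp add: coord_rep_def qc)
    then show ?thesis using chart_inj[OF c(1)] qE[OF m1] qc(1) by (simp add: inj_on_eq_iff)
  qed
  moreover have "openin X ?Q" by (rule openin_chart_preimage[OF c(1) T'])
  moreover have "p \<in> ?Q" using c T(2) fixed[of 1] px by (simp add: coord_rep_def)
  ultimately show ?thesis by blast
qed

text \<open>The interior of the fixed point set is closed: at a limit point all iterates fix the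
  point and, by continuity, have derivative one there, so the preceding lemma gives a neighbourhood
  of fixed points. Connectedness and effectiveness then conclude.\<close>

lemma periodic_action_trivial:
  assumes conn: "connected_space X" and m: "m > 0" "torus_exp (real m *\<^sub>R a) = \<one>\<^bsub>torus\<^esub>"
    and Q0: "openin X Q0" "Q0 \<noteq> {}" "\<And>q. q \<in> Q0 \<Longrightarrow> act (torus_exp a) q = q"
  shows "torus_exp a = \<one>\<^bsub>torus\<^esub>"
proof -
  let ?E = "\<lambda>k::nat. act (torus_exp (real k *\<^sub>R a))"
  define Z where "Z = \<Union>{Q. openin X Q \<and> (\<forall>q\<in>Q. act (torus_exp a) q = q)}"
  have oZ: "openin X Z" unfolding Z_def by (intro openin_Union) auto
  have ZX: "Z \<subseteq> topspace X" using oZ openin_subset by blast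
  have fixZ: "?E k q = q" if "q \<in> Z" for k q
    using that ZX act_exp_iterate[of q a k] by (auto simp: Z_def)
  have "closedin X Z"
  proof -
    have "X closure_of Z \<subseteq> Z"
    proof
      fix p assume p: "p \<in> X closure_of Z"
      then have pX: "p \<in> topspace X" by (simp add: in_closure_of)
      then obtain c where c: "c \<in> A" "p \<in> fst c" using ex_chart by blast
      have "closedin X {q \<in> topspace X. ?E k q = q}" for k
        by (intro closedin_continuous_maps_eq[OF Hausdorff] act_continuous) auto
      moreover have "Z \<subseteq> {q \<in> topspace X. ?E k q = q}" for k using fixZ ZX by blast
      ultimately have fixp: "?E k p = p" for k
        using closure_of_minimal[of Z "{q \<in> topspace X. ?E k q = q}" X] p by blast
      have "frechet_derivative (coord_rep c c (?E k)) (at (snd c p)) v = v" for k v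
      proof (rule ccontr)
        assume ne: "frechet_derivative (coord_rep c c (?E k)) (at (snd c p)) v \<noteq> v"
        let ?f = "\<lambda>x. frechet_derivative (coord_rep c c (?E k)) (at x) v"
        let ?dom = "coord_dom c c (?E k)"
        \<comment> \<open>An open set around the limit point where the derivative moves
          \<open>v\<close>; it meets \<open>Z\<close>, near whose points the iterate is the
          identity.\<close>
        let ?N = "?dom \<inter> ?f -` (- {v})"
        note sm = smooth_act_chart[OF c(1) c(1) torus_exp_carrier, of "real k *\<^sub>R a"]
        have "open ?N"
          by (rule continuous_open_preimage[OF smooth_on_continuous_on[OF smooth_on_frechet_derivative[OF sm(2)]] sm(1)])
            (simp add: open_Compl)
        then have "openin X {q \<in> fst c. snd c q \<in> ?N}" by (rule openin_chart_preimage[OF c(1)])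
        moreover have "p \<in> {q \<in> fst c. snd c q \<in> ?N}"
          using c ne fixp chart_inv_chart[OF c] by (auto simp: coord_dom_def chart_in_image)
        ultimately have "\<exists>q. q \<in> Z \<and> q \<in> {q \<in> fst c. snd c q \<in> ?N}"
          using p unfolding in_closure_of by (elim conjE allE[of _ "{q \<in> fst c. snd c q \<in> ?N}"] impE) simp_all
        then obtain q where q: "q \<in> Z" "q \<in> fst c" "snd c q \<in> ?N" by auto
        let ?B = "{x \<in> chart_image c. chart_inv c x \<in> Z}"
        have "frechet_derivative (coord_rep c c (?E k)) (at (snd c q)) = frechet_derivative (\<lambda>x. x) (at (snd c q))"
        proof (rule frechet_derivative_cong_open[OF open_chart_inv_preimage[OF c(1) oZ]])
          show "snd c q \<in> ?B" using q chart_inv_chart[OF c(1) q(2)] by (simp add: chart_in_image)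
          fix x assume "x \<in> ?B"
          then have "?E k (chart_inv c x) = chart_inv c x" "x \<in> chart_image c" using fixZ by blast+
          then show "coord_rep c c (?E k) x = x" by (simp add: coord_rep_def chart_chart_inv)
        qed
        moreover have "?f (snd c q) \<noteq> v" using q(3) by blast
        ultimately show False by simp
      qed
      then have "\<exists>Q. openin X Q \<and> p \<in> Q \<and> (\<forall>q\<in>Q. act (torus_exp a) q = q)"
        by (intro periodic_action_locally_trivial[OF c m fixp] ext)
      then show "p \<in> Z" by (auto simp: Z_def)
    qed
    then show ?thesis using ZX closure_of_subset_eq by blast
  qed
  moreover have "Z \<noteq> {}" using Q0 by (auto simp: Z_def)
  ultimately have "Z = topspace X" using conn oZ by (auto simp: connected_space_clopen_in)
  then show ?thesis using fixZ[of _ 1] by (intro effective) auto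
qed

lemma generating_field_not_zero_on_open:
  assumes conn: "connected_space X" and c: "c \<in> A" and w: "w \<noteq> 0"
    and B: "open B" "B \<noteq> {}" "B \<subseteq> chart_image c"
  shows "\<exists>x\<in>B. generating_field act w c x \<noteq> 0"
proof (rule ccontr)
  assume "\<not> ?thesis"
  then have zero: "generating_field act w c x = 0" if "x \<in> B" for x using that by blast
  have fixed: "act (torus_exp (s *\<^sub>R w)) (chart_inv c x) = chart_inv c x" if x: "x \<in> B" for x s
  proof -
    have xI: "x \<in> chart_image c" using x B by blast
    have qX: "chart_inv c x \<in> topspace X" using chart_inv_topspace[OF c xI] .
    let ?T = "(\<lambda>s. (s *\<^sub>R w, x)) -` flow_dom c"
    have "open ?T" by (intro open_vimage open_flow_dom c continuous_intros)
    moreover have "0 \<in> ?T" using flow_0(1)[OF c xI] by simp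
    ultimately obtain d where d: "d > 0" "ball 0 d \<subseteq> ?T" using openE by blast
    have "flow c (s *\<^sub>R w, x) = flow c (0 *\<^sub>R w, x)" if s: "s \<in> ball 0 d" for s
    proof (rule has_derivative_zero_unique[of "ball 0 d" "\<lambda>s. flow c (s *\<^sub>R w, x)"])
      fix s :: real assume "s \<in> ball 0 d"
      then have z: "(s *\<^sub>R w, x) \<in> flow_dom c" using d by auto
      \<comment> \<open>Along the orbit the field is the image of its value at \<open>x\<close>
        under the derivative of the action, hence zero; so the orbit does not move while it stays in
        the chart.\<close>
      have "frechet_derivative (flow c) (at (s *\<^sub>R w, x)) (w, 0) = generating_field act w c (flow c (s *\<^sub>R w, x))"
        using flow_time_derivative[OF c xI z] by simp
      also have "\<dots> = frechet_derivative (coord_rep c c (act (torus_exp (s *\<^sub>R w)))) (at x) 0"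
        using generating_field_act[OF c chart_inv_in[OF xI] c, of "torus_exp (s *\<^sub>R w)" w] z zero[OF x]
        by (simp add: flow_def flow_dom_def chart_chart_inv[OF xI])
      also have "\<dots> = 0"
        using linear_0[OF has_derivative_linear[OF has_derivative_flow_snd[OF c z]]]
        by (simp add: coord_rep_act_derivative[OF c z])
      finally have D0: "frechet_derivative (flow c) (at (s *\<^sub>R w, x)) (w, 0) = 0" .
      have "frechet_derivative (flow c) (at (s *\<^sub>R w, x)) (h *\<^sub>R w, 0) = 0" for h
        using linear_scale[OF has_derivative_linear[OF flow_derivative[OF c z]], of h "(w, 0)"] D0 by simp
      moreover have "((\<lambda>s. flow c (s *\<^sub>R w, x)) has_derivative
          (\<lambda>h. frechet_derivative (flow c) (at (s *\<^sub>R w, x)) (h *\<^sub>R w, 0))) (at s)"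
        by (rule has_derivative_compose[of "\<lambda>s. s *\<^sub>R w" "\<lambda>h. h *\<^sub>R w" s UNIV "\<lambda>\<theta>. flow c (\<theta>, x)",
              OF _ has_derivative_flow_fst[OF c z]]) (auto intro!: derivative_eq_intros)
      ultimately show "((\<lambda>s. flow c (s *\<^sub>R w, x)) has_derivative (\<lambda>h. 0)) (at s within ball 0 d)"
        by (simp add: has_derivative_at_withinI)
    qed (use d s in auto)
    then have near: "act (torus_exp (s *\<^sub>R w)) (chart_inv c x) = chart_inv c x" if "\<bar>s\<bar> < d" for s
    proof -
      have s: "s \<in> ball 0 d" using that by simp
      then have in_c: "act (torus_exp (s *\<^sub>R w)) (chart_inv c x) \<in> fst c" using d by (auto simp: flow_dom_def)
      have "flow c (s *\<^sub>R w, x) = x"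
        using \<open>\<And>s. s \<in> ball 0 d \<Longrightarrow> flow c (s *\<^sub>R w, x) = flow c (0 *\<^sub>R w, x)\<close>[OF s] flow_0(2)[OF c xI] by simp
      then have "chart_inv c (snd c (act (torus_exp (s *\<^sub>R w)) (chart_inv c x))) = chart_inv c x"
        by (simp add: flow_def)
      then show ?thesis by (simp add: chart_inv_chart[OF c in_c])
    qed
    \<comment> \<open>An arbitrary time is divided into \<open>n\<close> steps shorter than
      \<open>d\<close>, each of which fixes the point.\<close>
    obtain n :: nat where n: "\<bar>s\<bar> / d < real n" using reals_Archimedean2 by blast
    have "0 \<le> \<bar>s\<bar> / d" using d by simp
    then have n0: "n > 0" using n by linarith
    have "\<bar>s / real n\<bar> < d" using n n0 d by (simp add: abs_divide field_simps)
    from act_exp_iterate[OF qX near[OF this], of n] show ?thesis using n0 by simp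
  qed
  obtain a m where m: "m > 0" "torus_exp (real m *\<^sub>R a) = \<one>\<^bsub>torus\<^esub>" and a: "torus_exp a \<noteq> \<one>\<^bsub>torus\<^esub>"
    and lim: "\<And>e. e > 0 \<Longrightarrow> \<exists>s. dist (torus_exp (s *\<^sub>R w)) (torus_exp a) < e"
    using torsion_in_closure_of_one_parameter_subgroup[OF w] by blast
  have "act (torus_exp a) q = q" if q: "q \<in> {q \<in> fst c. snd c q \<in> B}" for q
  proof -
    have qX: "q \<in> topspace X" using q chart_subset[OF c] by blast
    \<comment> \<open>The stabilizer of \<open>q\<close>, closed because the space is Hausdorff. It
      contains the one-parameter group, hence also the limit element
      \<open>torus_exp a\<close>.\<close>
    let ?K = "{t \<in> topspace (top_of_set (carrier torus)). act t q = q}"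
    have "continuous_map (top_of_set (carrier torus)) (prod_topology (top_of_set (carrier torus)) X) (\<lambda>t. (t, q))"
      using qX by (auto intro: continuous_map_pairedI)
    from continuous_map_compose[OF this action_continuous]
    have "continuous_map (top_of_set (carrier torus)) X (\<lambda>t. act t q)" by (simp add: o_def)
    then have "closedin (top_of_set (carrier torus)) ?K"
      using qX by (intro closedin_continuous_maps_eq[OF Hausdorff]) auto
    moreover have "closed (carrier torus)" by (simp add: torus_carrier closed_Times)
    ultimately have "closed ?K" using closedin_closed_trans by blast
    moreover have "torus_exp (s *\<^sub>R w) \<in> ?K" for s
      using fixed[of "snd c q" s] q chart_inv_chart[OF c] by simp
    then have "torus_exp a \<in> closure ?K" unfolding closure_approachable using lim by blast
    ultimately show ?thesis by simp
  qed
  moreover have "{q \<in> fst c. snd c q \<in> B} \<noteq> {}"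
  proof -
    obtain x where x: "x \<in> B" using B by blast
    then have "chart_inv c x \<in> {q \<in> fst c. snd c q \<in> B}"
      using B chart_inv_in[of x c] chart_chart_inv[of x c] by auto
    then show ?thesis by blast
  qed
  ultimately have "torus_exp a = \<one>\<^bsub>torus\<^esub>"
    by (intro periodic_action_trivial[OF conn m openin_chart_preimage[OF c B(1)]])
  then show False using a by contradiction
qed

end

section \<open>Stabilizers and linear dependence of the generating fields\<close>

lemma torus_exp_diff_cong:
  "torus_exp x = torus_exp x' \<Longrightarrow> torus_exp y = torus_exp y' \<Longrightarrow> torus_exp (x - y) = torus_exp (x' - y')"
  by (simp add: torus_exp_def cis_divide[symmetric])

context real_torus_action_mfd
begin

lemma topspace_nonempty: "topspace X \<noteq> {}"
proof
  assume "topspace X = {}"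
  then have "torus_exp (pi, 0) = \<one>\<^bsub>torus\<^esub>" by (intro effective) auto
  then show False by (simp add: torus_exp_def torus_one)
qed

text \<open>The derivative of the orbit map at time zero is bounded below by \<open>B\<close>, while
  the remainder is at most half of that for small times, so the orbit map does not return to
  \<open>p\<close>.\<close>

lemma locally_free_at_independent_point:
  assumes c: "c \<in> A" "p \<in> fst c" and inj: "inj (\<lambda>\<xi>. generating_field act \<xi> c (snd c p))"
  shows "\<exists>e>0. \<forall>\<theta>. norm \<theta> < e \<and> act (torus_exp \<theta>) p = p \<longrightarrow> \<theta> = 0"
proof -
  let ?D = "\<lambda>\<xi>. generating_field act \<xi> c (snd c p)" and ?x = "snd c p"
  have x: "?x \<in> chart_image c" using c by (simp add: chart_in_image)
  obtain B where B: "B > 0" "\<And>\<xi>. B * norm \<xi> \<le> norm (?D \<xi>)"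
    using linear_inj_bounded_below_pos[OF linear_generating_field[OF c(1) x] inj] by blast
  have "((\<lambda>\<theta>. flow c (\<theta>, ?x)) has_derivative ?D) (at 0)" by (rule has_derivative_flow_time_at_0[OF c(1) x])
  then obtain d where d: "d > 0"
    "\<And>\<theta>. norm \<theta> < d \<Longrightarrow> norm (flow c (\<theta>, ?x) - flow c (0, ?x) - ?D \<theta>) \<le> B / 2 * norm \<theta>"
    unfolding has_derivative_at_alt using B(1) by (metis diff_zero half_gt_zero)
  have "\<theta> = 0" if "norm \<theta> < d" "act (torus_exp \<theta>) p = p" for \<theta>
  proof -
    have "flow c (\<theta>, ?x) = flow c (0, ?x)"
      using that(2) flow_0(2)[OF c(1) x] chart_inv_chart[OF c] by (simp add: flow_def)
    then have "norm (?D \<theta>) \<le> B / 2 * norm \<theta>" using d(2)[OF that(1)] by simp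
    then have "B * norm \<theta> \<le> B / 2 * norm \<theta>" using B(2)[of \<theta>] by linarith
    then have "B / 2 * norm \<theta> \<le> 0" by simp
    then show ?thesis using B(1) by (simp add: mult_le_0_iff)
  qed
  then show ?thesis using d(1) by blast
qed

text \<open>A pigeonhole argument: the multiples of \<open>a\<close> have representatives in a
  compact ball, so two of these are close. Their difference exponentiates into the stabilizer and is
  small, hence zero, and the difference of the indices is a period.\<close>

lemma stabilizer_finite_order_at_independent_point:
  assumes c: "c \<in> A" "p \<in> fst c" and inj: "inj (\<lambda>\<xi>. generating_field act \<xi> c (snd c p))"
    and fixed: "act (torus_exp a) p = p"
  shows "\<exists>m>0. torus_exp (real m *\<^sub>R a) = \<one>\<^bsub>torus\<^esub>"
proof -
  have p: "p \<in> topspace X" using c chart_subset by blast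
  obtain e where e: "e > 0" "\<And>\<theta>. norm \<theta> < e \<Longrightarrow> act (torus_exp \<theta>) p = p \<Longrightarrow> \<theta> = 0"
    using locally_free_at_independent_point[OF c inj] by blast
  have "\<exists>b. torus_exp (real k *\<^sub>R a) = torus_exp b \<and> norm b \<le> 2 * pi" for k :: nat
    using torus_exp_surj[OF torus_exp_carrier] by metis
  then obtain b where b: "\<And>k::nat. torus_exp (real k *\<^sub>R a) = torus_exp (b k)" "\<And>k. norm (b k) \<le> 2 * pi"
    by metis
  have "b k \<in> cball 0 (2 * pi)" for k using b(2) by simp
  then obtain l r where r: "strict_mono r" "(b \<circ> r) \<longlonglongrightarrow> l"
    using compact_cball[of "0 :: real \<times> real" "2 * pi"] unfolding compact_def by blast
  then have "Cauchy (b \<circ> r)" using LIMSEQ_imp_Cauchy by blast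
  then obtain N where N: "\<And>i j. i \<ge> N \<Longrightarrow> j \<ge> N \<Longrightarrow> norm ((b \<circ> r) i - (b \<circ> r) j) < e"
    using CauchyD[OF _ e(1)] by blast
  define i j where "i = r N" and "j = r (Suc N)"
  have ij: "i < j" using r(1) by (simp add: i_def j_def strict_mono_def)
  have "real (j - i) *\<^sub>R a = real j *\<^sub>R a - real i *\<^sub>R a" using ij by (simp add: of_nat_diff scaleR_diff_left)
  then have eq: "torus_exp (real (j - i) *\<^sub>R a) = torus_exp (b j - b i)"
    using torus_exp_diff_cong[OF b(1) b(1)] by simp
  have "act (torus_exp (b j - b i)) p = p"
    using act_exp_iterate[OF p fixed, of "j - i"] eq by simp
  moreover have "norm (b j - b i) < e" using N[of "Suc N" N] by (simp add: i_def j_def)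
  ultimately have "b j - b i = 0" using e(2) by blast
  then have "torus_exp (real (j - i) *\<^sub>R a) = \<one>\<^bsub>torus\<^esub>" using eq torus_exp_0 by simp
  then show ?thesis using ij by (intro exI[of _ "j - i"]) simp
qed

text \<open>Both \<open>U\<close> and \<open>V = f U\<close> preserve \<open>J\<close>. Comparing
  the two Lie derivatives leaves \<open>f' v J U = f' (J v) U\<close>, and a nonzero vector is never
  a real eigenvector of \<open>J\<close>.\<close>

lemma derivative_of_proportionality_factor:
  assumes J: "almost_complex A J" and invJ: "\<And>t. t \<in> carrier torus \<Longrightarrow> preserves_endo A (act t) J"
    and c: "c \<in> A" and B: "open B" "B \<subseteq> chart_image c" and x: "x \<in> B"
    and f: "(f has_derivative f') (at x)"
    and dep: "\<And>x. x \<in> B \<Longrightarrow> generating_field act \<eta> c x = f x *\<^sub>R generating_field act \<xi> c x"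
    and nz: "generating_field act \<xi> c x \<noteq> 0"
  shows "f' v = 0"
proof -
  let ?U = "generating_field act \<xi> c" and ?V = "generating_field act \<eta> c"
  let ?DU = "frechet_derivative ?U (at x)" and ?DV = "frechet_derivative ?V (at x)"
  let ?DJ = "\<lambda>v. frechet_derivative (\<lambda>y. J c y v) (at x)"
  have xI: "x \<in> chart_image c" using x B by blast
  have Jf: "endo_field A J" and J2: "J c x (J c x v) = - v" for v
    using J c xI by (auto simp: almost_complex_def)
  have Jlin: "linear (J c x)" using Jf c xI by (simp add: endo_field_def)
  have "(?V has_derivative (\<lambda>v. f x *\<^sub>R ?DU v + f' v *\<^sub>R ?U x)) (at x)"
    by (rule has_derivative_transform_within_open[OF has_derivative_scaleR[OF f generating_field_derivative[OF c xI]] B(1) x])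
      (simp add: dep)
  then have DV: "?DV = (\<lambda>v. f x *\<^sub>R ?DU v + f' v *\<^sub>R ?U x)" by (rule frechet_derivative_at[symmetric])
  have linDJ: "linear (?DJ v)" for v
    using Jf c xI by (auto simp: endo_field_def intro!: has_derivative_linear[OF smooth_on_has_derivative])
  have "?DJ v (?V x) + J c x (?DV v) = ?DV (J c x v)" for v
    by (rule lie_derivative_endo[OF Jf invJ c xI])
  moreover have "?DJ v (?U x) + J c x (?DU v) = ?DU (J c x v)" for v
    by (rule lie_derivative_endo[OF Jf invJ c xI])
  ultimately have "f x *\<^sub>R ?DU (J c x v) + f' v *\<^sub>R J c x (?U x) = f x *\<^sub>R ?DU (J c x v) + f' (J c x v) *\<^sub>R ?U x"
    by (simp add: DV dep[OF x] linear_scale[OF linDJ] linear_add[OF Jlin] linear_scale[OF Jlin]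
        scaleR_add_right[symmetric] add.assoc[symmetric])
  then have eq: "f' v *\<^sub>R J c x (?U x) = f' (J c x v) *\<^sub>R ?U x" by simp
  let ?a = "f' v" and ?b = "f' (J c x v)"
  \<comment> \<open>Applying \<open>J\<close> to the relation and eliminating \<open>J U\<close>
    leaves a vanishing sum of squares as the coefficient of \<open>U\<close>.\<close>
  have "J c x (?a *\<^sub>R J c x (?U x)) = J c x (?b *\<^sub>R ?U x)" using eq by simp
  then have "- ?a *\<^sub>R ?U x = ?b *\<^sub>R J c x (?U x)" by (simp add: linear_scale[OF Jlin] J2)
  then have "?a *\<^sub>R (- ?a *\<^sub>R ?U x) = ?b *\<^sub>R (?a *\<^sub>R J c x (?U x))" by simp
  then have "(?a * ?a + ?b * ?b) *\<^sub>R ?U x = 0"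
    unfolding eq by (simp add: scaleR_add_left neg_eq_iff_add_eq_0)
  then have "?a * ?a + ?b * ?b = 0" using nz by simp
  then show ?thesis by (simp add: sum_squares_eq_zero_iff)
qed

lemma generating_fields_independent_somewhere:
  assumes conn: "connected_space X" and J: "almost_complex A J"
    and invJ: "\<And>t. t \<in> carrier torus \<Longrightarrow> preserves_endo A (act t) J"
    and ind: "\<xi> \<noteq> \<eta>" "independent {\<xi>, \<eta>}"
  shows "\<exists>c\<in>A. \<exists>x\<in>chart_image c. \<forall>\<alpha> \<beta>.
    \<alpha> *\<^sub>R generating_field act \<xi> c x + \<beta> *\<^sub>R generating_field act \<eta> c x = 0 \<longrightarrow> \<alpha> = 0 \<and> \<beta> = 0"
proof (rule ccontr)
  assume not: "\<not> ?thesis"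
  obtain p where "p \<in> topspace X" using topspace_nonempty by blast
  then obtain c where c: "c \<in> A" "p \<in> fst c" using ex_chart by blast
  let ?U = "generating_field act \<xi> c" and ?V = "generating_field act \<eta> c"
  have "\<xi> \<noteq> 0" using ind(2) dependent_zero by auto
  then obtain x0 where x0: "x0 \<in> chart_image c" "?U x0 \<noteq> 0"
    using generating_field_not_zero_on_open[OF conn c(1) _ chart_image_open[OF c(1)]] chart_in_image[OF c(2)]
    by blast
  have I: "open (chart_image c)" by (rule chart_image_open[OF c(1)])
  have sU: "smooth_on (chart_image c) ?U" and sV: "smooth_on (chart_image c) ?V"
    by (rule smooth_generating_field[OF c(1)])+
  have "open (chart_image c \<inter> ?U -` (- {0}))"
    using smooth_on_continuous_on[OF sU] I by (intro continuous_open_preimage) (auto simp: open_Compl)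
  moreover have "x0 \<in> chart_image c \<inter> ?U -` (- {0})" using x0 by simp
  ultimately obtain r where r: "r > 0" "ball x0 r \<subseteq> chart_image c \<inter> ?U -` (- {0})" using openE by blast
  define B where "B = ball x0 r"
  have B: "open B" "B \<noteq> {}" "B \<subseteq> chart_image c" "convex B" using r by (auto simp: B_def)
  have Unz: "?U x \<noteq> 0" if "x \<in> B" for x using r that by (auto simp: B_def)
  \<comment> \<open>The coefficient is written as a Euclidean projection in the chart so that its
    smoothness is visible; the denominator is nonzero on \<open>B\<close>.\<close>
  define f where "f x = (?V x \<bullet> ?U x) / (?U x \<bullet> ?U x)" for x
  have dep: "?V x = f x *\<^sub>R ?U x" if x: "x \<in> B" for x
  proof -
    obtain \<alpha> \<beta> where ab: "\<alpha> *\<^sub>R ?U x + \<beta> *\<^sub>R ?V x = 0" "\<alpha> \<noteq> 0 \<or> \<beta> \<noteq> 0"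
      using not c B x by blast
    then have "\<beta> \<noteq> 0" using Unz[OF x] by auto
    have "\<beta> *\<^sub>R ?V x = - \<alpha> *\<^sub>R ?U x" using ab(1) by (simp add: eq_neg_iff_add_eq_0 add.commute)
    then have "?V x = (1 / \<beta>) *\<^sub>R (- \<alpha> *\<^sub>R ?U x)" using \<open>\<beta> \<noteq> 0\<close> by (metis divide_self_if inverse_eq_divide
          real_vector.scale_one scaleR_scaleR times_divide_eq_left mult_1)
    then have V: "?V x = (- \<alpha> / \<beta>) *\<^sub>R ?U x" by simp
    then have "f x = - \<alpha> / \<beta>" using Unz[OF x] by (simp add: f_def)
    then show ?thesis using V by simp
  qed
  have sf: "smooth_on B f"
    unfolding f_def using B(3) Unz
    by (intro smooth_on_divide B smooth_on_bounded_bilinear[OF B(1) bounded_bilinear_inner]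
        smooth_on_subset[OF sU] smooth_on_subset[OF sV]) auto
  have "(f has_derivative (\<lambda>h. 0)) (at x within B)" if x: "x \<in> B" for x
  proof -
    have "frechet_derivative f (at x) = (\<lambda>h. 0)"
      by (intro ext derivative_of_proportionality_factor[OF J invJ c(1) B(1,3) x
            smooth_on_has_derivative[OF sf x] dep Unz[OF x]])
    then show ?thesis using smooth_on_has_derivative[OF sf x] by (simp add: has_derivative_at_withinI)
  qed
  then obtain k where k: "\<And>x. x \<in> B \<Longrightarrow> f x = k"
    using has_derivative_zero_constant[OF B(4)] by blast
  have "generating_field act (\<eta> - k *\<^sub>R \<xi>) c x = 0" if x: "x \<in> B" for x
  proof -
    have lin: "linear (\<lambda>\<xi>. generating_field act \<xi> c x)"
      using linear_generating_field[OF c(1)] x B by blast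
    show ?thesis using dep[OF x] k[OF x] linear_diff[OF lin, of \<eta> "k *\<^sub>R \<xi>"] linear_scale[OF lin, of k \<xi>] by simp
  qed
  moreover have "\<eta> - k *\<^sub>R \<xi> \<noteq> 0"
  proof
    assume "\<eta> - k *\<^sub>R \<xi> = 0"
    then have "\<eta> \<in> span {\<xi>}" by (simp add: span_base span_scale)
    moreover have "{\<xi>, \<eta>} - {\<eta>} = {\<xi>}" using ind(1) by auto
    ultimately show False using ind(2) unfolding dependent_def by force
  qed
  ultimately show False using generating_field_not_zero_on_open[OF conn c(1) _ B(1-3)] by blast
qed

end

section \<open>The multi-moment map\<close>

text \<open>Lists the 24 permutations as products of transpositions, whose values and signs can be
  evaluated by rewriting.\<close>

lemma permutes_4_sum:
  "sum f {\<pi>. \<pi> permutes {..<4::nat}} =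
    (\<Sum>a\<in>{0,1,2,3}. \<Sum>b\<in>{1,2,3}. \<Sum>c\<in>{2,3}. f (Transposition.transpose 0 a \<circ> (Transposition.transpose 1 b \<circ> (Transposition.transpose 2 c \<circ> id))))"
proof -
  have 4: "{..<4::nat} = insert 0 (insert 1 (insert 2 {3}))" by auto
  have f: "finite (insert 1 (insert 2 {3::nat}))" "0 \<notin> insert 1 (insert 2 {3::nat})"
    "finite (insert 2 {3::nat})" "1 \<notin> insert 2 {3::nat}" "finite {3::nat}" "2 \<notin> {3::nat}"
    by auto
  show ?thesis
    unfolding 4
    unfolding sum_over_permutations_insert[OF f(1,2)]
    unfolding sum_over_permutations_insert[OF f(3,4)]
    unfolding sum_over_permutations_insert[OF f(5,6)]
    unfolding permutes_sing by simp
qed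

text \<open>There are three ways to split four vectors into two pairs, and each accounts for eight
  equal terms of the sum; division by \<open>fact 2 * fact 2\<close> leaves the factor two.\<close>

lemma wedge_2_2_self:
  fixes \<alpha> :: "'e list \<Rightarrow> real"
  assumes skew: "\<And>u v. \<alpha> [u, v] = - \<alpha> [v, u]"
  shows "wedge 2 2 \<alpha> \<alpha> [a, b, c, d] = 2 * (\<alpha> [a, b] * \<alpha> [c, d] - \<alpha> [a, c] * \<alpha> [b, d] + \<alpha> [a, d] * \<alpha> [b, c])"
proof -
  have m: "map (\<lambda>i. [a, b, c, d] ! \<pi> i) [0..<2] = [[a, b, c, d] ! \<pi> 0, [a, b, c, d] ! \<pi> 1]"
    "map (\<lambda>i. [a, b, c, d] ! \<pi> i) [2..<2 + 2] = [[a, b, c, d] ! \<pi> 2, [a, b, c, d] ! \<pi> 3]" for \<pi>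
    by (simp_all add: upt_rec numeral_eq_Suc)
  have four: "(2::nat) + 2 = 4" by simp
  show ?thesis
    unfolding wedge_def m
    unfolding four permutes_4_sum
    by (simp add: sign_swap_id permutation_swap_id permutation_compose sign_compose sign_id
        Transposition.transpose_def numeral_eq_Suc skew[of b a] skew[of c a] skew[of d a] skew[of c b] skew[of d b] skew[of d c]
        field_simps)
qed

lemma ext_deriv_3:
  "ext_deriv \<omega> x [a, b, c] = frechet_derivative (\<lambda>y. \<omega> y [b, c]) (at x) a
    - frechet_derivative (\<lambda>y. \<omega> y [a, c]) (at x) b + frechet_derivative (\<lambda>y. \<omega> y [a, b]) (at x) c"
  by (simp add: ext_deriv_def numeral_eq_Suc lessThan_Suc)

lemma ext_deriv_4:
  "ext_deriv \<omega> x [a, b, c, d] = frechet_derivative (\<lambda>y. \<omega> y [b, c, d]) (at x) a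
    - frechet_derivative (\<lambda>y. \<omega> y [a, c, d]) (at x) b + frechet_derivative (\<lambda>y. \<omega> y [a, b, d]) (at x) c
    - frechet_derivative (\<lambda>y. \<omega> y [a, b, c]) (at x) d"
  by (simp add: ext_deriv_def numeral_eq_Suc lessThan_Suc)

text \<open>Polarization: \<open>alternating\<close> only asks for zero on repeated arguments, and
  the sign rule follows by expanding a repeated sum.\<close>

lemma alternating_swap3:
  fixes \<alpha> :: "'e::real_vector list \<Rightarrow> 'b::real_vector"
  assumes "multilin 3 \<alpha>" "alternating 3 \<alpha>"
  shows "\<alpha> [v, u, w] = - \<alpha> [u, v, w]" "\<alpha> [u, w, v] = - \<alpha> [u, v, w]" "\<alpha> [u, u, w] = 0" "\<alpha> [u, w, w] = 0"
proof -
  note lin = multilin_linear3[OF assms(1)]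
  have z1: "\<alpha> [u, u, w] = 0" and z2: "\<alpha> [u, w, w] = 0" for u w
    using assms(2) by (auto simp: alternating_def)
  show "\<alpha> [u, u, w] = 0" "\<alpha> [u, w, w] = 0" by (rule z1 z2)+
  have "\<alpha> [u + v, u + v, w] = \<alpha> [u, u, w] + \<alpha> [u, v, w] + (\<alpha> [v, u, w] + \<alpha> [v, v, w])"
    by (simp only: linear_add[OF lin(1)] linear_add[OF lin(2)] add_ac)
  then have "\<alpha> [u + v, u + v, w] = \<alpha> [u, v, w] + \<alpha> [v, u, w]" by (simp only: z1 add_0_left add_0_right)
  then show "\<alpha> [v, u, w] = - \<alpha> [u, v, w]" using z1[of "u + v" w] by (simp add: eq_neg_iff_add_eq_0 add.commute)
  have "\<alpha> [u, v + w, v + w] = \<alpha> [u, v, v] + \<alpha> [u, v, w] + (\<alpha> [u, w, v] + \<alpha> [u, w, w])"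
    by (simp only: linear_add[OF lin(2)] linear_add[OF lin(3)] add_ac)
  then have "\<alpha> [u, v + w, v + w] = \<alpha> [u, v, w] + \<alpha> [u, w, v]" by (simp only: z2 add_0_left add_0_right)
  then show "\<alpha> [u, w, v] = - \<alpha> [u, v, w]" using z2[of u "v + w"] by (simp add: eq_neg_iff_add_eq_0 add.commute)
qed

locale nearly_kaehler_torus = real_torus_action_mfd X A act
  for X :: "'p topology" and A :: "('p, real ^ 6) chart set" and act +
  fixes g :: "('p, real ^ 6, real) tensor" and J :: "('p, real ^ 6) endo"
    and \<Psi> :: "('p, real ^ 6, complex) tensor" and \<xi> \<eta> :: "real \<times> real"
  assumes compact: "compact_space X" and connected: "connected_space X"
    and nk: "nearly_kaehler A g J \<Psi>"
    and invariant: "\<And>t. t \<in> carrier torus \<Longrightarrow>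
           preserves_tensor A (act t) 2 g \<and> preserves_endo A (act t) J \<and>
           preserves_tensor A (act t) 3 (re_part \<Psi>) \<and> preserves_tensor A (act t) 3 (im_part \<Psi>)"
    and indep: "\<xi> \<noteq> \<eta>" "independent {\<xi>, \<eta>}"
begin

definition U :: "('p, real ^ 6) vfield" where "U = generating_field act \<xi>"
definition V :: "('p, real ^ 6) vfield" where "V = generating_field act \<eta>"
definition \<sigma> :: "('p, real ^ 6, real) tensor" where "\<sigma> = fund_form g J"
definition \<nu> :: "'p \<Rightarrow> real" where "\<nu> = multi_moment A \<sigma> U V"

lemma su3: "su3_structure A g J \<Psi>"
  and d_fund: "c \<in> A \<Longrightarrow> x \<in> chart_image c \<Longrightarrow> ext_deriv (\<sigma> c) x [u, v, w] = 3 * Re (\<Psi> c x [u, v, w])"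
  and d_im: "c \<in> A \<Longrightarrow> x \<in> chart_image c \<Longrightarrow>
    ext_deriv (im_part \<Psi> c) x [a, u, v, w] = - 2 * wedge 2 2 (\<sigma> c x) (\<sigma> c x) [a, u, v, w]"
  using nk by (auto simp: nearly_kaehler_def \<sigma>_def re_part_def)

lemma metric: "tensor_field A 2 g"
  and metric_sym: "c \<in> A \<Longrightarrow> x \<in> chart_image c \<Longrightarrow> g c x [v, w] = g c x [w, v]"
  and metric_pos: "c \<in> A \<Longrightarrow> x \<in> chart_image c \<Longrightarrow> v \<noteq> 0 \<Longrightarrow> g c x [v, v] > 0"
  and J_almost_complex: "almost_complex A J"
  and J_isometric: "c \<in> A \<Longrightarrow> x \<in> chart_image c \<Longrightarrow> g c x [J c x v, J c x w] = g c x [v, w]"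
  and volume_form: "diff_form A 3 \<Psi>"
  and volume_J: "c \<in> A \<Longrightarrow> x \<in> chart_image c \<Longrightarrow> \<Psi> c x [J c x u, v, w] = \<i> * \<Psi> c x [u, v, w]"
  using su3 by (auto simp: su3_structure_def riemannian_metric_def)

lemma J_endo: "endo_field A J"
  and JJ: "c \<in> A \<Longrightarrow> x \<in> chart_image c \<Longrightarrow> J c x (J c x v) = - v"
  using J_almost_complex by (auto simp: almost_complex_def)

lemma J_linear: "c \<in> A \<Longrightarrow> x \<in> chart_image c \<Longrightarrow> linear (J c x)"
  using J_endo by (auto simp: endo_field_def)

lemma volume_tensor: "tensor_field A 3 \<Psi>"
  using volume_form by (simp add: diff_form_def)

lemma volume_alternating:
  assumes "c \<in> A" "x \<in> chart_image c"
  shows "multilin 3 (\<Psi> c x)" "alternating 3 (\<Psi> c x)"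
  using volume_form assms by (auto simp: diff_form_def tensor_field_def)

lemma fund_eq: "\<sigma> c x [v, w] = g c x [J c x v, w]"
  by (simp add: \<sigma>_def fund_form_def)

lemma fund_skew:
  assumes c: "c \<in> A" "x \<in> chart_image c" shows "\<sigma> c x [v, w] = - \<sigma> c x [w, v]"
proof -
  have "g c x [J c x v, w] = g c x [J c x (J c x v), J c x w]" using J_isometric[OF c] by simp
  also have "\<dots> = g c x [- v, J c x w]" by (simp add: JJ[OF c])
  also have "\<dots> = - g c x [v, J c x w]" by (rule linear_neg[OF tensor_field_linear2(1)[OF metric c]])
  also have "\<dots> = - g c x [J c x w, v]" using metric_sym[OF c] by simp
  finally show ?thesis by (simp add: fund_eq)
qed

text \<open>With \<open>F\<close> the identity this is the transformation law of
  \<open>\<sigma>\<close>, with \<open>F = act t\<close> its invariance.\<close>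

lemma preserves_fund:
  assumes T: "preserves_tensor A F 2 g" and E: "preserves_endo A F J"
  shows "preserves_tensor A F 2 \<sigma>"
  unfolding preserves_tensor_def
proof (intro ballI allI impI)
  fix c c' x and vs :: "(real ^ 6) list"
  assume c: "c \<in> A" "c' \<in> A" "x \<in> coord_dom c c' F" and "length vs = 2"
  then obtain u v where vs: "vs = [u, v]" by (auto simp: length_Suc_conv numeral_2_eq_2)
  let ?D = "frechet_derivative (coord_rep c c' F) (at x)"
  have "J c' (coord_rep c c' F x) (?D u) = ?D (J c x u)"
    using E c by (auto simp: preserves_endo_def)
  then show "\<sigma> c' (coord_rep c c' F x) (map ?D vs) = \<sigma> c x vs"
    using T[unfolded preserves_tensor_def, rule_format, OF c, of "[J c x u, v]"]
    by (simp add: vs fund_eq)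
qed

lemma fund_tensor: "tensor_field A 2 \<sigma>"
proof -
  have lin: "linear (\<lambda>v. \<sigma> c x [v, w])" "linear (\<lambda>w. \<sigma> c x [v, w])"
    if c: "c \<in> A" "x \<in> chart_image c" for c x v w
    using linear_compose[OF J_linear[OF c] tensor_field_linear2(1)[OF metric c]]
      tensor_field_linear2(2)[OF metric c] by (simp_all add: fund_eq o_def)
  have "multilin 2 (\<sigma> c x)" if c: "c \<in> A" "x \<in> chart_image c" for c x
    unfolding multilin_def
  proof (intro allI impI)
    fix vs :: "(real ^ 6) list" and i :: nat assume "length vs = 2" "i < 2"
    then show "linear (\<lambda>v. \<sigma> c x (vs[i := v]))"
      using lin[OF c] by (auto simp: length_Suc_conv numeral_2_eq_2 less_Suc_eq)
  qed
  moreover have "smooth_on (chart_image c) (\<lambda>x. \<sigma> c x vs)" if c: "c \<in> A" and "length vs = 2" for c vs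
  proof -
    obtain u v where vs: "vs = [u, v]" using \<open>length vs = 2\<close> by (auto simp: length_Suc_conv numeral_2_eq_2)
    have "smooth_on (chart_image c) (\<lambda>x. g c x [J c x u, v])"
      by (rule smooth_on_linear_field[where T = "\<lambda>x w. g c x [w, v]", OF chart_image_open[OF c]])
        (use metric J_endo c tensor_field_linear2(1)[OF metric c] in \<open>auto simp: tensor_field_def endo_field_def\<close>)
    then show ?thesis by (simp add: vs fund_eq)
  qed
  moreover have "preserves_tensor A id 2 \<sigma>"
    using metric J_endo by (intro preserves_fund) (auto simp: tensor_field_def endo_field_def)
  ultimately show ?thesis by (simp add: tensor_field_def)
qed

lemma fund_invariant: "t \<in> carrier torus \<Longrightarrow> preserves_tensor A (act t) 2 \<sigma>"
  using invariant preserves_fund by blast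

lemma im_tensor: "tensor_field A 3 (im_part \<Psi>)"
  using tensor_field_bounded_linear[OF volume_tensor bounded_linear_Im chart_image_open]
  by (simp add: im_part_def[abs_def])

lemma volume_J3:
  assumes c: "c \<in> A" "x \<in> chart_image c"
  shows "\<Psi> c x [u, J c x v, w] = \<i> * \<Psi> c x [u, v, w]" "\<Psi> c x [u, v, J c x w] = \<i> * \<Psi> c x [u, v, w]"
proof -
  note sw = alternating_swap3[OF volume_alternating[OF c]]
  show *: "\<Psi> c x [u, J c x v, w] = \<i> * \<Psi> c x [u, v, w]" for v w
    using sw(1)[of u "J c x v" w] sw(1)[of u v w] volume_J[OF c] by simp
  show "\<Psi> c x [u, v, J c x w] = \<i> * \<Psi> c x [u, v, w]"
    using sw(2)[of u "J c x w" v] sw(2)[of u w v] *[of w v] by simp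
qed

text \<open>Replacing \<open>w\<close> by \<open>J w\<close> multiplies the value by the imaginary
  unit, so the real parts also determine the imaginary ones. At critical points of
  \<open>\<nu>\<close> this transfers the vanishing from \<open>\<psi>\<^sub>+\<close> to
  \<open>\<psi>\<^sub>-\<close>.\<close>

lemma volume_eq_0_if_re_eq_0:
  assumes c: "c \<in> A" "x \<in> chart_image c" and "\<And>w. Re (\<Psi> c x [u, v, w]) = 0"
  shows "\<Psi> c x [u, v, w] = 0"
  using assms(3)[of w] assms(3)[of "J c x w"] volume_J3(2)[OF c, of u v w] by (simp add: complex_eq_iff)

text \<open>Removes the choice of a chart from \<open>multi_moment\<close>, by the transformation
  laws of \<open>\<sigma>\<close> and of the generating fields.\<close>

lemma \<nu>_chart:
  assumes c: "c \<in> A" "p \<in> fst c" shows "\<nu> p = \<sigma> c (snd c p) [U c (snd c p), V c (snd c p)]"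
proof -
  define c' where "c' = (SOME c. c \<in> A \<and> p \<in> fst c)"
  have c': "c' \<in> A" "p \<in> fst c'" using someI[of "\<lambda>c. c \<in> A \<and> p \<in> fst c" c] c by (auto simp: c'_def)
  have "snd c p \<in> coord_dom c c' id" using c c' chart_inv_chart[OF c] by (simp add: coord_dom_def chart_in_image)
  moreover have "coord_rep c c' id (snd c p) = snd c' p" using chart_inv_chart[OF c] by (simp add: coord_rep_def)
  ultimately have "\<sigma> c' (snd c' p) [U c' (snd c' p), V c' (snd c' p)] = \<sigma> c (snd c p) [U c (snd c p), V c (snd c p)]"
    using fund_tensor[unfolded tensor_field_def preserves_tensor_def, THEN conjunct2, rule_format, OF c(1) c'(1),
        of "snd c p" "[U c (snd c p), V c (snd c p)]"]
      generating_field_chart[OF c c', of \<xi>] generating_field_chart[OF c c', of \<eta>]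
    by (simp add: U_def V_def)
  then show ?thesis by (simp add: \<nu>_def multi_moment_def c'_def Let_def)
qed

lemma \<nu>_chart_inv:
  assumes "c \<in> A" "x \<in> chart_image c" shows "\<nu> (chart_inv c x) = \<sigma> c x [U c x, V c x]"
  using \<nu>_chart[OF assms(1) chart_inv_in[OF assms(2)]] by (simp add: chart_chart_inv[OF assms(2)])

lemma smooth_U: "c \<in> A \<Longrightarrow> smooth_on (chart_image c) (U c)"
  and smooth_V: "c \<in> A \<Longrightarrow> smooth_on (chart_image c) (V c)"
  by (simp_all add: U_def V_def smooth_generating_field)

lemma smooth_\<nu>: "smooth_to X A (topspace X) \<nu>"
  unfolding smooth_to_def
proof (intro conjI ballI)
  fix c assume c: "c \<in> A"
  note I = chart_image_open[OF c]
  have sm: "smooth_on (chart_image c) (\<lambda>x. \<sigma> c x [u, v])" for u v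
    using fund_tensor c by (simp add: tensor_field_def)
  have *: "smooth_on (chart_image c) (\<lambda>x. \<sigma> c x [u, V c x])" for u
    by (rule smooth_on_linear_field[where T = "\<lambda>x w. \<sigma> c x [u, w]",
          OF I tensor_field_linear2(2)[OF fund_tensor c] sm smooth_V[OF c]])
  have "smooth_on (chart_image c) (\<lambda>x. \<sigma> c x [U c x, V c x])"
    by (rule smooth_on_linear_field[where T = "\<lambda>x w. \<sigma> c x [w, V c x]",
          OF I tensor_field_linear2(1)[OF fund_tensor c] * smooth_U[OF c]])
  then have "smooth_on (chart_image c) (\<lambda>x. \<nu> (chart_inv c x))"
    by (rule smooth_on_eqI[OF I]) (rule \<nu>_chart_inv[OF c])
  then show "smooth_on {x \<in> chart_image c. chart_inv c x \<in> topspace X} (\<lambda>x. \<nu> (chart_inv c x))"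
    by (rule smooth_on_subset) auto
qed simp

lemma \<nu>_chart_derivative:
  assumes c: "c \<in> A" "x \<in> chart_image c"
  shows "((\<lambda>x. \<nu> (chart_inv c x)) has_derivative frechet_derivative (\<lambda>x. \<nu> (chart_inv c x)) (at x)) (at x)"
  by (rule smooth_on_has_derivative[OF smooth_toD(2)[OF smooth_\<nu> c(1)]])
    (use c chart_inv_topspace[OF c] in simp)

lemma \<nu>_act: assumes t: "t \<in> carrier torus" and p: "p \<in> topspace X" shows "\<nu> (act t p) = \<nu> p"
proof -
  obtain c where c: "c \<in> A" "p \<in> fst c" using ex_chart p by blast
  obtain c' where c': "c' \<in> A" "act t p \<in> fst c'" using ex_chart act_topspace[OF t p] by blast
  have "snd c p \<in> coord_dom c c' (act t)" using c c' chart_inv_chart[OF c] by (simp add: coord_dom_def chart_in_image)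
  moreover have "coord_rep c c' (act t) (snd c p) = snd c' (act t p)"
    using chart_inv_chart[OF c] by (simp add: coord_rep_def)
  ultimately show ?thesis
    using fund_invariant[OF t, unfolded preserves_tensor_def, rule_format, OF c(1) c'(1),
        of "snd c p" "[U c (snd c p), V c (snd c p)]"]
      generating_field_act[OF c c' t, of \<xi>] generating_field_act[OF c c' t, of \<eta>]
    by (simp add: U_def V_def \<nu>_chart[OF c] \<nu>_chart[OF c'])
qed

text \<open>Cartan's formula, applied twice: the Lie derivatives of \<open>\<sigma>\<close> along \<open>U\<close> and \<open>V\<close> vanish and the
  two fields commute.\<close>

lemma d\<nu>:
  assumes c: "c \<in> A" "x \<in> chart_image c"
  shows "frechet_derivative (\<lambda>x. \<nu> (chart_inv c x)) (at x) w = 3 * Re (\<Psi> c x [U c x, V c x, w])"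
proof -
  let ?u = "U c x" and ?v = "V c x"
  let ?D = "\<lambda>a b. frechet_derivative (\<lambda>y. \<sigma> c y [a, b]) (at x)"
  let ?DU = "frechet_derivative (U c) (at x)" and ?DV = "frechet_derivative (V c) (at x)"
  note I = chart_image_open[OF c(1)]
  note lie = lie_derivative_tensor2[OF fund_tensor fund_invariant c]
  have "((\<lambda>y. \<sigma> c y [U c y, V c y]) has_derivative
     (\<lambda>w. ?D ?u ?v w + \<sigma> c x [?u, ?DV w] + \<sigma> c x [?DU w, ?v])) (at x)"
    by (rule has_derivative_bilinear_field[where T = "\<lambda>y u v. \<sigma> c y [u, v]", OF I c(2)])
      (use tensor_field_linear2[OF fund_tensor c(1)] tensor_field_derivative[OF fund_tensor c]
        generating_field_derivative[OF c] in \<open>simp_all add: U_def V_def\<close>)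
  then have "((\<lambda>y. \<nu> (chart_inv c y)) has_derivative
     (\<lambda>w. ?D ?u ?v w + \<sigma> c x [?u, ?DV w] + \<sigma> c x [?DU w, ?v])) (at x)"
    by (rule has_derivative_transform_within_open[OF _ I c(2)]) (simp add: \<nu>_chart_inv[OF c(1)])
  from frechet_derivative_at[OF this, symmetric]
  have d: "frechet_derivative (\<lambda>x. \<nu> (chart_inv c x)) (at x) w = ?D ?u ?v w + \<sigma> c x [?u, ?DV w] + \<sigma> c x [?DU w, ?v]"
    by simp
  \<comment> \<open>The Lie derivatives replace the derivatives of \<open>\<sigma>\<close> along
    \<open>U\<close> and \<open>V\<close> in the exterior derivative; commutation of the fields
    cancels the bracket terms.\<close>
  have "?D ?v w ?u + \<sigma> c x [?v, ?DU w] + \<sigma> c x [?DU ?v, w] = 0"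
    using lie[of ?v w \<xi>] by (simp add: U_def)
  moreover have "?D ?u w ?v + \<sigma> c x [?u, ?DV w] + \<sigma> c x [?DV ?u, w] = 0"
    using lie[of ?u w \<eta>] by (simp add: V_def)
  moreover have "?DU ?v = ?DV ?u" using generating_fields_commute[OF c, of \<xi> \<eta>] by (simp add: U_def V_def)
  moreover have "\<sigma> c x [?DU w, ?v] = - \<sigma> c x [?v, ?DU w]" by (rule fund_skew[OF c])
  moreover have "?D ?v w ?u - ?D ?u w ?v + ?D ?u ?v w = 3 * Re (\<Psi> c x [?u, ?v, w])"
    using d_fund[OF c, of ?u ?v w] by (simp add: ext_deriv_3)
  ultimately show ?thesis unfolding d by simp
qed

lemma critical_iff:
  assumes c: "c \<in> A" "x \<in> chart_image c"
  shows "frechet_derivative (\<lambda>x. \<nu> (chart_inv c x)) (at x) = (\<lambda>v. 0) \<longleftrightarrow> (\<forall>w. \<Psi> c x [U c x, V c x, w] = 0)"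
proof
  assume "frechet_derivative (\<lambda>x. \<nu> (chart_inv c x)) (at x) = (\<lambda>v. 0)"
  then have "Re (\<Psi> c x [U c x, V c x, w]) = 0" for w using d\<nu>[OF c, of w] by simp
  then show "\<forall>w. \<Psi> c x [U c x, V c x, w] = 0" using volume_eq_0_if_re_eq_0[OF c] by blast
qed (simp add: d\<nu>[OF c] fun_eq_iff)

text \<open>The identity \<open>\<nu> \<sigma> = \<iota>\<^sub>U \<sigma> \<and> \<iota>\<^sub>V \<sigma>\<close> arises by contracting the second structure equation
  with \<open>U\<close> and \<open>V\<close>: if \<open>\<psi>\<^sub>- (U, V, \<cdot>)\<close> is zero, Cartan's formula makes the left side vanish.\<close>

lemma fund_identity_if_all_critical:
  assumes crit: "\<And>y w. y \<in> chart_image c \<Longrightarrow> \<Psi> c y [U c y, V c y, w] = 0"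
    and c: "c \<in> A" "x \<in> chart_image c"
  shows "\<sigma> c x [U c x, V c x] * \<sigma> c x [w, z] = \<sigma> c x [U c x, w] * \<sigma> c x [V c x, z] - \<sigma> c x [U c x, z] * \<sigma> c x [V c x, w]"
proof -
  let ?u = "U c x" and ?v = "V c x"
  let ?P = "\<lambda>a b c'. im_part \<Psi> c x [a, b, c']"
  let ?D = "\<lambda>a b c'. frechet_derivative (\<lambda>y. im_part \<Psi> c y [a, b, c']) (at x)"
  let ?DU = "frechet_derivative (U c) (at x)" and ?DV = "frechet_derivative (V c) (at x)"
  note I = chart_image_open[OF c(1)]
  have "preserves_tensor A (act t) 3 (im_part \<Psi>)" if "t \<in> carrier torus" for t
    using invariant[OF that] by blast
  note lie = lie_derivative_tensor3[OF im_tensor this c]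
  note sw = alternating_swap3[OF volume_alternating[OF c]]
  have sw1: "?P v u w = - ?P u v w" and sw2: "?P u w v = - ?P u v w" for u v w
    using sw(1)[of v u w] sw(2)[of u w v] by (simp_all add: im_part_def)
  \<comment> \<open>The function \<open>\<psi>\<^sub>- (U, V, z)\<close> vanishes on the whole
    chart, so its derivative does too. This supplies the two terms of the exterior derivative in
    directions other than \<open>U\<close> and \<open>V\<close>.\<close>
  have D0: "?D ?u ?v z w + ?P ?u (?DV w) z + ?P (?DU w) ?v z = 0" for w z
  proof -
    have "((\<lambda>y. im_part \<Psi> c y [U c y, V c y, z]) has_derivative
       (\<lambda>w. ?D ?u ?v z w + ?P ?u (?DV w) z + ?P (?DU w) ?v z)) (at x)"
      by (rule has_derivative_bilinear_field[where T = "\<lambda>y u v. im_part \<Psi> c y [u, v, z]", OF I c(2)])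
        (use tensor_field_linear3[OF im_tensor c(1)] tensor_field_derivative[OF im_tensor c]
          generating_field_derivative[OF c] in \<open>simp_all add: U_def V_def\<close>)
    moreover have "((\<lambda>y. im_part \<Psi> c y [U c y, V c y, z]) has_derivative (\<lambda>w. 0)) (at x)"
      by (rule has_derivative_transform_within_open[OF has_derivative_const I c(2), of 0])
        (simp add: im_part_def crit)
    ultimately have "(\<lambda>w. ?D ?u ?v z w + ?P ?u (?DV w) z + ?P (?DU w) ?v z) = (\<lambda>w. 0)"
      by (rule has_derivative_unique)
    then show ?thesis by (rule fun_cong)
  qed
  have "?D ?v w z ?u + ?P ?v w (?DU z) + ?P ?v (?DU w) z + ?P (?DU ?v) w z = 0"
    using lie[of ?v w z \<xi>] by (simp add: U_def)
  moreover have "?D ?u w z ?v + ?P ?u w (?DV z) + ?P ?u (?DV w) z + ?P (?DV ?u) w z = 0"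
    using lie[of ?u w z \<eta>] by (simp add: V_def)
  moreover have "?DU ?v = ?DV ?u" using generating_fields_commute[OF c, of \<xi> \<eta>] by (simp add: U_def V_def)
  moreover have "?P ?v w (?DU z) = ?P (?DU z) ?v w" "?P ?v (?DU w) z = - ?P (?DU w) ?v z"
    "?P ?u w (?DV z) = - ?P ?u (?DV z) w"
    using sw1[of ?v "?DU z" w] sw2[of ?v w "?DU z"] sw1[of ?v "?DU w" z] sw2[of ?u w "?DV z"] by simp_all
  ultimately have "?D ?v w z ?u - ?D ?u w z ?v + ?D ?u ?v z w - ?D ?u ?v w z = 0"
    using D0[of w z] D0[of z w] by simp
  then have "ext_deriv (im_part \<Psi> c) x [?u, ?v, w, z] = 0" by (simp add: ext_deriv_4)
  then have "wedge 2 2 (\<sigma> c x) (\<sigma> c x) [?u, ?v, w, z] = 0" using d_im[OF c] by simp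
  then show ?thesis using wedge_2_2_self[of "\<sigma> c x", OF fund_skew[OF c], of ?u ?v w z] by simp
qed

lemma ex_regular_point: "\<exists>c\<in>A. \<exists>x\<in>chart_image c. frechet_derivative (\<lambda>x. \<nu> (chart_inv c x)) (at x) \<noteq> (\<lambda>v. 0)"
proof (rule ccontr)
  assume not: "\<not> ?thesis"
  obtain c x where c: "c \<in> A" "x \<in> chart_image c"
    and ind: "\<And>\<alpha> \<beta>. \<alpha> *\<^sub>R U c x + \<beta> *\<^sub>R V c x = 0 \<Longrightarrow> \<alpha> = 0 \<and> \<beta> = 0"
    using generating_fields_independent_somewhere[OF connected J_almost_complex _ indep] invariant
    unfolding U_def V_def by blast
  have "\<Psi> c y [U c y, V c y, w] = 0" if "y \<in> chart_image c" for y w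
    using not c(1) that critical_iff[OF c(1) that] by blast
  note id = fund_identity_if_all_critical[OF this c]
  note lin = tensor_field_linear2[OF fund_tensor c]
  let ?u = "U c x" and ?v = "V c x"
  have pos: "\<sigma> c x [w, J c x w] > 0" if "w \<noteq> 0" for w
    using that metric_pos[OF c that] by (simp add: fund_eq J_isometric[OF c])
  \<comment> \<open>Two linear forms on a six-dimensional space have a common zero \<open>w\<close>.
    The identity at \<open>w\<close> and \<open>J w\<close> has zero right side, while
    \<open>\<sigma> (w, J w)\<close> is positive, so \<open>\<nu>\<close> vanishes.\<close>
  define L where "L w = (\<sigma> c x [?u, w], \<sigma> c x [?v, w])" for w
  have L: "linear L" unfolding L_def by (intro linearI) (simp_all add: linear_add[OF lin(2)] linear_scale[OF lin(2)])
  have "\<not> inj L"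
  proof
    assume "inj L"
    then have "dim (range L) = dim (UNIV :: (real ^ 6) set)" using dim_image_eq[OF L] by simp
    moreover have "dim (range L) \<le> DIM(real \<times> real)" by (rule dim_subset_UNIV)
    ultimately show False by simp
  qed
  then have "\<exists>w. L w = 0 \<and> w \<noteq> 0" unfolding linear_injective_0[OF L] by simp
  then obtain w where w: "w \<noteq> 0" "L w = 0" by auto
  have "\<sigma> c x [?u, ?v] * \<sigma> c x [w, J c x w] = 0"
    using id[of w "J c x w"] w(2) by (simp add: L_def zero_prod_def)
  then have \<nu>0: "\<sigma> c x [?u, ?v] = 0" using pos[OF w(1)] by simp
  have u: "?u \<noteq> 0" using ind[of 1 0] by auto
  \<comment> \<open>With \<open>\<nu> = 0\<close> the identity at \<open>J U\<close> says that
    \<open>\<sigma>\<close> annihilates this combination. Nondegeneracy makes it zero, and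
    independence then forces \<open>\<sigma> (U, J U) = 0\<close>, which is impossible.\<close>
  let ?y = "\<sigma> c x [?u, J c x ?u] *\<^sub>R ?v + (- \<sigma> c x [?v, J c x ?u]) *\<^sub>R ?u"
  have "\<sigma> c x [?y, z] = 0" for z
    using id[of "J c x ?u" z] \<nu>0 by (simp add: linear_add[OF lin(1)] linear_diff[OF lin(1)] linear_scale[OF lin(1)] linear_neg[OF lin(1)])
  then have "?y = 0" using pos[of ?y] by fastforce
  then have "\<sigma> c x [?u, J c x ?u] = 0"
    using ind[of "- \<sigma> c x [?v, J c x ?u]" "\<sigma> c x [?u, J c x ?u]"] by (simp add: add.commute)
  then show False using pos[OF u] by simp
qed

end

section \<open>Regular values and free orbits\<close>

lemma (in smooth_mfd) smooth_to_open_preimage: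
  assumes \<phi>: "smooth_to X A Q \<phi>" and W: "open W" shows "openin X {p \<in> Q. \<phi> p \<in> W}"
proof (subst openin_subopen, intro ballI)
  fix p assume p: "p \<in> {p \<in> Q. \<phi> p \<in> W}"
  have "Q \<subseteq> topspace X" using \<phi> openin_subset by (auto simp: smooth_to_def)
  then obtain c where c: "c \<in> A" "p \<in> fst c" using p ex_chart by blast
  let ?I = "{x \<in> chart_image c. chart_inv c x \<in> Q}"
  let ?T = "?I \<inter> (\<lambda>x. \<phi> (chart_inv c x)) -` W"
  have "open ?T"
    by (rule continuous_open_preimage[OF smooth_on_continuous_on[OF smooth_toD(2)[OF \<phi> c(1)]] smooth_toD(1)[OF \<phi> c(1)] W])
  then have "openin X {q \<in> fst c. snd c q \<in> ?T}" by (rule openin_chart_preimage[OF c(1)])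
  moreover have "p \<in> {q \<in> fst c. snd c q \<in> ?T}" using p c chart_inv_chart[OF c] by (simp add: chart_in_image)
  moreover have "{q \<in> fst c. snd c q \<in> ?T} \<subseteq> {p \<in> Q. \<phi> p \<in> W}" using chart_inv_chart[OF c(1)] by auto
  ultimately show "\<exists>T. openin X T \<and> p \<in> T \<and> T \<subseteq> {p \<in> Q. \<phi> p \<in> W}" by blast
qed

text \<open>The displacement \<open>L z - z\<close> is orthogonal to every vector fixed by
  \<open>L\<close>, in particular to the complex span of \<open>u\<close> and \<open>v\<close>. As
  \<open>L\<close> preserves \<open>P\<close>, the displacement has no component along
  \<open>w\<close>, so it lies in that span and is orthogonal to itself.\<close>

lemma rotation_fixing_complex_independent_pair:
  fixes G :: "'e::euclidean_space \<Rightarrow> 'e \<Rightarrow> real" and P :: "'e \<Rightarrow> 'e \<Rightarrow> 'e \<Rightarrow> complex"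
  assumes dim: "DIM('e) = 6"
    and G: "\<And>w. linear (\<lambda>v. G v w)" "\<And>v. linear (\<lambda>w. G v w)" "\<And>v. v \<noteq> 0 \<Longrightarrow> G v v > 0"
    and P: "\<And>v w. linear (\<lambda>u. P u v w)" "\<And>u w. linear (\<lambda>v. P u v w)" "\<And>u v. linear (\<lambda>w. P u v w)"
    and alt: "\<And>u w. P u u w = 0" "\<And>u w. P u w w = 0" "\<And>u w. P u w u = 0"
    and PJ: "\<And>u v w. P (J u) v w = \<i> * P u v w" "\<And>u v w. P u (J v) w = \<i> * P u v w"
      "\<And>u v w. P u v (J w) = \<i> * P u v w"
    and L: "linear L" "\<And>v. L (J v) = J (L v)" "\<And>v w. G (L v) (L w) = G v w"
      "\<And>u v w. P (L u) (L v) (L w) = P u v w"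
    and fixed: "L u = u" "L v = v" and nz: "P u v w \<noteq> 0"
  shows "L z = z"
proof -
  \<comment> \<open>Complex coordinates with respect to \<open>u\<close>, \<open>v\<close>,
    \<open>w\<close>. The form \<open>P\<close> recovers each of them, so \<open>M\<close> is
    injective, and onto because both dimensions are six.\<close>
  define M where "M = (\<lambda>(a, b, c). Re a *\<^sub>R u + Im a *\<^sub>R J u + Re b *\<^sub>R v + Im b *\<^sub>R J v + Re c *\<^sub>R w + Im c *\<^sub>R J w)"
  have Mlin: "linear M" by (rule linearI) (auto simp: M_def scaleR_add_left scaleR_add_right)
  have cx: "Re a *\<^sub>R z + Im a *\<^sub>R (\<i> * z) = a * z" for a z
    by (simp add: complex_eq_iff algebra_simps)
  have PM: "P (M (a, b, c)) v w = a * P u v w" "P u (M (a, b, c)) w = b * P u v w" "P u v (M (a, b, c)) = c * P u v w"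
    for a b c
    by (simp_all add: M_def linear_add[OF P(1)] linear_scale[OF P(1)] linear_add[OF P(2)] linear_scale[OF P(2)]
        linear_add[OF P(3)] linear_scale[OF P(3)] alt PJ cx)
  have "inj M"
    unfolding linear_injective_0[OF Mlin]
  proof (intro allI impI)
    fix z assume z: "M z = 0"
    obtain a b c where abc: "z = (a, b, c)" by (cases z)
    show "z = 0"
      using PM[of a b c] nz z unfolding abc by (simp add: linear_0[OF P(1)] linear_0[OF P(2)] linear_0[OF P(3)] zero_prod_def)
  qed
  then have "dim (range M) = 6" using dim_image_eq[OF Mlin, of UNIV] by simp
  then have "span (range M) = UNIV" using dim dim_eq_full by metis
  moreover have "subspace (range M)" using linear_subspace_image[OF Mlin subspace_UNIV] .
  ultimately have surj: "range M = UNIV" by (metis span_eq_iff)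
  define d where "d = L z - z"
  obtain a b c where abc: "d = M (a, b, c)" using surj by (metis rangeE UNIV_I prod_cases3)
  have "P u v (L z) = P u v z" using L(4)[of u v z] fixed by simp
  then have "P u v d = 0" by (simp add: d_def linear_diff[OF P(3)])
  then have "c * P u v w = 0" using PM(3)[of a b c] abc by simp
  then have c: "c = 0" using nz by simp
  have perp: "G d q = 0" if "L q = q" for q
    using L(3)[of z q] that by (simp add: d_def linear_diff[OF G(1)])
  have "L (J u) = J u" "L (J v) = J v" using L(2) fixed by simp_all
  then have "G d d = 0"
    using perp[of u] perp[of v] perp[of "J u"] perp[of "J v"] fixed
    by (subst (2) abc) (simp add: M_def c linear_add[OF G(2)] linear_scale[OF G(2)])
  then have "d = 0" using G(3)[of d] by fastforce
  then show ?thesis by (simp add: d_def)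
qed

context nearly_kaehler_torus
begin

text \<open>\<open>regular_value\<close> tests every chart around a point, while Sard's theorem is
  applied to finitely many charts; the chain rule mediates between them.\<close>

lemma critical_chart_independent:
  assumes c: "c \<in> A" "p \<in> fst c" and c': "c' \<in> A" "p \<in> fst c'"
    and crit: "frechet_derivative (\<lambda>x. \<nu> (chart_inv c x)) (at (snd c p)) = (\<lambda>v. 0)"
  shows "frechet_derivative (\<lambda>x. \<nu> (chart_inv c' x)) (at (snd c' p)) = (\<lambda>v. 0)"
proof -
  let ?S = "{x \<in> chart_image c'. chart_inv c' x \<in> fst c}" and ?\<tau> = "\<lambda>x. snd c (chart_inv c' x)"
  have S: "open ?S" by (rule open_chart_inv_preimage[OF c'(1) chart_open[OF c(1)]])
  have x: "snd c' p \<in> ?S" using c c' chart_inv_chart[OF c'] by (simp add: chart_in_image)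
  have "((\<lambda>x. \<nu> (chart_inv c x)) has_derivative (\<lambda>v. 0)) (at (?\<tau> (snd c' p)))"
    using \<nu>_chart_derivative[OF c(1), of "snd c p"] c chart_inv_chart[OF c'] crit by (simp add: chart_in_image)
  from has_derivative_compose[OF smooth_on_has_derivative[OF transition_smooth[OF c'(1) c(1)] x] this]
  have "((\<lambda>x. \<nu> (chart_inv c' x)) has_derivative (\<lambda>v. 0)) (at (snd c' p))"
    by (rule has_derivative_transform_within_open[OF _ S x]) (auto simp: chart_inv_chart[OF c(1)])
  then show ?thesis by (rule frechet_derivative_at[symmetric])
qed

lemma ex_nonzero_regular_value: "\<exists>s. s \<noteq> 0 \<and> regular_value X A \<nu> s"
proof -
  obtain c x0 where c: "c \<in> A" "x0 \<in> chart_image c"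
    and reg: "frechet_derivative (\<lambda>x. \<nu> (chart_inv c x)) (at x0) \<noteq> (\<lambda>v. 0)"
    using ex_regular_point by blast
  have cont: "continuous_map X euclideanreal \<nu>"
    using smooth_to_open_preimage[OF smooth_\<nu>] by (simp add: continuous_map_def)
  have conn: "connected (\<nu> ` topspace X)"
    using connectedin_continuous_map_image[OF cont, of "topspace X"] connected
    by (simp add: connectedin_topspace)
  have "\<exists>x\<in>chart_image c. \<nu> (chart_inv c x) \<noteq> \<nu> (chart_inv c x0)"
  proof (rule ccontr)
    assume "\<not> ?thesis"
    then have "((\<lambda>x. \<nu> (chart_inv c x)) has_derivative (\<lambda>v. 0)) (at x0)"
      by (intro has_derivative_transform_within_open[OF has_derivative_const chart_image_open[OF c(1)] c(2)]) auto
    then show False using frechet_derivative_at reg by metis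
  qed
  then obtain p q where pq: "p \<in> topspace X" "q \<in> topspace X" "\<nu> p < \<nu> q"
    using chart_inv_topspace[OF c(1)] c(2) by (metis linorder_neqE)
  \<comment> \<open>Compactness reduces the critical values to a finite union of negligible sets,
    one for each chart of a finite cover.\<close>
  have "fst ` A \<subseteq> {Q. openin X Q}" "topspace X \<subseteq> \<Union> (fst ` A)" using chart_open ex_chart by auto
  then obtain F' where F': "finite F'" "F' \<subseteq> fst ` A" "topspace X \<subseteq> \<Union>F'"
    using compact[unfolded compact_space_def compactin_def, THEN conjunct2, THEN spec, of "fst ` A"] by auto
  then obtain F where F: "finite F" "F \<subseteq> A" "F' = fst ` F" 
    using finite_subset_image[OF F'(1,2)] by blast
  let ?K = "\<lambda>c. (\<lambda>x. \<nu> (chart_inv c x)) ` {x \<in> chart_image c. frechet_derivative (\<lambda>x. \<nu> (chart_inv c x)) (at x) = (\<lambda>v. 0)}"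
  have "negligible (?K c)" if "c \<in> A" for c
  proof -
    have "{x \<in> chart_image c. chart_inv c x \<in> topspace X} = chart_image c"
      using chart_inv_topspace[OF that] by blast
    then show ?thesis
      using sard_real_valued[OF chart_image_open[OF that]] smooth_toD(2)[OF smooth_\<nu> that] by simp
  qed
  then have "negligible (\<Union> (?K ` F))" using F by (intro negligible_Union) auto
  \<comment> \<open>Adding the point zero to the negligible set makes the regular value found below
    nonzero.\<close>
  then have neg: "negligible (\<Union> (?K ` F) \<union> {0})" by (intro negligible_Un) auto
  have "\<not> cbox (\<nu> p) (\<nu> q) \<subseteq> \<Union> (?K ` F) \<union> {0}"
  proof
    assume "cbox (\<nu> p) (\<nu> q) \<subseteq> \<Union> (?K ` F) \<union> {0}"
    then have "negligible (cbox (\<nu> p) (\<nu> q))" using neg negligible_subset by blast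
    then have "box (\<nu> p) (\<nu> q) = {}" by (simp only: negligible_interval)
    then show False using pq(3) by (simp add: box_real)
  qed
  then obtain s where s: "s \<in> cbox (\<nu> p) (\<nu> q)" "s \<noteq> 0" "s \<notin> \<Union> (?K ` F)" by blast
  have "s \<in> \<nu> ` topspace X"
    using connected_contains_Icc[OF conn, of "\<nu> p" "\<nu> q"] pq s(1) by auto
  moreover have "frechet_derivative (\<lambda>x. \<nu> (chart_inv c x)) (at (snd c p)) \<noteq> (\<lambda>v. 0)"
    if p: "p \<in> level_set X \<nu> s" and c: "c \<in> A" "p \<in> fst c" for p c
  proof
    assume crit: "frechet_derivative (\<lambda>x. \<nu> (chart_inv c x)) (at (snd c p)) = (\<lambda>v. 0)"
    have "p \<in> topspace X" "\<nu> p = s" using p by (auto simp: level_set_def)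
    then obtain c' where c': "c' \<in> F" "p \<in> fst c'" using F F' by blast
    then have c'A: "c' \<in> A" using F by blast
    have "s \<in> ?K c'"
      using critical_chart_independent[OF c c'A c'(2) crit] \<open>\<nu> p = s\<close> chart_inv_chart[OF c'A c'(2)] c'(2)
      by (intro image_eqI[of _ _ "snd c' p"]) (simp_all add: chart_in_image)
    then show False using s(3) c'(1) by blast
  qed
  ultimately show ?thesis using s(2) unfolding regular_value_def by blast
qed

text \<open>Some \<open>w\<close> makes the volume form nonzero on \<open>U\<close>,
  \<open>V\<close>, \<open>w\<close>. Inserting a combination of \<open>U\<close> and
  \<open>V\<close> into the first or second slot isolates one of its coefficients.\<close>

lemma generating_fields_independent_at_regular_point:
  assumes c: "c \<in> A" "x \<in> chart_image c"
    and reg: "frechet_derivative (\<lambda>x. \<nu> (chart_inv c x)) (at x) \<noteq> (\<lambda>v. 0)"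
  shows "inj (\<lambda>\<zeta>. generating_field act \<zeta> c x)"
proof -
  note lin = linear_generating_field[OF c]
  note P = tensor_field_linear3[OF volume_tensor c] and sw = alternating_swap3[OF volume_alternating[OF c]]
  obtain w where w: "\<Psi> c x [U c x, V c x, w] \<noteq> 0" using reg critical_iff[OF c] by blast
  have "card {\<xi>, \<eta>} = DIM(real \<times> real)" using indep(1) by simp
  then have "span {\<xi>, \<eta>} = UNIV"
    using card_ge_dim_independent[OF subset_UNIV indep(2)] by auto
  show ?thesis
    unfolding linear_injective_0[OF lin]
  proof (intro allI impI)
    fix \<zeta> assume z: "generating_field act \<zeta> c x = 0"
    have "\<zeta> \<in> span {\<xi>, \<eta>}" using \<open>span {\<xi>, \<eta>} = UNIV\<close> by simp
    then obtain a b where ab: "\<zeta> = a *\<^sub>R \<xi> + b *\<^sub>R \<eta>"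
      by (auto simp: span_insert span_singleton algebra_simps)
    have uv: "a *\<^sub>R U c x + b *\<^sub>R V c x = 0"
      using z by (simp add: ab linear_add[OF lin] linear_scale[OF lin] U_def V_def)
    have "\<Psi> c x [a *\<^sub>R U c x + b *\<^sub>R V c x, V c x, w] = a *\<^sub>R \<Psi> c x [U c x, V c x, w]"
      by (simp add: linear_add[OF P(1)] linear_scale[OF P(1)] sw(3))
    then have a: "a = 0" using w by (simp add: uv linear_0[OF P(1)])
    have "\<Psi> c x [U c x, a *\<^sub>R U c x + b *\<^sub>R V c x, w] = b *\<^sub>R \<Psi> c x [U c x, V c x, w]"
      by (simp add: linear_add[OF P(2)] linear_scale[OF P(2)] sw(3))
    then have "b = 0" using w by (simp add: uv linear_0[OF P(2)])
    then show "\<zeta> = 0" using a ab by simp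
  qed
qed

lemma act_derivative_at_fixed_regular_point:
  assumes c: "c \<in> A" "p \<in> fst c"
    and reg: "frechet_derivative (\<lambda>x. \<nu> (chart_inv c x)) (at (snd c p)) \<noteq> (\<lambda>v. 0)"
    and t: "t \<in> carrier torus" "act t p = p"
  shows "frechet_derivative (coord_rep c c (act t)) (at (snd c p)) v = v"
proof -
  let ?x = "snd c p"
  have xI: "?x \<in> chart_image c" using c by (simp add: chart_in_image)
  note cx = c(1) xI
  let ?L = "frechet_derivative (coord_rep c c (act t)) (at ?x)"
  have xd: "?x \<in> coord_dom c c (act t)" using c t(2) chart_inv_chart[OF c] xI by (simp add: coord_dom_def)
  have Fx: "coord_rep c c (act t) ?x = ?x" using t(2) chart_inv_chart[OF c] by (simp add: coord_rep_def)
  have L: "linear ?L"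
    using smooth_on_has_derivative[OF smooth_act_chart(2)[OF c(1) c(1) t(1)] xd] has_derivative_linear by blast
  note inv = invariant[OF t(1)]
  obtain w where w: "\<Psi> c ?x [U c ?x, V c ?x, w] \<noteq> 0" using reg critical_iff[OF cx] by blast
  have LJ: "?L (J c ?x v) = J c ?x (?L v)" for v
    using inv c(1) xd Fx unfolding preserves_endo_def by metis
  have LG: "g c ?x [?L v, ?L w] = g c ?x [v, w]" for v w
    using conjunct1[OF inv, unfolded preserves_tensor_def, rule_format, OF c(1) c(1) xd, of "[v, w]"] Fx by simp
  have "re_part \<Psi> c ?x [?L u, ?L v, ?L w] = re_part \<Psi> c ?x [u, v, w]"
    "im_part \<Psi> c ?x [?L u, ?L v, ?L w] = im_part \<Psi> c ?x [u, v, w]" for u v w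
    using inv[THEN conjunct2, THEN conjunct2, THEN conjunct1, unfolded preserves_tensor_def, rule_format, OF c(1) c(1) xd, of "[u, v, w]"]
      inv[THEN conjunct2, THEN conjunct2, THEN conjunct2, unfolded preserves_tensor_def, rule_format, OF c(1) c(1) xd, of "[u, v, w]"] Fx
    by simp_all
  then have LP: "\<Psi> c ?x [?L u, ?L v, ?L w] = \<Psi> c ?x [u, v, w]" for u v w
    by (simp add: complex_eq_iff re_part_def im_part_def)
  have fixed: "?L (U c ?x) = U c ?x" "?L (V c ?x) = V c ?x"
    using generating_field_act[OF c c(1) _ t(1)] t(2) c(2) by (simp_all add: U_def V_def)
  note sw = alternating_swap3[OF volume_alternating[OF cx]]
  have alt3: "\<Psi> c ?x [u, w, u] = 0" for u w using sw(1)[of w u u] sw(4)[of w u] by simp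
  show ?thesis
    by (rule rotation_fixing_complex_independent_pair[where G = "\<lambda>v w. g c ?x [v, w]"
          and P = "\<lambda>u v w. \<Psi> c ?x [u, v, w]" and J = "J c ?x" and u = "U c ?x" and v = "V c ?x" and w = w,
          OF _ tensor_field_linear2[OF metric cx] metric_pos[OF cx] tensor_field_linear3[OF volume_tensor cx]
            sw(3) sw(4) alt3 volume_J[OF cx] volume_J3[OF cx] L LJ LG LP fixed w]) simp
qed

theorem free_at_regular_point:
  assumes p: "p \<in> topspace X"
    and reg: "\<And>c. c \<in> A \<Longrightarrow> p \<in> fst c \<Longrightarrow> frechet_derivative (\<lambda>x. \<nu> (chart_inv c x)) (at (snd c p)) \<noteq> (\<lambda>v. 0)"
    and t: "t \<in> carrier torus" "act t p = p"
  shows "t = \<one>\<^bsub>torus\<^esub>"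
proof -
  obtain c where c: "c \<in> A" "p \<in> fst c" using ex_chart[OF p] by blast
  have xI: "snd c p \<in> chart_image c" using c by (simp add: chart_in_image)
  obtain a where a: "t = torus_exp a" using torus_exp_surj[OF t(1)] by blast
  obtain m where m: "m > 0" "torus_exp (real m *\<^sub>R a) = \<one>\<^bsub>torus\<^esub>"
    using stabilizer_finite_order_at_independent_point[OF c
        generating_fields_independent_at_regular_point[OF c(1) xI reg[OF c]]] t(2) a by blast
  have fixp: "act (torus_exp (real k *\<^sub>R a)) p = p" for k using act_exp_iterate[OF p] t(2) a by simp
  obtain Q where Q: "openin X Q" "p \<in> Q" "\<And>q. q \<in> Q \<Longrightarrow> act (torus_exp a) q = q"
    using periodic_action_locally_trivial[OF c m fixp]
      act_derivative_at_fixed_regular_point[OF c reg[OF c] torus_exp_carrier fixp] by blast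
  show ?thesis unfolding a by (rule periodic_action_trivial[OF connected m Q(1) _ Q(3)]) (use Q(2) in auto)
qed

end

section \<open>Coordinates adapted to the action\<close>

text \<open>\<open>\<Gamma>\<close> is the local inverse of \<open>x \<mapsto> x - x\<^sub>0 + (h x - h x\<^sub>0 - l (x - x\<^sub>0)) n\<close> with \<open>l\<close> the derivative of
  \<open>h\<close> at \<open>x\<^sub>0\<close>.\<close>

lemma straighten_function:
  fixes h :: "real ^ 'n \<Rightarrow> real"
  assumes I: "open I" and h: "smooth_on I h" and x0: "x0 \<in> I"
    and n: "frechet_derivative h (at x0) n = 1"
  obtains W \<Gamma> where "open W" "0 \<in> W" "smooth_on W \<Gamma>" "\<Gamma> ` W \<subseteq> I" "\<Gamma> 0 = x0"
    "\<And>z. z \<in> W \<Longrightarrow> h (\<Gamma> z) = h x0 + frechet_derivative h (at x0) z"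
    "(\<Gamma> has_derivative (\<lambda>v. v)) (at 0)"
proof -
  define l where "l = frechet_derivative h (at x0)"
  note dh = smooth_on_has_derivative[OF h x0]
  have lin: "linear l" using dh has_derivative_linear by (auto simp: l_def)
  have ln: "l n = 1" using n by (simp add: l_def)
  define \<Theta> where "\<Theta> x = (x - x0) + (h x - h x0 - l (x - x0)) *\<^sub>R n" for x
  have sm: "smooth_on I \<Theta>"
    unfolding \<Theta>_def
    by (intro smooth_on_add smooth_on_diff smooth_on_scaleR smooth_on_id smooth_on_const I h
        smooth_on_bounded_linear[OF I, of l] linear_conv_bounded_linear[THEN iffD1, OF lin])
  have "(\<Theta> has_derivative (\<lambda>v. (v - 0) + (l v - 0 - l (v - 0)) *\<^sub>R n)) (at x0)"
    unfolding \<Theta>_def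
    by (intro has_derivative_add has_derivative_diff has_derivative_ident has_derivative_const
        has_derivative_scaleR_left bounded_linear.has_derivative[OF linear_conv_bounded_linear[THEN iffD1, OF lin]]
        dh[folded l_def])
  then have d\<Theta>: "(\<Theta> has_derivative (\<lambda>v. v)) (at x0)" by simp
  have "frechet_derivative \<Theta> (at x0) = (\<lambda>v. v)" by (rule frechet_derivative_at[OF d\<Theta>, symmetric])
  then have "inj (frechet_derivative \<Theta> (at x0))" by simp
  from smooth_inverse_function[OF I sm x0 this] obtain T W \<Gamma> where T: "open T" "x0 \<in> T" "T \<subseteq> I"
    and W: "open W" and hom: "homeomorphism T W \<Theta> \<Gamma>" and \<Gamma>: "smooth_on W \<Gamma>" .
  have \<Theta>0: "\<Theta> x0 = 0" by (simp add: \<Theta>_def linear_0[OF lin])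
  then have W0: "0 \<in> W" "\<Gamma> 0 = x0" using hom T(2) by (auto simp: homeomorphism_def)
  have \<Gamma>T: "\<Gamma> z \<in> T" "\<Theta> (\<Gamma> z) = z" if "z \<in> W" for z using hom that by (auto simp: homeomorphism_def)
  have h\<Gamma>: "h (\<Gamma> z) = h x0 + l z" if z: "z \<in> W" for z
  proof -
    \<comment> \<open>Since \<open>l n = 1\<close>, the correction along \<open>n\<close> replaces
      \<open>l (x - x0)\<close> by \<open>h x - h x0\<close>.\<close>
    have "l z = l (\<Theta> (\<Gamma> z))" using \<Gamma>T[OF z] by simp
    also have "\<dots> = h (\<Gamma> z) - h x0"
      using ln by (simp add: \<Theta>_def linear_add[OF lin] linear_scale[OF lin])
    finally show ?thesis by simp
  qed
  have d\<Gamma>: "(\<Gamma> has_derivative frechet_derivative \<Gamma> (at 0)) (at (\<Theta> x0))"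
    using smooth_on_has_derivative[OF \<Gamma> W0(1)] by (simp add: \<Theta>0)
  have "((\<lambda>x. x) has_derivative (\<lambda>v. frechet_derivative \<Gamma> (at 0) v)) (at x0)"
    by (rule has_derivative_transform_within_open[OF has_derivative_compose[OF d\<Theta> d\<Gamma>] T(1,2)])
      (use hom in \<open>auto simp: homeomorphism_def\<close>)
  then have "frechet_derivative \<Gamma> (at 0) = (\<lambda>v. v)"
    using has_derivative_unique[OF _ has_derivative_ident] by blast
  then have "(\<Gamma> has_derivative (\<lambda>v. v)) (at 0)" using d\<Gamma> by (simp add: \<Theta>0)
  then show thesis using that[OF W W0(1) \<Gamma> _ W0(2)] \<Gamma>T T(3) h\<Gamma> by (auto simp: l_def)
qed

text \<open>The kernel of \<open>l\<close> has dimension five and contains the two-dimensional range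
  of \<open>gen\<close>; its orthogonal complement in the kernel is parametrized by
  \<open>E\<close>, and \<open>n\<close> is transverse to the kernel. \<open>M'\<close> gives the
  coordinates in this frame.\<close>

lemma adapted_linear_frame:
  fixes gen :: "real \<times> real \<Rightarrow> real ^ 6" and l :: "real ^ 6 \<Rightarrow> real"
  assumes gen: "linear gen" "inj gen" and l: "linear l" "l n = 1" "\<And>a. l (gen a) = 0"
  obtains E :: "real ^ 3 \<Rightarrow> real ^ 6" and M' where "linear E" "\<And>y. l (E y) = 0" "linear M'"
    "\<And>a y r. M' (gen a + E y + r *\<^sub>R n) = (a, y, r)"
    "\<And>v. gen (fst (M' v)) + E (fst (snd (M' v))) + snd (snd (M' v)) *\<^sub>R n = v"
proof -
  let ?K = "{v. l v = 0}" and ?G = "range gen"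
  have lK: "l v = adjoint l 1 \<bullet> v" for v
    using adjoint_works[OF l(1), of v 1] by (simp add: inner_commute)
  have "adjoint l 1 \<noteq> 0" using lK[of n] l(2) by auto
  then have "dim {v. adjoint l 1 \<bullet> v = 0} = DIM(real ^ 6) - 1" by (rule dim_hyperplane)
  then have dimK: "dim ?K = 5" by (simp add: lK)
  have K: "subspace ?K" by (simp add: lK subspace_hyperplane)
  have G: "subspace ?G" using linear_subspace_image[OF gen(1) subspace_UNIV] .
  have dimG: "dim ?G = 2" using dim_image_eq[OF gen(1), of UNIV] gen(2) by simp
  let ?Y = "{y \<in> ?K. \<forall>x\<in>?G. orthogonal x y}"
  have "dim ?Y + dim ?G = dim ?K"
    by (rule dim_subspace_orthogonal_to_vectors[OF G K]) (use l(3) in auto)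
  then have dimY: "dim ?Y = dim (UNIV :: (real ^ 3) set)" using dimK dimG by simp
  have Y: "subspace ?Y"
    using K unfolding subspace_def by (auto simp: orthogonal_clauses)
  obtain E :: "real ^ 3 \<Rightarrow> real ^ 6" where E: "linear E" "E ` UNIV = ?Y" and E_norm: "\<And>y. y \<in> UNIV \<Longrightarrow> norm (E y) = norm y"
    by (rule isometry_subspaces[OF subspace_UNIV Y dimY[symmetric]], rule that)
  have EY: "l (E y) = 0" "orthogonal (gen a) (E y)" for a y using E(2) by blast+
  define M where "M z = gen (fst z) + E (fst (snd z)) + snd (snd z) *\<^sub>R n" for z
  have M: "linear M"
    by (rule linearI) (auto simp: M_def linear_add[OF gen(1)] linear_scale[OF gen(1)] linear_add[OF E(1)]
        linear_scale[OF E(1)] scaleR_add_left scaleR_add_right)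
  have "inj M"
    unfolding linear_injective_0[OF M]
  proof (intro allI impI)
    fix z assume z: "M z = 0"
    have "l (M z) = snd (snd z)" by (simp add: M_def linear_add[OF l(1)] linear_scale[OF l(1)] l EY)
    then have r: "snd (snd z) = 0" using z linear_0[OF l(1)] by simp
    then have eq: "gen (fst z) + E (fst (snd z)) = 0" using z by (simp add: M_def)
    have "gen (fst z) \<bullet> (gen (fst z) + E (fst (snd z))) = gen (fst z) \<bullet> gen (fst z)"
      using EY(2)[of "fst z" "fst (snd z)"] by (simp add: inner_add_right orthogonal_def)
    then have g0: "gen (fst z) = 0" by (simp add: eq)
    then have "fst z = 0" using linear_injective_0[OF gen(1)] gen(2) by blast
    moreover have "fst (snd z) = 0" using E_norm[of "fst (snd z)"] eq g0 by simp
    ultimately show "z = 0" using r by (simp add: prod_eq_iff)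
  qed
  then obtain M' where M': "linear M'" "M' \<circ> M = id" using linear_injective_left_inverse[OF M] by blast
  have M'M: "M' (M z) = z" for z using M'(2) by (metis comp_apply id_apply)
  have "dim (range M) = DIM(real ^ 6)" using dim_image_eq[OF M, of UNIV] \<open>inj M\<close> by simp
  then have "span (range M) = UNIV" using dim_eq_full by blast
  then have "range M = UNIV" by (metis linear_subspace_image[OF M subspace_UNIV] span_eq_iff)
  then have MM': "M (M' v) = v" for v using M'M by (metis surjD)
  show thesis
  proof (rule that[OF E(1) EY(1) M'(1)])
    show "M' (gen a + E y + r *\<^sub>R n) = (a, y, r)" for a y r using M'M[of "(a, y, r)"] by (simp add: M_def)
    show "gen (fst (M' v)) + E (fst (snd (M' v))) + snd (snd (M' v)) *\<^sub>R n = v" for v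
      using MM'[of v] by (simp add: M_def)
  qed
qed

context nearly_kaehler_torus
begin

abbreviation box3 :: "real \<Rightarrow> ((real \<times> real) \<times> (real ^ 3) \<times> real) set" where
  "box3 e \<equiv> ball 0 e \<times> ball 0 e \<times> ball 0 e"

text \<open>\<open>\<kappa>\<close> is inverse to \<open>F\<close>; on the level set of \<open>s\<close> the last coordinate vanishes, and on a slice
  the first one does too.\<close>

definition adapted_coordinates ::
  "real \<Rightarrow> ((real \<times> real) \<times> (real ^ 3) \<times> real \<Rightarrow> 'p) \<Rightarrow> real \<Rightarrow> 'p set \<Rightarrow>
   ('p \<Rightarrow> (real \<times> real) \<times> (real ^ 3) \<times> real) \<Rightarrow> bool" where
  "adapted_coordinates s F e Q \<kappa> \<longleftrightarrow> e > 0 \<and> smooth_from X A (box3 e) F \<and> smooth_to X A Q \<kappa> \<and>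
     F ` box3 e = Q \<and> (\<forall>z\<in>box3 e. \<kappa> (F z) = z) \<and>
     (\<forall>a\<in>ball 0 e. \<forall>y\<in>ball 0 e. \<forall>r\<in>ball 0 e. \<nu> (F (a, y, r)) = s + r \<and>
        F (a, y, r) = act (torus_exp a) (F (0, y, r)))"

text \<open>From the transversal point \<open>\<Gamma> (E y + r n)\<close> the action is followed
  for time \<open>a\<close>. The derivative at the origin is the identity in the linear frame, so
  the inverse function theorem applies, and the level of \<open>\<nu>\<close> is read off on the
  transversal.\<close>

lemma adapted_coordinates_exist:
  assumes p: "p \<in> topspace X" "\<nu> p = s" and c: "c \<in> A" "p \<in> fst c"
    and reg: "frechet_derivative (\<lambda>x. \<nu> (chart_inv c x)) (at (snd c p)) \<noteq> (\<lambda>v. 0)"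
  shows "\<exists>F e Q \<kappa>. adapted_coordinates s F e Q \<kappa> \<and> F 0 = p"
proof -
  define x0 where "x0 = snd c p"
  have x0: "x0 \<in> chart_image c" "chart_inv c x0 = p"
    using c chart_inv_chart[OF c] by (simp_all add: x0_def chart_in_image)
  note cx = c(1) x0(1)
  note I = chart_image_open[OF c(1)]
  let ?h = "\<lambda>x. \<nu> (chart_inv c x)"
  define l where "l = frechet_derivative ?h (at x0)"
  have dl: "(?h has_derivative l) (at x0)" using \<nu>_chart_derivative[OF cx] by (simp add: l_def)
  have l: "linear l" using dl by (rule has_derivative_linear)
  obtain n0 where n0: "l n0 \<noteq> 0" using reg by (auto simp: l_def x0_def)
  define n where "n = (1 / l n0) *\<^sub>R n0"
  have n: "l n = 1" using n0 by (simp add: n_def linear_scale[OF l])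
  have sh: "smooth_on (chart_image c) ?h"
    using smooth_toD(2)[OF smooth_\<nu> c(1)] chart_inv_topspace[OF c(1)] by (simp cong: conj_cong)
  obtain W \<Gamma> where W: "open W" "0 \<in> W" and \<Gamma>: "smooth_on W \<Gamma>" "\<Gamma> ` W \<subseteq> chart_image c" "\<Gamma> 0 = x0"
    "\<And>z. z \<in> W \<Longrightarrow> ?h (\<Gamma> z) = ?h x0 + l z" "(\<Gamma> has_derivative (\<lambda>v. v)) (at 0)"
    using straighten_function[OF I sh x0(1), of n] n unfolding l_def by blast
  define gen where "gen a = generating_field act a c x0" for a
  have gen: "linear gen" "inj gen"
    using linear_generating_field[OF cx] generating_fields_independent_at_regular_point[OF cx] reg
    by (simp_all add: gen_def[abs_def] x0_def)
  \<comment> \<open>Orbits lie in level sets of \<open>\<nu>\<close>, so its derivative annihilates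
    the generating fields.\<close>
  have lgen: "l (gen a) = 0" for a
  proof -
    have "((\<lambda>\<theta>. \<nu> (act (torus_exp \<theta>) p)) has_derivative (\<lambda>a. l (gen a))) (at 0)"
      using has_derivative_along_action[OF smooth_\<nu> p(1) c] by (simp add: l_def gen_def x0_def)
    then have "((\<lambda>\<theta>. \<nu> p) has_derivative (\<lambda>a. l (gen a))) (at 0)"
      by (simp add: \<nu>_act p(1))
    then have "(\<lambda>a. l (gen a)) = (\<lambda>a. 0)" using has_derivative_unique has_derivative_const by blast
    then show ?thesis by (rule fun_cong)
  qed
  obtain E :: "real ^ 3 \<Rightarrow> real ^ 6" and M' where E: "linear E" "\<And>y. l (E y) = 0" and M': "linear M'"
    "\<And>a y r. M' (gen a + E y + r *\<^sub>R n) = (a, y, r)"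
    "\<And>v. gen (fst (M' v)) + E (fst (snd (M' v))) + snd (snd (M' v)) *\<^sub>R n = v"
    using adapted_linear_frame[OF gen l n lgen] by blast
  define B where "B v = E (fst (snd (M' v))) + snd (snd (M' v)) *\<^sub>R n" for v
  have B: "linear B"
    by (rule linearI) (simp_all add: B_def linear_add[OF M'(1)] linear_scale[OF M'(1)] linear_add[OF E(1)]
        linear_scale[OF E(1)] scaleR_add_left scaleR_add_right)
  have blB: "bounded_linear B" "bounded_linear M'" using B M' by (simp_all add: linear_conv_bounded_linear)
  define S1 where "S1 = {v. B v \<in> W \<and> (fst (M' v), \<Gamma> (B v)) \<in> flow_dom c}"
  define f where "f v = flow c (fst (M' v), \<Gamma> (B v))" for v
  have BW: "open (B -` W)" by (rule open_vimage[OF W(1) linear_continuous_on[OF blB(1)]])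
  have sB: "smooth_on (B -` W) B" and sM': "smooth_on (B -` W) (\<lambda>v. fst (M' v))"
    using smooth_on_linear[OF BW] B smooth_on_fst[OF BW smooth_on_linear[OF BW M'(1)]] by blast+
  have s\<Gamma>B: "smooth_on (B -` W) (\<lambda>v. \<Gamma> (B v))" by (rule smooth_on_compose[OF BW W(1) _ \<Gamma>(1) sB]) auto
  have spair: "smooth_on (B -` W) (\<lambda>v. (fst (M' v), \<Gamma> (B v)))" by (rule smooth_on_Pair[OF BW sM' s\<Gamma>B])
  have S1_eq: "S1 = B -` W \<inter> (\<lambda>v. (fst (M' v), \<Gamma> (B v))) -` flow_dom c" by (auto simp: S1_def)
  have S1: "open S1"
    unfolding S1_eq
    by (rule continuous_open_preimage[OF smooth_on_continuous_on[OF spair] BW open_flow_dom[OF c(1)]])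
  have sf: "smooth_on S1 f"
    unfolding f_def
    by (rule smooth_on_compose[OF S1 open_flow_dom[OF c(1)] _ smooth_flow[OF c(1)] smooth_on_subset[OF spair]])
      (auto simp: S1_eq)
  have M'0: "M' 0 = 0" "B 0 = 0" using linear_0 M'(1) B by blast+
  have z: "(0, x0) \<in> flow_dom c" using flow_0(1)[OF cx] .
  have S10: "0 \<in> S1" using W(2) z by (simp add: S1_def M'0 \<Gamma>(3))
  have df: "(f has_derivative (\<lambda>v. v)) (at 0)"
  proof -
    have d\<Gamma>: "(\<Gamma> has_derivative (\<lambda>v. v)) (at (B 0))" using \<Gamma>(5) by (simp add: M'0)
    have "((\<lambda>v. \<Gamma> (B v)) has_derivative (\<lambda>v. B v)) (at 0)"
      by (rule has_derivative_compose[OF bounded_linear_imp_has_derivative[OF blB(1)] d\<Gamma>])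
    then have 1: "((\<lambda>v. (fst (M' v), \<Gamma> (B v))) has_derivative (\<lambda>v. (fst (M' v), B v))) (at 0)"
      by (intro has_derivative_Pair has_derivative_fst bounded_linear_imp_has_derivative[OF blB(2)])
    have 2: "(flow c has_derivative frechet_derivative (flow c) (at (0, x0))) (at (fst (M' 0), \<Gamma> (B 0)))"
      using flow_derivative[OF c(1) z] by (simp add: M'0 \<Gamma>(3))
    have "frechet_derivative (flow c) (at (0, x0)) (fst (M' v), B v) = v" for v
    proof -
      have lin: "linear (frechet_derivative (flow c) (at (0, x0)))"
        using flow_derivative[OF c(1) z] has_derivative_linear by blast
      have "frechet_derivative (flow c) (at (0, x0)) (fst (M' v), B v) = gen (fst (M' v)) + B v"
        using linear_add[OF lin, of "(fst (M' v), 0)" "(0, B v)"]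
        by (simp add: flow_derivative_at_0[OF cx] gen_def generating_field_eq[OF cx])
      then show ?thesis using M'(3)[of v] by (simp add: B_def add.assoc)
    qed
    then show ?thesis using has_derivative_compose[OF 1 2] by (simp add: f_def[abs_def])
  qed
  have "frechet_derivative f (at 0) = (\<lambda>v. v)" by (rule frechet_derivative_at[OF df, symmetric])
  then have "inj (frechet_derivative f (at 0))" by simp
  from smooth_inverse_function[OF S1 sf S10 this] obtain T1 W1 k where T1: "open T1" "0 \<in> T1" "T1 \<subseteq> S1"
    and W1: "open W1" and hom: "homeomorphism T1 W1 f k" and k: "smooth_on W1 k" .
  have fT: "f v \<in> W1" "k (f v) = v" if "v \<in> T1" for v using hom that by (auto simp: homeomorphism_def)
  have kW: "k x \<in> T1" "f (k x) = x" if "x \<in> W1" for x using hom that by (auto simp: homeomorphism_def)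
  have W1I: "x \<in> chart_image c" if x: "x \<in> W1" for x
  proof -
    have "k x \<in> S1" using kW(1)[OF x] T1(3) by blast
    then have "f (k x) \<in> chart_image c" by (simp add: S1_def f_def flow_in_image)
    then show ?thesis using kW(2)[OF x] by simp
  qed
  \<comment> \<open>The inverse of \<open>M'\<close>. The inverse function theorem was applied on
    \<open>real ^ 6\<close>, and \<open>M\<close> carries its result over to the triples
    \<open>(a, y, r)\<close>.\<close>
  define M where "M z = gen (fst z) + E (fst (snd z)) + snd (snd z) *\<^sub>R n" for z
  have M: "linear M"
    by (rule linearI) (simp_all add: M_def linear_add[OF gen(1)] linear_scale[OF gen(1)] linear_add[OF E(1)]
        linear_scale[OF E(1)] scaleR_add_left scaleR_add_right)
  have M'M: "M' (M z) = z" for z using M'(2) by (simp add: M_def)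
  have MM': "M (M' v) = v" for v using M'(3) by (simp add: M_def)
  have "open (M -` T1)" using M T1(1) by (simp add: open_vimage linear_continuous_on linear_conv_bounded_linear)
  moreover have "0 \<in> M -` T1" using T1(2) linear_0[OF M] by simp
  ultimately obtain d where d: "d > 0" "ball 0 d \<subseteq> M -` T1" using openE by blast
  \<comment> \<open>Three components of norm less than \<open>d / 3\<close> form a triple of norm
    less than \<open>d\<close>.\<close>
  define e where "e = d / 3"
  have e: "e > 0" using d by (simp add: e_def)
  have box: "M w \<in> T1" if w: "w \<in> box3 e" for w
  proof -
    have "norm w \<le> norm (fst w) + (norm (fst (snd w)) + norm (snd (snd w)))"
      using norm_Pair_le[of "fst w" "snd w"] norm_Pair_le[of "fst (snd w)" "snd (snd w)"] by simp
    also have "\<dots> < d" using w by (auto simp: e_def)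
    finally show ?thesis using d by auto
  qed
  have obox: "open (box3 e)" by (intro open_Times open_ball)
  define F where "F w = chart_inv c (f (M w))" for w
  define Q where "Q = {q \<in> fst c. snd c q \<in> W1 \<inter> (\<lambda>x. M' (k x)) -` box3 e}"
  define \<kappa> where "\<kappa> q = M' (k (snd c q))" for q
  have F_chart: "snd c (F w) = f (M w)" "F w \<in> fst c" if w: "w \<in> box3 e" for w
    using W1I[OF fT(1)[OF box[OF w]]] by (simp_all add: F_def chart_chart_inv chart_inv_in)
  have \<kappa>F: "\<kappa> (F w) = w" if w: "w \<in> box3 e" for w
    by (simp only: \<kappa>_def F_chart[OF w] fT(2)[OF box[OF w]] M'M)
  have FQ: "F ` box3 e = Q"
  proof (intro subset_antisym subsetI)
    fix q assume "q \<in> F ` box3 e"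
    then obtain w where w: "w \<in> box3 e" "q = F w" by blast
    then show "q \<in> Q"
      using F_chart[OF w(1)] fT[OF box[OF w(1)]] M'M[of w] by (simp add: Q_def)
  next
    fix q assume q: "q \<in> Q"
    then have *: "q \<in> fst c" "snd c q \<in> W1" "\<kappa> q \<in> box3 e" by (simp_all add: Q_def \<kappa>_def)
    have "F (\<kappa> q) = q" using kW(2)[OF *(2)] chart_inv_chart[OF c(1) *(1)] by (simp add: F_def \<kappa>_def MM')
    then show "q \<in> F ` box3 e" using *(3) by (intro image_eqI[of _ _ "\<kappa> q"]) simp_all
  qed
  have sF: "smooth_from X A (box3 e) F"
    unfolding F_def
    by (rule smooth_from_compose[OF smooth_from_chart_inv[OF c(1)] obox
          smooth_on_compose[OF obox S1 _ sf smooth_on_linear[OF obox M]]])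
      (use box T1(3) W1I fT(1) in blast)+
  have sM'k: "smooth_on W1 (\<lambda>x. M' (k x))" by (rule smooth_on_bounded_linear[OF W1 blB(2) k])
  have oQ: "openin X Q"
    unfolding Q_def
    by (rule openin_chart_preimage[OF c(1) continuous_open_preimage[OF smooth_on_continuous_on[OF sM'k] W1 obox]])
  have s\<kappa>: "smooth_to X A Q \<kappa>"
    unfolding \<kappa>_def
    by (rule smooth_to_compose[OF smooth_to_subset[OF smooth_to_chart[OF c(1)] oQ] W1 sM'k]) (auto simp: Q_def)
  have main: "\<nu> (F (a, y, r)) = s + r \<and> F (a, y, r) = act (torus_exp a) (F (0, y, r))"
    if "a \<in> ball 0 e" "y \<in> ball 0 e" "r \<in> ball 0 e" for a y r
  proof -
    have w: "(a, y, r) \<in> box3 e" and w0: "(0, y, r) \<in> box3 e" using that e by simp_all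
    let ?b = "E y + r *\<^sub>R n"
    have BM: "B (M (a, y, r)) = ?b" for a using M'M[of "(a, y, r)"] by (simp add: B_def)
    have b: "?b \<in> W" "(a, \<Gamma> ?b) \<in> flow_dom c"
      using box[OF w] T1(3) BM[of a] M'M[of "(a, y, r)"] by (auto simp: S1_def)
    have bI: "\<Gamma> ?b \<in> chart_image c" using \<Gamma>(2) b(1) by blast
    have F0: "F (0, y, r) = chart_inv c (\<Gamma> ?b)"
      by (simp add: F_def f_def BM M'M flow_0(2)[OF c(1) bI])
    have Fa: "F (a, y, r) = act (torus_exp a) (F (0, y, r))"
      using b(2) chart_inv_chart[OF c(1), of "act (torus_exp a) (chart_inv c (\<Gamma> ?b))"]
      by (simp add: F0) (simp add: F_def f_def BM M'M flow_def flow_dom_def)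
    have "\<nu> (F (a, y, r)) = \<nu> (F (0, y, r))"
      unfolding Fa F0 by (rule \<nu>_act) (simp_all add: chart_inv_topspace[OF c(1) bI])
    also have "\<dots> = s + r"
      using \<Gamma>(4)[OF b(1)] by (simp add: F0 x0 p linear_add[OF l] linear_scale[OF l] E n)
    finally show ?thesis using Fa by blast
  qed
  have "F 0 = p" by (simp add: F_def linear_0[OF M] f_def M'0 \<Gamma>(3) flow_0(2)[OF cx] x0(2))
  moreover have "adapted_coordinates s F e Q \<kappa>"
    unfolding adapted_coordinates_def using e sF s\<kappa> FQ \<kappa>F main by blast
  ultimately show ?thesis by blast
qed

end

context smooth_mfd
begin

lemma smooth_to_continuous_map:
  assumes "smooth_to X A Q \<phi>" shows "continuous_map (subtopology X Q) euclidean \<phi>"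
proof -
  have Q: "openin X Q" using assms by (simp add: smooth_to_def)
  have "openin (subtopology X Q) {p \<in> topspace (subtopology X Q). \<phi> p \<in> W}" if "open W" for W
  proof -
    have "{p \<in> topspace (subtopology X Q). \<phi> p \<in> W} = {p \<in> Q. \<phi> p \<in> W}"
      using openin_subset[OF Q] by auto
    then show ?thesis
      using smooth_to_open_preimage[OF assms that] unfolding openin_open_subtopology[OF Q] by auto
  qed
  then show ?thesis by (simp add: continuous_map_def)
qed

text \<open>When the composite is the identity, the outer derivative is a left inverse of the inner
  one; this is how the inclusion of the level set is shown to be an immersion.\<close>

lemma smooth_to_from_derivative:
  assumes \<phi>: "smooth_to X A Q \<phi>" and S: "smooth_from X A B S" and y: "y \<in> B" "S y \<in> Q"
    and c: "c \<in> A" "S y \<in> fst c"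
  shows "((\<lambda>y. \<phi> (S y)) has_derivative
    (\<lambda>v. frechet_derivative (\<lambda>x. \<phi> (chart_inv c x)) (at (snd c (S y)))
      (frechet_derivative (\<lambda>y. snd c (S y)) (at y) v))) (at y)"
proof -
  note inv = chart_inv_chart[OF c(1)]
  have "snd c (S y) \<in> {x \<in> chart_image c. chart_inv c x \<in> Q}" using y c inv by (simp add: chart_in_image)
  note d1 = smooth_on_has_derivative[OF smooth_toD(2)[OF \<phi> c(1)] this]
  have yB: "y \<in> {y \<in> B. S y \<in> fst c}" using y c by simp
  note d2 = smooth_on_has_derivative[OF smooth_fromD(2)[OF S c(1)] yB]
  show ?thesis
    by (rule has_derivative_transform_within_open[OF has_derivative_compose[OF d2 d1] smooth_fromD(1)[OF S c(1)] yB])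
      (simp add: inv)
qed

end

context nearly_kaehler_torus
begin

lemma adapted_coordinatesD:
  assumes "adapted_coordinates s F e Q \<kappa>"
  shows "e > 0" "smooth_from X A (box3 e) F" "smooth_to X A Q \<kappa>" "F ` box3 e = Q"
    "\<And>z. z \<in> box3 e \<Longrightarrow> \<kappa> (F z) = z"
    "\<And>a y r. a \<in> ball 0 e \<Longrightarrow> y \<in> ball 0 e \<Longrightarrow> r \<in> ball 0 e \<Longrightarrow> \<nu> (F (a, y, r)) = s + r"
    "\<And>a y r. a \<in> ball 0 e \<Longrightarrow> y \<in> ball 0 e \<Longrightarrow> r \<in> ball 0 e \<Longrightarrow>
      F (a, y, r) = act (torus_exp a) (F (0, y, r))"
proof -
  note * = assms[unfolded adapted_coordinates_def]
  show "e > 0" "smooth_from X A (box3 e) F" "smooth_to X A Q \<kappa>" "F ` box3 e = Q"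
    "\<And>z. z \<in> box3 e \<Longrightarrow> \<kappa> (F z) = z"
    "\<And>a y r. a \<in> ball 0 e \<Longrightarrow> y \<in> ball 0 e \<Longrightarrow> r \<in> ball 0 e \<Longrightarrow> \<nu> (F (a, y, r)) = s + r"
    "\<And>a y r. a \<in> ball 0 e \<Longrightarrow> y \<in> ball 0 e \<Longrightarrow> r \<in> ball 0 e \<Longrightarrow>
      F (a, y, r) = act (torus_exp a) (F (0, y, r))"
    using * by blast+
qed

lemma adapted_coordinates_shrink:
  assumes F: "adapted_coordinates s F e Q \<kappa>" and e': "0 < e'" "e' \<le> e"
  shows "adapted_coordinates s F e' (F ` box3 e') \<kappa>"
proof -
  have sub: "box3 e' \<subseteq> box3 e" using e' by auto
  have ob: "open (box3 e')" by (intro open_Times open_ball)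
  \<comment> \<open>Written as a preimage under \<open>\<kappa>\<close>, the smaller image is seen
    to be open.\<close>
  have eq: "F ` box3 e' = {q \<in> Q. \<kappa> q \<in> box3 e'}"
  proof (intro subset_antisym subsetI)
    fix q assume "q \<in> F ` box3 e'"
    then obtain z where z: "z \<in> box3 e'" "q = F z" by blast
    then have "z \<in> box3 e" using sub by blast
    then have "\<kappa> (F z) = z" "F z \<in> Q" using F unfolding adapted_coordinates_def by blast+
    then show "q \<in> {q \<in> Q. \<kappa> q \<in> box3 e'}" using z by simp
  next
    fix q assume q: "q \<in> {q \<in> Q. \<kappa> q \<in> box3 e'}"
    then have "q \<in> F ` box3 e" unfolding adapted_coordinatesD(4)[OF F] by blast
    then obtain z where z: "z \<in> box3 e" "q = F z" by blast
    then have "\<kappa> q = z" using adapted_coordinatesD(5)[OF F z(1)] by simp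
    moreover have "\<kappa> q \<in> box3 e'" using q by (simp only: mem_Collect_eq)
    ultimately have "z \<in> box3 e'" by (rule subst)
    then show "q \<in> F ` box3 e'" unfolding z(2) by (rule imageI)
  qed
  note \<kappa> = adapted_coordinatesD(3)[OF F]
  have "smooth_to X A (F ` box3 e') \<kappa>"
    unfolding eq by (rule smooth_to_subset[OF \<kappa> smooth_to_open_preimage[OF \<kappa> ob]]) (rule Collect_subset)
  moreover have "smooth_from X A (box3 e') F"
    by (rule smooth_from_subset[OF adapted_coordinatesD(2)[OF F] ob sub])
  moreover have "\<forall>z\<in>box3 e'. \<kappa> (F z) = z"
    using F sub unfolding adapted_coordinates_def by blast
  moreover have "\<forall>a\<in>ball 0 e'. \<forall>y\<in>ball 0 e'. \<forall>r\<in>ball 0 e'. \<nu> (F (a, y, r)) = s + r \<and>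
        F (a, y, r) = act (torus_exp a) (F (0, y, r))"
    by (intro ballI conjI adapted_coordinatesD(6,7)[OF F] subsetD[OF subset_ball[OF e'(2)]])
  ultimately show ?thesis using e'(1) unfolding adapted_coordinates_def by blast
qed

lemma smooth_from_slice:
  assumes F: "adapted_coordinates s F e Q \<kappa>" shows "smooth_from X A (ball 0 e) (\<lambda>y. F (0, y, 0))"
proof -
  have e: "e > 0" and sF: "smooth_from X A (box3 e) F" by (rule adapted_coordinatesD[OF F])+
  show ?thesis
    by (rule smooth_from_compose[OF sF open_ball])
      (use e in \<open>auto intro!: smooth_on_Pair smooth_on_const smooth_on_id\<close>)
qed

text \<open>If elements other than one carried points of shrinking slices back to the slice, they would
  accumulate at an element of the stabilizer of the centre, that is, at one; but for small times
  the action is a translation in the coordinates.\<close>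

lemma slice_meets_orbits_once:
  assumes F: "adapted_coordinates s F e Q \<kappa>" and free: "\<And>t. t \<in> carrier torus \<Longrightarrow> act t (F 0) = F 0 \<Longrightarrow> t = \<one>\<^bsub>torus\<^esub>"
  shows "\<exists>d>0. d \<le> e \<and> (\<forall>t\<in>carrier torus. \<forall>y\<in>ball 0 d. \<forall>y'\<in>ball 0 d.
    act t (F (0, y, 0)) = F (0, y', 0) \<longrightarrow> t = \<one>\<^bsub>torus\<^esub> \<and> y = y')"
proof (rule ccontr)
  assume not: "\<not> ?thesis"
  have e: "e > 0" by (rule adapted_coordinatesD(1)[OF F])
  let ?S = "\<lambda>y. F (0, y, 0)"
  have S: "smooth_from X A (ball 0 e) ?S" by (rule smooth_from_slice[OF F])
  \<comment> \<open>Radii shrinking to zero from \<open>e\<close>, one for each member of the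
    sequence of counterexamples.\<close>
  define d where "d n = e / real (Suc n)" for n
  have d: "d n > 0" "d n \<le> e" for n using e by (simp_all add: d_def field_simps)
  have d0: "d \<longlonglongrightarrow> 0" unfolding d_def using LIMSEQ_inverse_real_of_nat
    by (auto simp: divide_inverse intro!: tendsto_mult_right_zero)
  have "\<exists>t y y'. t \<in> carrier torus \<and> y \<in> ball 0 (d n) \<and> y' \<in> ball 0 (d n) \<and> act t (?S y) = ?S y' \<and>
      \<not> (t = \<one>\<^bsub>torus\<^esub> \<and> y = y')" for n
    using not d[of n] by blast
  then obtain t y y' where ty: "\<And>n. t n \<in> carrier torus" "\<And>n. y n \<in> ball 0 (d n)" "\<And>n. y' n \<in> ball 0 (d n)"
    "\<And>n. act (t n) (?S (y n)) = ?S (y' n)" "\<And>n. \<not> (t n = \<one>\<^bsub>torus\<^esub> \<and> y n = y' n)" by metis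
  have "\<exists>a. t n = torus_exp a \<and> norm a \<le> 2 * pi" for n using torus_exp_surj[OF ty(1)[of n]] by blast
  then obtain a where a: "\<And>n. t n = torus_exp (a n)" "\<And>n. norm (a n) \<le> 2 * pi" by metis
  have "a n \<in> cball 0 (2 * pi)" for n using a(2) by simp
  then obtain l r where r: "strict_mono r" "(a \<circ> r) \<longlonglongrightarrow> l"
    using compact_cball[of "0 :: real \<times> real" "2 * pi"] unfolding compact_def by blast
  have lim0: "(\<lambda>n. z (r n)) \<longlonglongrightarrow> 0" if "\<And>n. z n \<in> ball 0 (d n)" for z :: "nat \<Rightarrow> real ^ 3"
  proof (rule tendsto_norm_zero_cancel, rule tendsto_sandwich[of "\<lambda>_. 0" _ _ "\<lambda>n. d (r n)"])
    show "(\<lambda>n. d (r n)) \<longlonglongrightarrow> 0" using LIMSEQ_subseq_LIMSEQ[OF d0 r(1)] by (simp add: o_def)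
    show "\<forall>\<^sub>F n in sequentially. norm (z (r n)) \<le> d (r n)"
      using that by (intro always_eventually allI) (simp add: less_imp_le)
  qed auto
  have y0: "(\<lambda>n. y (r n)) \<longlonglongrightarrow> 0" "(\<lambda>n. y' (r n)) \<longlonglongrightarrow> 0" by (intro lim0 ty)+
  have in_e: "y n \<in> ball 0 e" "y' n \<in> ball 0 e" for n using ty(2,3)[of n] d(2)[of n] by auto
  have F0: "?S 0 = F 0" by (simp add: zero_prod_def)
  have SX: "?S z \<in> topspace X" if "z \<in> ball 0 e" for z using S that by (auto simp: smooth_from_def)
  have F0X: "F 0 \<in> topspace X" using SX[of 0] F0 e by simp
  \<comment> \<open>The limit element fixes the centre. As the space is only a Hausdorff topology,
    limits are compared through disjoint neighbourhoods.\<close>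
  have "act (torus_exp l) (F 0) = F 0"
  proof (rule ccontr)
    assume "act (torus_exp l) (F 0) \<noteq> F 0"
    then have "\<exists>O1 O2. openin X O1 \<and> openin X O2 \<and> act (torus_exp l) (F 0) \<in> O1 \<and> F 0 \<in> O2 \<and> disjnt O1 O2"
      by (intro Hausdorff[unfolded Hausdorff_space_def, rule_format] conjI F0X act_topspace torus_exp_carrier)
    then obtain O1 O2 where O: "openin X O1" "openin X O2" "act (torus_exp l) (F 0) \<in> O1" "F 0 \<in> O2" "disjnt O1 O2"
      by (elim exE conjE)
    let ?V1 = "{z \<in> UNIV \<times> ball 0 e. act (torus_exp (fst z)) (?S (snd z)) \<in> O1}"
    have "open ?V1" by (rule open_action_preimage[OF S O(1)])
    moreover have "(l, 0) \<in> ?V1" using O(3) e by (simp add: F0[simplified])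
    moreover have "(\<lambda>n. ((a \<circ> r) n, y (r n))) \<longlonglongrightarrow> (l, 0)" by (intro tendsto_Pair r y0)
    ultimately have 1: "\<forall>\<^sub>F n in sequentially. ((a \<circ> r) n, y (r n)) \<in> ?V1" by (rule topological_tendstoD[rotated])
    let ?V2 = "{z \<in> ball 0 e. ?S z \<in> O2}"
    have "open ?V2" using S O(2) unfolding smooth_from_def by blast
    moreover have "0 \<in> ?V2" using O(4) e F0 by simp
    ultimately have 2: "\<forall>\<^sub>F n in sequentially. y' (r n) \<in> ?V2" by (rule topological_tendstoD[OF y0(2)])
    from eventually_happens'[OF sequentially_bot eventually_conj[OF 1 2]]
    obtain n where n: "((a \<circ> r) n, y (r n)) \<in> ?V1" "y' (r n) \<in> ?V2" by blast
    then show False using ty(4)[of "r n"] O(5) a(1)[of "r n"] by (auto simp: disjnt_iff)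
  qed
  then have l1: "torus_exp l = \<one>\<^bsub>torus\<^esub>" by (intro free) simp_all
  have "\<forall>\<^sub>F n in sequentially. (a \<circ> r) n \<in> ball l e"
    by (rule topological_tendstoD[OF r(2)]) (use e in auto)
  from eventually_happens'[OF sequentially_bot this] obtain n where n: "(a \<circ> r) n \<in> ball l e" by blast
  define m where "m = r n"
  \<comment> \<open>As \<open>torus_exp l\<close> is one, subtracting \<open>l\<close> does not
    change the group element but makes the time small enough for the adapted coordinates.\<close>
  have al: "a m - l \<in> ball 0 e" using n by (simp add: m_def dist_norm norm_minus_commute)
  have "torus_exp (a m - l) = torus_exp (a m)"
    using torus_exp_diff_cong[of "a m" "a m" l 0] l1 torus_exp_0 by simp
  then have "F (a m - l, y m, 0) = ?S (y' m)"
    using adapted_coordinatesD(7)[OF F al in_e(1), of 0 m] e ty(4)[of m] a(1)[of m] by simp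
  moreover have "\<kappa> (F (a m - l, y m, 0)) = (a m - l, y m, 0)" "\<kappa> (?S (y' m)) = (0, y' m, 0)"
    using adapted_coordinatesD(5)[OF F, of "(a m - l, y m, 0)"] adapted_coordinatesD(5)[OF F, of "(0, y' m, 0)"]
      al in_e[of m] e by simp_all
  ultimately have "a m - l = 0" "y m = y' m" by simp_all
  then show False using ty(5)[of m] a(1)[of m] l1 by simp
qed

text \<open>The added clause makes the slice inject into the orbit space, so that \<open>y\<close>
  is a coordinate there.\<close>

definition slice_coordinates where
  "slice_coordinates s F e Q \<kappa> \<longleftrightarrow> adapted_coordinates s F e Q \<kappa> \<and>
    (\<forall>t\<in>carrier torus. \<forall>y\<in>ball 0 e. \<forall>y'\<in>ball 0 e.
      act t (F (0, y, 0)) = F (0, y', 0) \<longrightarrow> t = \<one>\<^bsub>torus\<^esub> \<and> y = y')"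

lemma slice_coordinates_exist:
  assumes s: "regular_value X A \<nu> s" and p: "p \<in> level_set X \<nu> s"
  shows "\<exists>F e Q \<kappa>. slice_coordinates s F e Q \<kappa> \<and> p \<in> Q"
proof -
  have pX: "p \<in> topspace X" "\<nu> p = s" using p by (auto simp: level_set_def)
  have reg: "frechet_derivative (\<lambda>x. \<nu> (chart_inv c x)) (at (snd c p)) \<noteq> (\<lambda>v. 0)" if "c \<in> A" "p \<in> fst c" for c
    using s p that unfolding regular_value_def by blast
  obtain c where c: "c \<in> A" "p \<in> fst c" using ex_chart[OF pX(1)] by blast
  obtain F e Q \<kappa> where F: "adapted_coordinates s F e Q \<kappa>" "F 0 = p"
    using adapted_coordinates_exist[OF pX c reg[OF c]] by blast
  obtain d where d: "d > 0" "d \<le> e" "\<forall>t\<in>carrier torus. \<forall>y\<in>ball 0 d. \<forall>y'\<in>ball 0 d.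
    act t (F (0, y, 0)) = F (0, y', 0) \<longrightarrow> t = \<one>\<^bsub>torus\<^esub> \<and> y = y'"
    using slice_meets_orbits_once[OF F(1)] free_at_regular_point[OF pX(1) reg] F(2) by blast
  have "slice_coordinates s F d (F ` box3 d) \<kappa>"
    using adapted_coordinates_shrink[OF F(1) d(1,2)] d(3) by (simp add: slice_coordinates_def)
  moreover have "p \<in> F ` box3 d" using F(2) d(1) by (intro image_eqI[of _ _ 0]) (simp_all add: zero_prod_def)
  ultimately show ?thesis by blast
qed

end

section \<open>The level set and its quotient\<close>

lemma homeomorphic_map_if_inverse:
  assumes "continuous_map Y (top_of_set B) f" "continuous_map (top_of_set B) Y h"
    and "\<And>p. p \<in> topspace Y \<Longrightarrow> h (f p) = p" "\<And>x. x \<in> B \<Longrightarrow> f (h x) = x"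
  shows "homeomorphic_map Y (top_of_set B) f"
  unfolding homeomorphic_map_maps homeomorphic_maps_def using assms by auto

context torus_action_mfd
begin

lemma orbit_eq_iff:
  assumes p: "p \<in> topspace X" and p': "p' \<in> topspace X"
  shows "orbit torus act p = orbit torus act p' \<longleftrightarrow> (\<exists>t\<in>carrier torus. act t p = p')"
proof
  assume "orbit torus act p = orbit torus act p'"
  then have "p' \<in> orbit torus act p" using orbit_refl[OF p'] by simp
  then obtain t where "t \<in> carrier torus" "p' = act t p" unfolding orbit_def by blast
  then show "\<exists>t\<in>carrier torus. act t p = p'" by blast
next
  assume "\<exists>t\<in>carrier torus. act t p = p'"
  then obtain a where a: "p' = act (torus_exp a) p" using torus_exp_surj by metis
  have "carrier torus = range torus_exp"
  proof (intro subset_antisym subsetI)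
    fix t assume "t \<in> carrier torus"
    from torus_exp_surj[OF this] obtain b where "t = torus_exp b" .
    then show "t \<in> range torus_exp" by (rule range_eqI)
  qed (erule rangeE, simp)
  then have eq: "orbit torus act p = range (\<lambda>b. act (torus_exp b) p)" for p
    unfolding orbit_def Setcompr_eq_image by (simp add: image_image)
  have "act (torus_exp b) p' = act (torus_exp (b + a)) p" "act (torus_exp b) p = act (torus_exp (b - a)) p'" for b
    using act_exp_add[OF p, of b a] act_exp_add[OF p, of "b - a" a] by (simp_all add: a)
  then show "orbit torus act p = orbit torus act p'" unfolding eq by (metis (no_types, lifting) image_cong rangeE rangeI subsetI subset_antisym)
qed

end

text \<open>\<open>i5\<close> and \<open>j5\<close> identify the pairs of orbit and slice
  coordinates with \<open>real ^ 5\<close>, the model space asked of the level set.\<close>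

locale nearly_kaehler_torus_level = nearly_kaehler_torus X A act g J \<Psi> \<xi> \<eta>
  for X :: "'p topology" and A act g J \<Psi> \<xi> \<eta> +
  fixes s :: real and i5 :: "(real \<times> real) \<times> (real ^ 3) \<Rightarrow> real ^ 5" and j5
  assumes regular: "regular_value X A \<nu> s"
    and i5: "linear i5" "linear j5" "\<And>z. j5 (i5 z) = z" "\<And>x. i5 (j5 x) = x"
begin

definition N where "N = level_set X \<nu> s"
definition XN where "XN = subtopology X N"
abbreviation "orb \<equiv> orbit torus act"
definition XQ where "XQ = quotient_topology XN orb"

lemma N_iff: "p \<in> N \<longleftrightarrow> p \<in> topspace X \<and> \<nu> p = s"
  by (simp add: N_def level_set_def)

lemma topspace_XN: "topspace XN = N"
  by (auto simp: XN_def topspace_subtopology N_iff)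

lemma act_N: "t \<in> carrier torus \<Longrightarrow> p \<in> N \<Longrightarrow> act t p \<in> N"
  by (simp add: N_iff act_topspace \<nu>_act)

lemma act_image_N: assumes t: "t \<in> carrier torus" shows "act t ` N = N"
proof (intro subset_antisym subsetI)
  fix p assume p: "p \<in> N"
  obtain a where a: "t = torus_exp a" using torus_exp_surj[OF t] by blast
  have pX: "p \<in> topspace X" using p by (simp add: N_iff)
  have "p = act t (act (torus_exp (- a)) p)" using act_exp_minus[OF pX, of "- a"] a by simp
  then show "p \<in> act t ` N" by (rule image_eqI) (rule act_N[OF torus_exp_carrier p])
qed (use act_N[OF t] in blast)

lemma stabilizer_N: assumes p: "p \<in> N" shows "stabilizer torus act p = {\<one>\<^bsub>torus\<^esub>}"
proof -
  have pX: "p \<in> topspace X" using p by (simp add: N_iff)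
  have reg: "frechet_derivative (\<lambda>x. \<nu> (chart_inv c x)) (at (snd c p)) \<noteq> (\<lambda>v. 0)" if "c \<in> A" "p \<in> fst c" for c
    using regular p that unfolding regular_value_def N_def by blast
  have "\<one>\<^bsub>torus\<^esub> \<in> carrier torus" using torus_exp_carrier[of 0] by (simp add: torus_exp_0)
  then have "\<one>\<^bsub>torus\<^esub> \<in> stabilizer torus act p" by (simp add: stabilizer_def act_one[OF pX])
  moreover have "t = \<one>\<^bsub>torus\<^esub>" if "t \<in> stabilizer torus act p" for t
  proof -
    have "t \<in> carrier torus" "act t p = p" using that by (simp_all add: stabilizer_def)
    with reg show ?thesis by (rule free_at_regular_point[OF pX])
  qed
  ultimately show ?thesis by blast
qed

section \<open>Charts obtained from slice coordinates\<close>

definition par :: "((real \<times> real) \<times> (real ^ 3) \<times> real \<Rightarrow> 'p) \<Rightarrow> real ^ 5 \<Rightarrow> 'p" where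
  "par F x = F (fst (j5 x), snd (j5 x), 0)"
definition pdom :: "real \<Rightarrow> (real ^ 5) set" where
  "pdom e = {x. fst (j5 x) \<in> ball 0 e \<and> snd (j5 x) \<in> ball 0 e}"
definition ncoord :: "('p \<Rightarrow> (real \<times> real) \<times> (real ^ 3) \<times> real) \<Rightarrow> 'p \<Rightarrow> real ^ 5" where
  "ncoord \<kappa> p = i5 (fst (\<kappa> p), fst (snd (\<kappa> p)))"
definition nchart where "nchart Q \<kappa> = (Q \<inter> N, ncoord \<kappa>)"
definition AN where "AN = {nchart Q \<kappa> | F e Q \<kappa>. slice_coordinates s F e Q \<kappa>}"

text \<open>An orbit receives the coordinate of the only point at which it meets the slice.\<close>

definition qcoord :: "((real \<times> real) \<times> (real ^ 3) \<times> real \<Rightarrow> 'p) \<Rightarrow> real \<Rightarrow> 'p set \<Rightarrow> real ^ 3" where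
  "qcoord F e = inv_into (ball 0 e) (\<lambda>y. orb (F (0, y, 0)))"
definition qchart where "qchart F e Q = (orb ` (Q \<inter> N), qcoord F e)"
definition AQ where "AQ = {qchart F e Q | F e Q \<kappa>. slice_coordinates s F e Q \<kappa>}"

lemma sliceD: "slice_coordinates s F e Q \<kappa> \<Longrightarrow> adapted_coordinates s F e Q \<kappa>"
  by (simp add: slice_coordinates_def)

lemma slice_once: "slice_coordinates s F e Q \<kappa> \<Longrightarrow> t \<in> carrier torus \<Longrightarrow> y \<in> ball 0 e \<Longrightarrow> y' \<in> ball 0 e \<Longrightarrow>
    act t (F (0, y, 0)) = F (0, y', 0) \<Longrightarrow> y = y'"
  unfolding slice_coordinates_def by blast

lemma open_pdom: "open (pdom e)"
proof -
  have "open (j5 -` (ball 0 e \<times> ball 0 e))"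
    using i5(2) by (intro open_vimage open_Times open_ball linear_continuous_on) (simp_all add: linear_conv_bounded_linear)
  moreover have "j5 -` (ball 0 e \<times> ball 0 e) = pdom e" by (auto simp: pdom_def mem_Times_iff)
  ultimately show ?thesis by simp
qed

context
  fixes F e Q \<kappa> assumes sc: "slice_coordinates s F e Q \<kappa>"
begin

lemma ad: "adapted_coordinates s F e Q \<kappa>" by (rule sliceD[OF sc])

lemma e_pos: "e > 0" by (rule adapted_coordinatesD(1)[OF ad])

lemma openin_Q: "openin X Q"
  using adapted_coordinatesD(3)[OF ad] by (simp add: smooth_to_def)

lemma level_point:
  assumes "a \<in> ball 0 e" "y \<in> ball 0 e"
  shows "F (a, y, 0) \<in> Q \<inter> N" "\<kappa> (F (a, y, 0)) = (a, y, 0)" "F (a, y, 0) = act (torus_exp a) (F (0, y, 0))"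
proof -
  have z: "(a, y, 0) \<in> box3 e" using assms e_pos by simp
  have "F (a, y, 0) \<in> F ` box3 e" using z by (rule imageI)
  then have Q: "F (a, y, 0) \<in> Q" using adapted_coordinatesD(4)[OF ad] by (rule back_subst)
  moreover have "F (a, y, 0) \<in> topspace X" using Q openin_subset[OF openin_Q] by blast
  moreover have "\<nu> (F (a, y, 0)) = s"
    using adapted_coordinatesD(6)[OF ad assms, of 0] e_pos by simp
  ultimately show "F (a, y, 0) \<in> Q \<inter> N" by (simp add: N_iff)
  show "\<kappa> (F (a, y, 0)) = (a, y, 0)" by (rule adapted_coordinatesD(5)[OF ad z])
  show "F (a, y, 0) = act (torus_exp a) (F (0, y, 0))"
    by (rule adapted_coordinatesD(7)[OF ad assms]) (use e_pos in simp)
qed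

lemma level_coordinates:
  assumes p: "p \<in> Q \<inter> N"
  obtains a y where "a \<in> ball 0 e" "y \<in> ball 0 e" "p = F (a, y, 0)" "\<kappa> p = (a, y, 0)"
proof -
  have "p \<in> F ` box3 e" using p adapted_coordinatesD(4)[OF ad] by blast
  then obtain z where z: "z \<in> box3 e" "p = F z" by blast
  obtain a y r where zr: "z = (a, y, r)" by (cases z)
  have ayr: "a \<in> ball 0 e" "y \<in> ball 0 e" "r \<in> ball 0 e" using z(1) by (simp_all add: zr)
  have "s + r = s" using adapted_coordinatesD(6)[OF ad ayr] p z(2) by (simp add: zr N_iff)
  then have "p = F (a, y, 0)" using z(2) zr by simp
  then show thesis using that[OF ayr(1,2)] level_point(2)[OF ayr(1,2)] by simp
qed

lemma par_in: "x \<in> pdom e \<Longrightarrow> par F x \<in> Q \<inter> N"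
  and ncoord_par: "x \<in> pdom e \<Longrightarrow> ncoord \<kappa> (par F x) = x"
  using level_point[of "fst (j5 x)" "snd (j5 x)"] by (simp_all add: pdom_def par_def ncoord_def i5)

lemma ncoord_in: "p \<in> Q \<inter> N \<Longrightarrow> ncoord \<kappa> p \<in> pdom e"
  and par_ncoord: "p \<in> Q \<inter> N \<Longrightarrow> par F (ncoord \<kappa> p) = p"
  by (erule level_coordinates, simp add: pdom_def par_def ncoord_def i5)+

lemma smooth_from_par: "smooth_from X A (pdom e) (par F)"
  unfolding par_def
proof (rule smooth_from_compose[OF adapted_coordinatesD(2)[OF ad] open_pdom])
  show "smooth_on (pdom e) (\<lambda>x. (fst (j5 x), snd (j5 x), 0::real))"
    by (intro smooth_on_Pair smooth_on_const smooth_on_fst smooth_on_snd smooth_on_linear open_pdom i5)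
  show "(\<lambda>x. (fst (j5 x), snd (j5 x), 0)) ` pdom e \<subseteq> box3 e" using e_pos by (auto simp: pdom_def)
qed

lemma smooth_to_ncoord: "smooth_to X A Q (ncoord \<kappa>)"
  unfolding ncoord_def
proof (rule smooth_to_compose[OF adapted_coordinatesD(3)[OF ad] open_UNIV, where f = "\<lambda>z. i5 (fst z, fst (snd z))"])
  show "smooth_on UNIV (\<lambda>z :: (real \<times> real) \<times> (real ^ 3) \<times> real. i5 (fst z, fst (snd z)))"
    by (rule smooth_on_bounded_linear[OF open_UNIV i5(1)[unfolded linear_conv_bounded_linear]])
      (intro smooth_on_Pair smooth_on_fst smooth_on_snd smooth_on_id open_UNIV)
qed simp

lemma smooth_to_slice_coord: "smooth_to X A Q (\<lambda>p. fst (snd (\<kappa> p)))"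
  by (rule smooth_to_compose[OF adapted_coordinatesD(3)[OF ad] open_UNIV, where f = "\<lambda>z. fst (snd z)"])
    (intro smooth_on_fst smooth_on_snd smooth_on_id open_UNIV, simp)

lemma nchart_image: "chart_image (nchart Q \<kappa>) = pdom e"
proof (intro subset_antisym subsetI)
  fix x assume "x \<in> pdom e"
  then show "x \<in> chart_image (nchart Q \<kappa>)"
    using par_in[of x] ncoord_par[of x] unfolding chart_image_def nchart_def by (intro image_eqI[of _ _ "par F x"]) simp_all
qed (use ncoord_in in \<open>auto simp: chart_image_def nchart_def\<close>)

lemma nchart_inv: assumes "x \<in> pdom e" shows "chart_inv (nchart Q \<kappa>) x = par F x"
proof -
  have "inj_on (ncoord \<kappa>) (Q \<inter> N)" using par_ncoord by (metis inj_onI)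
  then show ?thesis
    using inv_into_f_f[of "ncoord \<kappa>" "Q \<inter> N" "par F x"] par_in[OF assms] ncoord_par[OF assms]
    by (simp add: chart_inv_def nchart_def)
qed

lemma nchart_homeo:
  "homeomorphic_map (subtopology XN (Q \<inter> N)) (top_of_set (pdom e)) (ncoord \<kappa>)"
proof (rule homeomorphic_map_if_inverse[where h = "par F"])
  have eq: "subtopology XN (Q \<inter> N) = subtopology X (Q \<inter> N)"
    by (simp add: XN_def subtopology_subtopology Int_absorb1)
  have top: "topspace (subtopology X (Q \<inter> N)) = Q \<inter> N" by (auto simp: topspace_subtopology N_iff)
  show "continuous_map (subtopology XN (Q \<inter> N)) (top_of_set (pdom e)) (ncoord \<kappa>)"
    unfolding eq
    by (rule continuous_map_into_subtopology[OF continuous_map_from_subtopology_mono[OF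
            smooth_to_continuous_map[OF smooth_to_ncoord]]]) (use ncoord_in top in auto)
  show "continuous_map (top_of_set (pdom e)) (subtopology XN (Q \<inter> N)) (par F)"
    unfolding eq
    by (rule continuous_map_into_subtopology[OF smooth_from_continuous_map[OF smooth_from_par]]) (use par_in in auto)
qed (use par_ncoord ncoord_par in \<open>auto simp: XN_def topspace_subtopology\<close>)

lemma inj_slice: "inj_on (\<lambda>y. orb (F (0, y, 0))) (ball 0 e)"
proof (rule inj_onI)
  fix y y' assume y: "y \<in> ball 0 e" "y' \<in> ball 0 e" and eq: "orb (F (0, y, 0)) = orb (F (0, y', 0))"
  have 0: "0 \<in> ball (0 :: real \<times> real) e" using e_pos by simp
  have "F (0, y, 0) \<in> topspace X" "F (0, y', 0) \<in> topspace X"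
    using level_point(1)[OF 0 y(1)] level_point(1)[OF 0 y(2)] by (simp_all add: N_iff)
  then obtain t where "t \<in> carrier torus" "act t (F (0, y, 0)) = F (0, y', 0)" using eq orbit_eq_iff by blast
  then show "y = y'" using slice_once[OF sc _ y] by blast
qed

text \<open>\<open>F (a, y, 0)\<close> is a translate of \<open>F (0, y, 0)\<close>, so every point
  of \<open>Q \<inter> N\<close> on an orbit shows the quotient coordinate as its middle
  component.\<close>

lemma orb_slice: assumes p: "p \<in> Q \<inter> N"
  shows "orb p = orb (F (0, fst (snd (\<kappa> p)), 0))" "fst (snd (\<kappa> p)) \<in> ball 0 e" "qcoord F e (orb p) = fst (snd (\<kappa> p))"
proof -
  obtain a y where ay: "a \<in> ball 0 e" "y \<in> ball 0 e" "p = F (a, y, 0)" "\<kappa> p = (a, y, 0)"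
    using level_coordinates[OF p] by blast
  have 0: "0 \<in> ball (0 :: real \<times> real) e" using e_pos by simp
  have "F (0, y, 0) \<in> topspace X" using level_point(1)[OF 0 ay(2)] by (simp add: N_iff)
  moreover have "p \<in> topspace X" using p by (simp add: N_iff)
  moreover have "act (torus_exp a) (F (0, y, 0)) = p" using level_point(3)[OF ay(1,2)] ay(3) by simp
  ultimately have "orb (F (0, y, 0)) = orb p" using orbit_eq_iff torus_exp_carrier by blast
  then show 1: "orb p = orb (F (0, fst (snd (\<kappa> p)), 0))" by (simp add: ay(4))
  show 2: "fst (snd (\<kappa> p)) \<in> ball 0 e" using ay by simp
  show "qcoord F e (orb p) = fst (snd (\<kappa> p))"
    unfolding 1 qcoord_def using inv_into_f_f[OF inj_slice 2] by simp
qed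

lemma slice_point: assumes y: "y \<in> ball 0 e"
  shows "F (0, y, 0) \<in> Q \<inter> N" "qcoord F e (orb (F (0, y, 0))) = y"
proof -
  have 0: "0 \<in> ball (0 :: real \<times> real) e" using e_pos by simp
  show "F (0, y, 0) \<in> Q \<inter> N" by (rule level_point(1)[OF 0 y])
  then show "qcoord F e (orb (F (0, y, 0))) = y" using orb_slice(3) level_point(2)[OF 0 y] by simp
qed

lemma qchart_image: "chart_image (qchart F e Q) = ball 0 e"
proof (intro subset_antisym subsetI)
  fix y :: "real ^ 3" assume "y \<in> ball 0 e"
  then show "y \<in> chart_image (qchart F e Q)"
    using slice_point[of y] unfolding chart_image_def qchart_def fst_conv snd_conv
    by (intro image_eqI[of _ _ "orb (F (0, y, 0))"]) auto
next
  fix y assume "y \<in> chart_image (qchart F e Q)"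
  then obtain p where p: "p \<in> Q \<inter> N" "y = qcoord F e (orb p)" by (auto simp: chart_image_def qchart_def)
  then show "y \<in> ball 0 e" using orb_slice(2,3)[OF p(1)] by simp
qed

lemma inj_qcoord: "inj_on (qcoord F e) (orb ` (Q \<inter> N))"
proof (rule inj_onI)
  fix \<omega> \<omega>' assume "\<omega> \<in> orb ` (Q \<inter> N)" "\<omega>' \<in> orb ` (Q \<inter> N)" and eq: "qcoord F e \<omega> = qcoord F e \<omega>'"
  then obtain p p' where p: "p \<in> Q \<inter> N" "\<omega> = orb p" "p' \<in> Q \<inter> N" "\<omega>' = orb p'" by blast
  show "\<omega> = \<omega>'" using eq orb_slice[OF p(1)] orb_slice[OF p(3)] by (simp add: p(2,4))
qed

lemma qchart_inv: assumes y: "y \<in> ball 0 e" shows "chart_inv (qchart F e Q) y = orb (F (0, y, 0))"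
  using inv_into_f_f[OF inj_qcoord imageI[OF slice_point(1)[OF y]]] slice_point(2)[OF y]
  by (simp add: chart_inv_def qchart_def)

end

end

section \<open>The level set as an immersed manifold\<close>

context nearly_kaehler_torus_level
begin

lemma coord_nchart:
  assumes sc: "slice_coordinates s F e Q \<kappa>"
  shows "coord_dom (nchart Q \<kappa>) c' G = {x \<in> pdom e. G (par F x) \<in> fst c'}"
    and "x \<in> pdom e \<Longrightarrow> coord_rep (nchart Q \<kappa>) c' G x = snd c' (G (par F x))"
  using nchart_inv[OF sc] by (auto simp: coord_dom_def coord_rep_def nchart_image[OF sc])

lemma coord_qchart:
  assumes sc: "slice_coordinates s F e Q \<kappa>"
  shows "coord_dom (qchart F e Q) c' G = {y \<in> ball 0 e. G (orb (F (0, y, 0))) \<in> fst c'}"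
    and "y \<in> ball 0 e \<Longrightarrow> coord_rep (qchart F e Q) c' G y = snd c' (G (orb (F (0, y, 0))))"
  using qchart_inv[OF sc] by (auto simp: coord_dom_def coord_rep_def qchart_image[OF sc])

lemma AN_cases:
  assumes "c \<in> AN"
  obtains F e Q \<kappa> where "slice_coordinates s F e Q \<kappa>" "c = nchart Q \<kappa>"
  using assms unfolding AN_def by blast

lemma AQ_cases:
  assumes "c \<in> AQ"
  obtains F e Q \<kappa> where "slice_coordinates s F e Q \<kappa>" "c = qchart F e Q"
  using assms unfolding AQ_def by blast

lemma openin_XN_Int: "openin X Q \<Longrightarrow> openin XN (Q \<inter> N)"
  unfolding XN_def by (rule openin_subtopology_Int)

lemma manifold_N: "smooth_manifold XN AN"
  unfolding smooth_manifold_def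
proof (intro conjI ballI)
  show "Hausdorff_space XN" unfolding XN_def by (rule Hausdorff_space_subtopology[OF Hausdorff])
  show "second_countable XN"
    unfolding XN_def using mfd by (intro second_countable_subtopology) (simp add: smooth_manifold_def)
  fix c assume "c \<in> AN"
  then obtain F e Q \<kappa> where sc: "slice_coordinates s F e Q \<kappa>" "c = nchart Q \<kappa>" by (rule AN_cases)
  show "openin XN (fst c)" using openin_XN_Int[OF openin_Q[OF sc(1)]] by (simp add: sc(2) nchart_def)
  show "open (chart_image c)" by (simp add: sc(2) nchart_image[OF sc(1)] open_pdom)
  show "homeomorphic_map (subtopology XN (fst c)) (top_of_set (chart_image c)) (snd c)"
    using nchart_homeo[OF sc(1)] unfolding sc(2) nchart_image[OF sc(1)] by (simp add: nchart_def)
  fix c' assume "c' \<in> AN"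
  then obtain F' e' Q' \<kappa>' where sc': "slice_coordinates s F' e' Q' \<kappa>'" "c' = nchart Q' \<kappa>'" by (rule AN_cases)
  have dom: "coord_dom c c' id = {x \<in> pdom e. par F x \<in> Q'}"
    unfolding sc(2) coord_nchart(1)[OF sc(1)] using par_in[OF sc(1)] by (auto simp: sc'(2) nchart_def)
  note tf = smooth_to_from[OF smooth_to_ncoord[OF sc'(1)] smooth_from_par[OF sc(1)]]
  show "smooth_on (coord_dom c c' id) (coord_rep c c' id)"
    unfolding dom
    by (rule smooth_on_eqI[OF tf]) (simp add: sc(2) coord_nchart(2)[OF sc(1)], simp add: sc'(2) nchart_def)
next
  show "(\<Union>c\<in>AN. fst c) = topspace XN"
  proof (intro subset_antisym subsetI)
    fix p assume "p \<in> (\<Union>c\<in>AN. fst c)"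
    then obtain c where "c \<in> AN" "p \<in> fst c" by blast
    then show "p \<in> topspace XN" by (elim AN_cases) (simp add: nchart_def topspace_XN)
  next
    fix p assume "p \<in> topspace XN"
    then have p: "p \<in> N" by (simp add: topspace_XN)
    then obtain F e Q \<kappa> where sc: "slice_coordinates s F e Q \<kappa>" "p \<in> Q"
      using slice_coordinates_exist[OF regular] unfolding N_def by blast
    have "nchart Q \<kappa> \<in> AN" unfolding AN_def using sc(1) by blast
    moreover have "p \<in> fst (nchart Q \<kappa>)" using sc(2) p by (simp add: nchart_def)
    ultimately show "p \<in> (\<Union>c\<in>AN. fst c)" by (rule UN_I)
  qed
qed

text \<open>The coordinate map \<open>ncoord \<kappa>\<close> is smooth on the open set
  \<open>Q\<close> of the ambient manifold and inverts \<open>par F\<close> on the left, so its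
  derivative is a left inverse of that of the inclusion.\<close>

lemma immersion_N: "smooth_immersion XN AN X A (\<lambda>p. p)"
  unfolding smooth_immersion_def smooth_map_def
proof (intro conjI ballI)
  show "continuous_map XN X (\<lambda>p. p)"
    unfolding XN_def by (rule continuous_map_from_subtopology) (simp add: continuous_map_id[unfolded id_def])
  fix c c' assume "c \<in> AN" and c': "c' \<in> A"
  then obtain F e Q \<kappa> where sc: "slice_coordinates s F e Q \<kappa>" "c = nchart Q \<kappa>" by (elim AN_cases)
  note S = smooth_from_par[OF sc(1)]
  have dom: "coord_dom c c' (\<lambda>p. p) = {x \<in> pdom e. par F x \<in> fst c'}"
    by (simp add: sc(2) coord_nchart(1)[OF sc(1)])
  have rep: "coord_rep c c' (\<lambda>p. p) x = snd c' (par F x)" if "x \<in> {x \<in> pdom e. par F x \<in> fst c'}" for x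
    using that by (simp add: sc(2) coord_nchart(2)[OF sc(1)])
  note D = smooth_fromD[OF S c']
  show "smooth_on (coord_dom c c' (\<lambda>p. p)) (coord_rep c c' (\<lambda>p. p))"
    unfolding dom by (rule smooth_on_eqI[OF D rep])
  fix x assume "x \<in> coord_dom c c' (\<lambda>p. p)"
  then have x: "x \<in> pdom e" "par F x \<in> fst c'" and x': "x \<in> {x \<in> pdom e. par F x \<in> fst c'}"
    unfolding dom by simp_all
  have eq: "frechet_derivative (coord_rep c c' (\<lambda>p. p)) (at x) = frechet_derivative (\<lambda>x. snd c' (par F x)) (at x)"
    by (rule frechet_derivative_cong_open[OF D(1) x' rep])
  have "par F x \<in> Q" using par_in[OF sc(1) x(1)] by blast
  from smooth_to_from_derivative[OF smooth_to_ncoord[OF sc(1)] S x(1) this c' x(2)]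
  obtain D' where "((\<lambda>y. ncoord \<kappa> (par F y)) has_derivative
      (\<lambda>v. D' (frechet_derivative (\<lambda>y. snd c' (par F y)) (at x) v))) (at x)" by blast
  then have "((\<lambda>y. y) has_derivative
      (\<lambda>v. D' (frechet_derivative (\<lambda>y. snd c' (par F y)) (at x) v))) (at x)"
    by (rule has_derivative_transform_within_open[OF _ open_pdom x(1)]) (rule ncoord_par[OF sc(1)])
  then have "(\<lambda>v. D' (frechet_derivative (\<lambda>y. snd c' (par F y)) (at x) v)) = (\<lambda>v. v)"
    using has_derivative_unique has_derivative_ident by blast
  then have "D' (frechet_derivative (\<lambda>y. snd c' (par F y)) (at x) v) = v" for v by (rule fun_cong)
  then show "inj (frechet_derivative (coord_rep c c' (\<lambda>p. p)) (at x))" unfolding eq by (rule inj_on_inverseI)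
qed

section \<open>The orbit space as a manifold\<close>

lemma quotient_orb: "quotient_map XN XQ orb"
  unfolding XQ_def by (rule quotient_map_quotient_topology)

lemma topspace_XQ: "topspace XQ = orb ` N"
  using quotient_orb by (simp add: quotient_map_def topspace_XN)

lemma orb_eq_iff: "p \<in> N \<Longrightarrow> p' \<in> N \<Longrightarrow> orb p = orb p' \<longleftrightarrow> (\<exists>t\<in>carrier torus. act t p = p')"
  by (simp add: orbit_eq_iff N_iff)

lemma act_continuous_N: assumes t: "t \<in> carrier torus" shows "continuous_map XN XN (act t)"
proof -
  have "continuous_map XN X (act t)"
    unfolding XN_def by (rule continuous_map_from_subtopology[OF act_continuous[OF t]])
  then show ?thesis
    using act_N[OF t] topspace_XN by (subst (2) XN_def) (rule continuous_map_into_subtopology, auto)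
qed

text \<open>Presents the saturation of an open set as a union of open sets, which makes the orbit
  map open.\<close>

lemma saturation: assumes "W \<subseteq> N"
  shows "{p \<in> topspace XN. orb p \<in> orb ` W} = (\<Union>t\<in>carrier torus. {p \<in> topspace XN. act t p \<in> W})"
proof (intro subset_antisym subsetI)
  fix p assume "p \<in> {p \<in> topspace XN. orb p \<in> orb ` W}"
  then obtain w where p: "p \<in> N" "w \<in> W" "orb p = orb w" by (auto simp: topspace_XN)
  then obtain t where "t \<in> carrier torus" "act t p = w" using orb_eq_iff assms by blast
  then show "p \<in> (\<Union>t\<in>carrier torus. {p \<in> topspace XN. act t p \<in> W})"
    using p by (intro UN_I[of t]) (simp_all add: topspace_XN)
next
  fix p assume "p \<in> (\<Union>t\<in>carrier torus. {p \<in> topspace XN. act t p \<in> W})"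
  then obtain t where t: "t \<in> carrier torus" "p \<in> N" "act t p \<in> W" by (auto simp: topspace_XN)
  then have "orb p = orb (act t p)" using orb_eq_iff[of p "act t p"] assms by blast
  then show "p \<in> {p \<in> topspace XN. orb p \<in> orb ` W}" using t by (simp add: topspace_XN)
qed

lemma open_map_orb: "open_map XN XQ orb"
  unfolding open_map_def
proof (intro allI impI)
  fix W assume W: "openin XN W"
  have sub: "W \<subseteq> N" using openin_subset[OF W] by (simp add: topspace_XN)
  have "openin XN {p \<in> topspace XN. orb p \<in> orb ` W}"
    unfolding saturation[OF sub]
    by (intro openin_Union ballI) (use openin_continuous_map_preimage[OF act_continuous_N W] in blast)
  then show "openin XQ (orb ` W)"
    unfolding XQ_def openin_quotient_topology using sub by (simp add: topspace_XN image_mono)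
qed

lemma closedin_N: "closedin X N"
proof -
  have "openin X {p \<in> topspace X. \<nu> p \<in> - {s}}"
    by (rule smooth_to_open_preimage[OF smooth_\<nu>]) (simp add: open_Compl)
  moreover have "topspace X - N = {p \<in> topspace X. \<nu> p \<in> - {s}}"
    by (intro subset_antisym subsetI) (simp_all add: N_iff)
  moreover have "N \<subseteq> topspace X" using N_iff by blast
  ultimately show ?thesis by (simp add: closedin_def)
qed

lemma compact_XN: "compact_space XN"
  unfolding XN_def
  using closedin_compact_space[OF compact closedin_N] compactin_subspace by blast

text \<open>The saturation of \<open>C\<close> is the image of the compact set
  \<open>carrier torus \<times> C\<close> under the action, hence closed.\<close>

lemma closed_map_orb: "closed_map XN XQ orb"
  unfolding closed_map_def
proof (intro allI impI)
  fix C assume C: "closedin XN C"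
  have sub: "C \<subseteq> N" using closedin_subset[OF C] by (simp add: topspace_XN)
  have "compactin XN C" by (rule closedin_compact_space[OF compact_XN C])
  then have CX: "compactin X C" unfolding XN_def by (simp add: compactin_subtopology)
  have "compact (carrier torus)" by (simp add: torus_carrier compact_Times)
  then have "compactin (prod_topology (top_of_set (carrier torus)) X) (carrier torus \<times> C)"
    using CX by (simp add: compactin_Times compactin_subtopology)
  from image_compactin[OF this action_continuous]
  have "closedin X ((\<lambda>(t, p). act t p) ` (carrier torus \<times> C))" by (rule compactin_imp_closedin[OF Hausdorff])
  moreover have "{p \<in> topspace XN. orb p \<in> orb ` C} = (\<lambda>(t, p). act t p) ` (carrier torus \<times> C)"
  proof (intro subset_antisym subsetI)
    fix p assume "p \<in> {p \<in> topspace XN. orb p \<in> orb ` C}"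
    then obtain w where p: "p \<in> N" "w \<in> C" "orb w = orb p" by (auto simp: topspace_XN)
    then obtain t where "t \<in> carrier torus" "act t w = p" using orb_eq_iff sub by blast
    then show "p \<in> (\<lambda>(t, p). act t p) ` (carrier torus \<times> C)"
      using p by (intro image_eqI[of _ _ "(t, w)"]) simp_all
  next
    fix p assume "p \<in> (\<lambda>(t, p). act t p) ` (carrier torus \<times> C)"
    then obtain z where z: "z \<in> carrier torus \<times> C" "p = (\<lambda>(t, p). act t p) z" by (rule imageE)
    obtain t w where tw: "z = (t, w)" by (rule prod.exhaust)
    have t: "t \<in> carrier torus" "w \<in> C" "p = act t w" using z by (simp_all add: tw)
    have wN: "w \<in> N" using t(2) sub by blast
    have pN: "p \<in> N" using act_N[OF t(1) wN] t(3) by simp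
    then have "orb w = orb p" using orb_eq_iff[OF wN pN] t by blast
    then show "p \<in> {p \<in> topspace XN. orb p \<in> orb ` C}" using pN t(2) by (auto simp: topspace_XN)
  qed
  ultimately have "closedin X {p \<in> topspace XN. orb p \<in> orb ` C}" by (simp only:)
  moreover have "{p \<in> topspace XN. orb p \<in> orb ` C} \<subseteq> N" by (auto simp: topspace_XN)
  ultimately have "closedin XN {p \<in> topspace XN. orb p \<in> orb ` C}"
    unfolding XN_def by (intro closedin_subset_topspace)
  then show "closedin XQ (orb ` C)"
    using quotient_orb sub unfolding quotient_map_closedin by (simp add: topspace_XQ image_mono)
qed

text \<open>The compact Hausdorff level set is normal, and a closed continuous surjection passes
  this on together with the separation of points.\<close>

lemma Hausdorff_XQ: "Hausdorff_space XQ"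
proof -
  have "Hausdorff_space XN" unfolding XN_def by (rule Hausdorff_space_subtopology[OF Hausdorff])
  then show ?thesis
    using normal_Hausdorff_space_closed_continuous_map_image[OF
        compact_Hausdorff_or_regular_imp_normal_space[OF compact_XN] _ closed_map_orb
        quotient_imp_continuous_map[OF quotient_orb]] topspace_XQ topspace_XN by blast
qed

lemma second_countable_XQ: "second_countable XQ"
proof (rule second_countable_open_map_image[OF quotient_imp_continuous_map[OF quotient_orb] open_map_orb])
  show "orb ` topspace XN = topspace XQ" by (simp add: topspace_XN topspace_XQ)
  show "second_countable XN"
    unfolding XN_def using mfd by (intro second_countable_subtopology) (simp add: smooth_manifold_def)
qed

lemma openin_qchart: "openin X Q \<Longrightarrow> openin XQ (orb ` (Q \<inter> N))"
  using open_map_orb openin_XN_Int unfolding open_map_def by blast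

lemma qchart_homeo:
  assumes sc: "slice_coordinates s F e Q \<kappa>"
  shows "homeomorphic_map (subtopology XQ (orb ` (Q \<inter> N))) (top_of_set (ball 0 e)) (qcoord F e)"
proof (rule homeomorphic_map_if_inverse[where h = "\<lambda>y. orb (F (0, y, 0))"])
  let ?O = "orb ` (Q \<inter> N)"
  have O: "openin XQ ?O" by (rule openin_qchart[OF openin_Q[OF sc]])
  have top: "topspace (subtopology XQ ?O) = ?O" using openin_subset[OF O] by (auto simp: topspace_subtopology)
  have in_ball: "qcoord F e \<omega> \<in> ball 0 e" if \<omega>: "\<omega> \<in> ?O" for \<omega>
    using \<omega> orb_slice(2,3)[OF sc] by force
  have "openin (subtopology XQ ?O) {\<omega> \<in> topspace (subtopology XQ ?O). qcoord F e \<omega> \<in> W}" if W: "open W" for W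
  proof -
    have eq: "{\<omega> \<in> ?O. qcoord F e \<omega> \<in> W} = orb ` ({p \<in> Q. fst (snd (\<kappa> p)) \<in> W} \<inter> N)"
    proof (intro subset_antisym subsetI)
      fix \<omega> assume "\<omega> \<in> {\<omega> \<in> ?O. qcoord F e \<omega> \<in> W}"
      then obtain p where p: "p \<in> Q \<inter> N" "\<omega> = orb p" "qcoord F e (orb p) \<in> W" by blast
      then show "\<omega> \<in> orb ` ({p \<in> Q. fst (snd (\<kappa> p)) \<in> W} \<inter> N)" using orb_slice(3)[OF sc p(1)] by auto
    next
      fix \<omega> assume "\<omega> \<in> orb ` ({p \<in> Q. fst (snd (\<kappa> p)) \<in> W} \<inter> N)"
      then obtain p where p: "p \<in> Q \<inter> N" "\<omega> = orb p" "fst (snd (\<kappa> p)) \<in> W" by blast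
      then show "\<omega> \<in> {\<omega> \<in> ?O. qcoord F e \<omega> \<in> W}" using orb_slice(3)[OF sc p(1)] by auto
    qed
    have "openin XQ {\<omega> \<in> ?O. qcoord F e \<omega> \<in> W}"
      unfolding eq by (rule openin_qchart[OF smooth_to_open_preimage[OF smooth_to_slice_coord[OF sc] W]])
    then show ?thesis unfolding top openin_open_subtopology[OF O] by blast
  qed
  then have "continuous_map (subtopology XQ ?O) euclidean (qcoord F e)"
    by (simp add: continuous_map_def)
  then show "continuous_map (subtopology XQ ?O) (top_of_set (ball 0 e)) (qcoord F e)"
    by (rule continuous_map_into_subtopology) (use in_ball top in auto)
  have "continuous_map (top_of_set (ball 0 e)) XN (\<lambda>y. F (0, y, 0))"
    unfolding XN_def
    by (rule continuous_map_into_subtopology[OF smooth_from_continuous_map[OF smooth_from_slice[OF sliceD[OF sc]]]])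
      (use slice_point(1)[OF sc] in auto)
  from continuous_map_compose[OF this quotient_imp_continuous_map[OF quotient_orb]]
  have "continuous_map (top_of_set (ball 0 e)) XQ (\<lambda>y. orb (F (0, y, 0)))" by (simp add: o_def)
  then show "continuous_map (top_of_set (ball 0 e)) (subtopology XQ ?O) (\<lambda>y. orb (F (0, y, 0)))"
    by (rule continuous_map_into_subtopology) (use slice_point(1)[OF sc] in auto)
  show "orb (F (0, qcoord F e \<omega>, 0)) = \<omega>" if "\<omega> \<in> topspace (subtopology XQ ?O)" for \<omega>
  proof -
    obtain p where p: "p \<in> Q \<inter> N" "\<omega> = orb p" using \<open>\<omega> \<in> topspace (subtopology XQ ?O)\<close> unfolding top by blast
    show ?thesis unfolding p(2) orb_slice(3)[OF sc p(1)] by (rule orb_slice(1)[OF sc p(1), symmetric])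
  qed
  show "qcoord F e (orb (F (0, y, 0))) = y" if "y \<in> ball 0 e" for y
    by (rule slice_point(2)[OF sc that])
qed

lemma act_into_chart:
  assumes p: "p \<in> N" and orb: "orb p \<in> orb ` (Q \<inter> N)"
  obtains t where "t \<in> carrier torus" "act t p \<in> Q \<inter> N"
proof -
  obtain w where w: "w \<in> Q \<inter> N" "orb p = orb w" using orb by blast
  then obtain t where "t \<in> carrier torus" "act t p = w" using orb_eq_iff[OF p] by blast
  then show thesis using that w(1) by blast
qed

lemma qcoord_act:
  assumes sc: "slice_coordinates s F e Q \<kappa>" and p: "p \<in> N" and t: "t \<in> carrier torus" "act t p \<in> Q"
  shows "orb p \<in> orb ` (Q \<inter> N)" "qcoord F e (orb p) = fst (snd (\<kappa> (act t p)))"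
proof -
  have tp: "act t p \<in> Q \<inter> N" using act_N[OF t(1) p] t(2) by simp
  have eq: "orb p = orb (act t p)" using orb_eq_iff[of p "act t p"] p tp t(1) by blast
  show "orb p \<in> orb ` (Q \<inter> N)" unfolding eq using tp by (rule imageI)
  show "qcoord F e (orb p) = fst (snd (\<kappa> (act t p)))" unfolding eq by (rule orb_slice(3)[OF sc tp])
qed

text \<open>Near a given parameter one fixed group element carries \<open>S y\<close> into
  \<open>Q\<close> without changing its orbit, and there the quotient coordinate is a component of
  \<open>\<kappa>\<close>. This covers both the changes of quotient charts and the orbit
  map.\<close>

lemma smooth_into_quotient:
  fixes S :: "'c::euclidean_space \<Rightarrow> 'p"
  assumes S: "smooth_from X A B S" and SN: "\<And>y. y \<in> B \<Longrightarrow> S y \<in> N"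
    and sc: "slice_coordinates s F e Q \<kappa>"
  shows "open {y \<in> B. orb (S y) \<in> orb ` (Q \<inter> N)}"
    and "smooth_on {y \<in> B. orb (S y) \<in> orb ` (Q \<inter> N)} (\<lambda>y. qcoord F e (orb (S y)))"
proof -
  let ?B = "{y \<in> B. orb (S y) \<in> orb ` (Q \<inter> N)}"
  have loc: "\<exists>T. open T \<and> y \<in> T \<and> T \<subseteq> ?B \<and> smooth_on T (\<lambda>y. qcoord F e (orb (S y)))" if y: "y \<in> ?B" for y
  proof -
    have yB: "y \<in> B" "orb (S y) \<in> orb ` (Q \<inter> N)" using y by simp_all
    obtain t where t: "t \<in> carrier torus" "act t (S y) \<in> Q \<inter> N"
      using act_into_chart[OF SN[OF yB(1)] yB(2)] by blast
    let ?T = "{y \<in> B. act t (S y) \<in> Q}"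
    note tf = smooth_to_from[OF smooth_to_slice_coord[OF sc] smooth_from_act[OF S t(1)]]
    have T: "orb (S z) \<in> orb ` (Q \<inter> N)" "qcoord F e (orb (S z)) = fst (snd (\<kappa> (act t (S z))))" if "z \<in> ?T" for z
      using qcoord_act[OF sc SN t(1), of z] that by simp_all
    have "smooth_on ?T (\<lambda>y. qcoord F e (orb (S y)))" by (rule smooth_on_eqI[OF tf]) (rule T(2))
    moreover have "y \<in> ?T" using yB t by simp
    moreover have "?T \<subseteq> ?B" using T(1) by blast
    ultimately show ?thesis using tf(1) by blast
  qed
  show "open ?B"
  proof (subst open_subopen, intro ballI)
    fix y assume "y \<in> ?B"
    from loc[OF this] show "\<exists>T. open T \<and> y \<in> T \<and> T \<subseteq> ?B" by blast
  qed
  show "smooth_on ?B (\<lambda>y. qcoord F e (orb (S y)))" 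
  proof (rule smooth_on_local)
    fix y assume "y \<in> ?B"
    from loc[OF this] show "\<exists>T. open T \<and> y \<in> T \<and> smooth_on T (\<lambda>y. qcoord F e (orb (S y)))" by blast
  qed
qed

lemma manifold_quotient: "smooth_manifold XQ AQ"
  unfolding smooth_manifold_def
proof (intro conjI ballI)
  show "Hausdorff_space XQ" by (rule Hausdorff_XQ)
  show "second_countable XQ" by (rule second_countable_XQ)
  fix c assume "c \<in> AQ"
  then obtain F e Q \<kappa> where sc: "slice_coordinates s F e Q \<kappa>" "c = qchart F e Q" by (rule AQ_cases)
  show "openin XQ (fst c)" using openin_qchart[OF openin_Q[OF sc(1)]] by (simp add: sc(2) qchart_def)
  show "open (chart_image c)" by (simp add: sc(2) qchart_image[OF sc(1)])
  show "homeomorphic_map (subtopology XQ (fst c)) (top_of_set (chart_image c)) (snd c)"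
    using qchart_homeo[OF sc(1)] unfolding sc(2) qchart_image[OF sc(1)] by (simp add: qchart_def)
  fix c' assume "c' \<in> AQ"
  then obtain F' e' Q' \<kappa>' where sc': "slice_coordinates s F' e' Q' \<kappa>'" "c' = qchart F' e' Q'" by (rule AQ_cases)
  have dom: "coord_dom c c' id = {y \<in> ball 0 e. orb (F (0, y, 0)) \<in> orb ` (Q' \<inter> N)}"
    unfolding sc(2) coord_qchart(1)[OF sc(1)] by (simp add: sc'(2) qchart_def)
  have "F (0, y, 0) \<in> N" if "y \<in> ball 0 e" for y using slice_point(1)[OF sc(1) that] by blast
  note sm = smooth_into_quotient[OF smooth_from_slice[OF sliceD[OF sc(1)]] this sc'(1)]
  show "smooth_on (coord_dom c c' id) (coord_rep c c' id)"
    unfolding dom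
  proof (rule smooth_on_eqI[OF sm])
    fix y assume "y \<in> {y \<in> ball 0 e. orb (F (0, y, 0)) \<in> orb ` (Q' \<inter> N)}"
    then have y: "y \<in> ball 0 e" by simp
    show "coord_rep c c' id y = qcoord F' e' (orb (F (0, y, 0)))"
      unfolding sc(2) coord_qchart(2)[OF sc(1) y] by (simp add: sc'(2) qchart_def)
  qed
next
  show "(\<Union>c\<in>AQ. fst c) = topspace XQ"
  proof (intro subset_antisym subsetI)
    fix \<omega> assume "\<omega> \<in> (\<Union>c\<in>AQ. fst c)"
    then obtain c where "c \<in> AQ" "\<omega> \<in> fst c" by blast
    then show "\<omega> \<in> topspace XQ" by (elim AQ_cases) (auto simp: qchart_def topspace_XQ)
  next
    fix \<omega> assume "\<omega> \<in> topspace XQ"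
    then obtain p where p: "p \<in> N" "\<omega> = orb p" by (auto simp: topspace_XQ)
    then obtain F e Q \<kappa> where sc: "slice_coordinates s F e Q \<kappa>" "p \<in> Q"
      using slice_coordinates_exist[OF regular] unfolding N_def by blast
    have "qchart F e Q \<in> AQ" unfolding AQ_def using sc(1) by blast
    moreover have "\<omega> \<in> fst (qchart F e Q)" using sc(2) p by (simp add: qchart_def)
    ultimately show "\<omega> \<in> (\<Union>c\<in>AQ. fst c)" by (rule UN_I)
  qed
qed

text \<open>A slice of the target chart, translated by a group element so as to pass through
  \<open>par F x\<close>, is a local section of the orbit map; its derivative is a right
  inverse.\<close>

lemma submersion_orb: "smooth_submersion XN AN XQ AQ orb"
  unfolding smooth_submersion_def smooth_map_def
proof (intro conjI ballI)
  show "continuous_map XN XQ orb" by (rule quotient_imp_continuous_map[OF quotient_orb])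
  fix c c' assume "c \<in> AN" "c' \<in> AQ"
  then obtain F e Q \<kappa> F' e' Q' \<kappa>' where sc: "slice_coordinates s F e Q \<kappa>" "c = nchart Q \<kappa>"
    and sc': "slice_coordinates s F' e' Q' \<kappa>'" "c' = qchart F' e' Q'" by (elim AN_cases AQ_cases)
  let ?dom = "{x \<in> pdom e. orb (par F x) \<in> orb ` (Q' \<inter> N)}" and ?R = "\<lambda>x. qcoord F' e' (orb (par F x))"
  have dom: "coord_dom c c' orb = ?dom"
    unfolding sc(2) coord_nchart(1)[OF sc(1)] by (simp add: sc'(2) qchart_def)
  have rep: "coord_rep c c' orb x = ?R x" if "x \<in> ?dom" for x
    using that by (simp add: sc(2) coord_nchart(2)[OF sc(1)] sc'(2) qchart_def)
  have SN: "par F x \<in> N" if "x \<in> pdom e" for x using par_in[OF sc(1) that] by blast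
  note sm = smooth_into_quotient[OF smooth_from_par[OF sc(1)] SN sc'(1)]
  show "smooth_on (coord_dom c c' orb) (coord_rep c c' orb)"
    unfolding dom by (rule smooth_on_eqI[OF sm rep])
  fix x assume "x \<in> coord_dom c c' orb"
  then have x: "x \<in> ?dom" unfolding dom .
  have xp: "x \<in> pdom e" "orb (par F x) \<in> orb ` (Q' \<inter> N)" using x by simp_all
  have eq: "frechet_derivative (coord_rep c c' orb) (at x) = frechet_derivative ?R (at x)"
    by (rule frechet_derivative_cong_open[OF sm(1) x rep])
  obtain w where w: "w \<in> Q' \<inter> N" "orb (par F x) = orb w" using xp(2) by blast
  define y where "y = fst (snd (\<kappa>' w))"
  have y: "y \<in> ball 0 e'" "orb (par F x) = orb (F' (0, y, 0))" "qcoord F' e' (orb w) = y"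
    using orb_slice[OF sc'(1) w(1)] w(2) by (simp_all add: y_def)
  have S'N: "F' (0, z, 0) \<in> N" if "z \<in> ball 0 e'" for z using slice_point(1)[OF sc'(1) that] by blast
  obtain t where t: "t \<in> carrier torus" "act t (F' (0, y, 0)) = par F x"
    using orb_eq_iff[OF S'N[OF y(1)] SN[OF xp(1)]] y(2) by metis
  let ?S = "\<lambda>z. act t (F' (0, z, 0))"
  have S: "smooth_from X A (ball 0 e') ?S" by (rule smooth_from_act[OF smooth_from_slice[OF sliceD[OF sc'(1)]] t(1)])
  let ?T = "{z \<in> ball 0 e'. ?S z \<in> Q}" and ?x = "\<lambda>z. ncoord \<kappa> (?S z)"
  note tf = smooth_to_from[OF smooth_to_ncoord[OF sc(1)] S]
  have yT: "y \<in> ?T" using y(1) t(2) par_in[OF sc(1) xp(1)] by simp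
  have xy: "?x y = x" using t(2) ncoord_par[OF sc(1) xp(1)] by simp
  have Rx: "?R (?x z) = z" if z: "z \<in> ?T" for z
  proof -
    have zb: "z \<in> ball 0 e'" "?S z \<in> Q" using z by simp_all
    have "?S z \<in> N" by (rule act_N[OF t(1) S'N[OF zb(1)]])
    then have SQ: "?S z \<in> Q \<inter> N" using zb(2) by blast
    have "orb (?S z) = orb (F' (0, z, 0))"
      using orb_eq_iff[OF S'N[OF zb(1)] \<open>?S z \<in> N\<close>] t(1) by blast
    then show ?thesis by (simp only: par_ncoord[OF sc(1) SQ] slice_point(2)[OF sc'(1) zb(1)])
  qed
  have dR: "(?R has_derivative frechet_derivative ?R (at x)) (at (?x y))"
    using smooth_on_has_derivative[OF sm(2) x] by (simp add: xy)
  have "((\<lambda>z. z) has_derivative (\<lambda>v. frechet_derivative ?R (at x) (frechet_derivative ?x (at y) v))) (at y)"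
    by (rule has_derivative_transform_within_open[OF
          has_derivative_compose[OF smooth_on_has_derivative[OF tf(2) yT] dR] tf(1) yT Rx])
  then have "(\<lambda>v. frechet_derivative ?R (at x) (frechet_derivative ?x (at y) v)) = (\<lambda>v. v)"
    using has_derivative_unique has_derivative_ident by blast
  then have "frechet_derivative ?R (at x) (frechet_derivative ?x (at y) v) = v" for v by (rule fun_cong)
  then show "surj (frechet_derivative (coord_rep c c' orb) (at x))" unfolding eq by (rule surjI)
qed

end

theorem proposition3p3:
  fixes X :: "'p topology"
    and A :: "('p, real ^ 6) chart set"
    and g :: "('p, real ^ 6, real) tensor"
    and J :: "('p, real ^ 6) endo"
    and \<Psi> :: "('p, real ^ 6, complex) tensor"
    and act :: "complex \<times> complex \<Rightarrow> 'p \<Rightarrow> 'p"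
    and \<xi> \<eta> :: "real \<times> real"
    and U V :: "('p, real ^ 6) vfield"
    and \<nu> :: "'p \<Rightarrow> real"
  assumes "smooth_manifold X A" and "compact_space X" and "connected_space X"
    and "nearly_kaehler A g J \<Psi>"
    and "smooth_effective_torus_action X A act"
    and "\<And>t. t \<in> carrier torus \<Longrightarrow>
           preserves_tensor A (act t) 2 g \<and> preserves_endo A (act t) J \<and>
           preserves_tensor A (act t) 3 (re_part \<Psi>) \<and> preserves_tensor A (act t) 3 (im_part \<Psi>)"
    and "\<xi> \<noteq> \<eta>" and "independent {\<xi>, \<eta>}"
    and "U = generating_field act \<xi>" and "V = generating_field act \<eta>"
    and "\<nu> = multi_moment A (fund_form g J) U V"
  shows "(\<exists>s. s \<noteq> 0 \<and> regular_value X A \<nu> s) \<and>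
    (\<forall>s. regular_value X A \<nu> s \<longrightarrow>
       (let N = level_set X \<nu> s;
            XN = subtopology X N;
            Q = quotient_topology XN (orbit torus act)
        in (\<forall>t\<in>carrier torus. act t ` N = N) \<and>
           (\<forall>p\<in>N. stabilizer torus act p = {\<one>\<^bsub>torus\<^esub>}) \<and>
           (\<exists>(AN :: ('p, real ^ 5) chart set) (AQ :: ('p set, real ^ 3) chart set).
              smooth_manifold XN AN \<and> smooth_immersion XN AN X A (\<lambda>p. p) \<and>
              smooth_manifold Q AQ \<and> smooth_submersion XN AN Q AQ (orbit torus act))))"
proof -
  interpret K: nearly_kaehler_torus X A act g J \<Psi> \<xi> \<eta>
    by unfold_locales (use assms in blast)+
  have \<nu>: "\<nu> = K.\<nu>" by (simp add: assms(9-11) K.\<nu>_def K.\<sigma>_def K.U_def K.V_def)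
  have "let N = level_set X \<nu> s;
            XN = subtopology X N;
            Q = quotient_topology XN (orbit torus act)
        in (\<forall>t\<in>carrier torus. act t ` N = N) \<and>
           (\<forall>p\<in>N. stabilizer torus act p = {\<one>\<^bsub>torus\<^esub>}) \<and>
           (\<exists>(AN :: ('p, real ^ 5) chart set) (AQ :: ('p set, real ^ 3) chart set).
              smooth_manifold XN AN \<and> smooth_immersion XN AN X A (\<lambda>p. p) \<and>
              smooth_manifold Q AQ \<and> smooth_submersion XN AN Q AQ (orbit torus act))"
    if s: "regular_value X A \<nu> s" for s
  proof -
    \<comment> \<open>Two orbit directions and three slice directions make up the dimension of the
      level set.\<close>
    have "DIM((real \<times> real) \<times> (real ^ 3)) = DIM(real ^ 5)" by simp
    then obtain i5 :: "(real \<times> real) \<times> (real ^ 3) \<Rightarrow> real ^ 5" and j5 where i5: "linear i5" "linear j5"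
      "\<And>z. norm (i5 z) = norm z" "\<And>x. norm (j5 x) = norm x" "\<And>z. j5 (i5 z) = z" "\<And>x. i5 (j5 x) = x"
      by (rule isomorphisms_UNIV_UNIV) (rule that)
    interpret L: nearly_kaehler_torus_level X A act g J \<Psi> \<xi> \<eta> s i5 j5
      by (rule nearly_kaehler_torus_level.intro[OF K.nearly_kaehler_torus_axioms
            nearly_kaehler_torus_level_axioms.intro[OF s[unfolded \<nu>] i5(1,2,5,6)]])
    have N: "level_set X \<nu> s = L.N" unfolding \<nu> by (rule L.N_def[symmetric])
    show ?thesis
      unfolding Let_def N L.XN_def[symmetric] L.XQ_def[symmetric]
      using L.act_image_N L.stabilizer_N
      by (intro conjI ballI exI[of _ L.AN] exI[of _ L.AQ] L.manifold_N L.immersion_N L.manifold_quotient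
          L.submersion_orb)
  qed
  then show ?thesis using K.ex_nonzero_regular_value by (simp add: \<nu>)
qed

end
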